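(* Let $P$ be a set of $n\geq 5$ points in general position in the plane. Then $\mu(D(P))\geq \binom{n}{2}-9$.
   Context: A set of points in the plane is in general position if no three of its points are collinear. The disjointness graph of segments $D(P)$ is the graph whose vertices are all closed straight-line segments with both endpoints in $P$, two being adjacent if and only if they are disjoint. For a graph $G$ and $U\subseteq V(G)$, two distinct vertices $x,y\in U$ are $U$-mutually visible if $G$ contains a shortest $x$-$y$ path none of whose internal vertices lies in $U$; $U$ is a mutual-visibility set if every two distinct vertices of $U$ are $U$-mutually visible. The mutual-visibility number $\mu(G)$ is the maximum size of a mutual-visibility set of $G$. *)

theory Defs
  imports "HOL-Analysis.Analysis"
begin

definition general_position :: "(real^2) set \<Rightarrow> bool" where
  "general_position P \<longleftrightarrow>
     (\<forall>a\<in>P. \<forall>b\<in>P. \<forall>c\<in>P. a \<noteq> b \<and> a \<noteq> c \<and> b \<noteq> c \<longrightarrow> \<not> collinear {a, b, c})"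

(* Vertices of D(P): segments with both endpoints in P, represented by their
   (2-element) endpoint set; the segment itself is the closed segment. *)
definition seg_vertices :: "(real^2) set \<Rightarrow> (real^2) set set" where
  "seg_vertices P = {{a, b} | a b. a \<in> P \<and> b \<in> P \<and> a \<noteq> b}"

definition seg_of :: "(real^2) set \<Rightarrow> (real^2) set" where
  "seg_of s = convex hull s"

definition disj_adj :: "(real^2) set \<Rightarrow> (real^2) set \<Rightarrow> bool" where
  "disj_adj s t \<longleftrightarrow> seg_of s \<inter> seg_of t = {}"

definition walk :: "'v set \<Rightarrow> ('v \<Rightarrow> 'v \<Rightarrow> bool) \<Rightarrow> 'v list \<Rightarrow> bool" where
  "walk V E xs \<longleftrightarrow> xs \<noteq> [] \<and> set xs \<subseteq> V \<and>
     (\<forall>i. Suc i < length xs \<longrightarrow> E (xs ! i) (xs ! Suc i))"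

definition shortest_path :: "'v set \<Rightarrow> ('v \<Rightarrow> 'v \<Rightarrow> bool) \<Rightarrow> 'v \<Rightarrow> 'v \<Rightarrow> 'v list \<Rightarrow> bool" where
  "shortest_path V E x y xs \<longleftrightarrow> walk V E xs \<and> hd xs = x \<and> last xs = y \<and>
     (\<forall>ys. walk V E ys \<and> hd ys = x \<and> last ys = y \<longrightarrow> length xs \<le> length ys)"

definition mutually_visible :: "'v set \<Rightarrow> ('v \<Rightarrow> 'v \<Rightarrow> bool) \<Rightarrow> 'v set \<Rightarrow> 'v \<Rightarrow> 'v \<Rightarrow> bool" where
  "mutually_visible V E U x y \<longleftrightarrow>
     (\<exists>xs. shortest_path V E x y xs \<and> (\<forall>z \<in> set (butlast (tl xs)). z \<notin> U))"

definition mutual_visibility_set :: "'v set \<Rightarrow> ('v \<Rightarrow> 'v \<Rightarrow> bool) \<Rightarrow> 'v set \<Rightarrow> bool" where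
  "mutual_visibility_set V E U \<longleftrightarrow> U \<subseteq> V \<and>
     (\<forall>x\<in>U. \<forall>y\<in>U. x \<noteq> y \<longrightarrow> mutually_visible V E U x y)"

definition mu :: "'v set \<Rightarrow> ('v \<Rightarrow> 'v \<Rightarrow> bool) \<Rightarrow> nat" where
  "mu V E = Max {card U | U. mutual_visibility_set V E U}"

end

theory Submission
  imports Defs
begin

text \<open>
  It suffices to find at most nine segments \<open>W\<close> such that any two segments outside \<open>W\<close> that meet are both disjoint
  from a common member of \<open>W\<close>, or have no common neighbour at all and are joined by a path of length three through \<open>W\<close>.

  Call a pair of points a cap if a line separates it from all other points; segments avoiding its two points are
  disjoint from it. Hull edges are caps, and so is every hull vertex together with a suitable point of its ear (the
  triangle it spans with its hull neighbours) if the ear is not empty; if the ear is empty, the chord cutting it off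
  can only be met through the three corners. Four disjoint caps, together with four segments joining two of them, form
  a suitable \<open>W\<close>, which settles hulls with at least eight vertices and most cases with nonempty ears. The remaining
  configurations, with three to seven hull vertices, are settled by explicit sets \<open>W\<close>; these are combinatorial
  except for a few pairs of segments, and a verified checker goes through the pairs. Only for seven points in
  convex position do paths of length three occur: there \<open>W\<close> is the hull.\<close>

section \<open>Orientation and disjoint segments\<close>

text \<open>Two segments have at most four ends, and a cap with neither of its points among these
  ends is disjoint from both. So the caps in \<open>W\<close>, read as edges of a graph on the
  points, leave open only those pairs whose ends form a vertex cover of this graph. Four disjoint
  caps use up all four ends, one in each; a small hull offers too few disjoint caps, and smaller
  covers survive. Members of \<open>W\<close> then have a second use: a segment put into
  \<open>W\<close> no longer has to see anything, so one adds segments that join points of the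
  surviving covers. This is where nine comes from: several explicit sets consist of all pairs but
  one of five suitable points, the omitted pair being a cap or the chord of an empty ear; for six
  points in convex position the set consists of the nine diagonals.\<close>

definition ori :: "real^2 \<Rightarrow> real^2 \<Rightarrow> real^2 \<Rightarrow> real" where
  "ori a b c = (b$1 - a$1) * (c$2 - a$2) - (b$2 - a$2) * (c$1 - a$1)"

lemma ori_rot: "ori a b c = ori b c a"
  by (simp add: ori_def algebra_simps)

lemma ori_swap: "ori b a c = - ori a b c"
  by (simp add: ori_def algebra_simps)

lemma ori_same [simp]: "ori a b a = 0" "ori a a b = 0" "ori a b b = 0"
  by (simp_all add: ori_def)

lemma ori_affine: "u + v = 1 \<Longrightarrow> ori a b (u *\<^sub>R x + v *\<^sub>R y) = u * ori a b x + v * ori a b y"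
proof -
  assume "u + v = 1"
  then have v: "v = 1 - u" by simp
  show ?thesis unfolding v by (simp add: ori_def algebra_simps)
qed

lemma ori_zero_line:
  assumes "ori a b c = 0" "a \<noteq> b" obtains k where "c = (1 - k) *\<^sub>R a + k *\<^sub>R b"
proof -
  define d where "d = b - a"
  have d: "d \<noteq> 0" using assms by (simp add: d_def)
  have eq: "d$1 * (c - a)$2 = d$2 * (c - a)$1" using assms by (simp add: ori_def d_def)
  have "\<exists>k. c - a = k *\<^sub>R d"
  proof -
    have "d$1 \<noteq> 0 \<or> d$2 \<noteq> 0" using d by (auto simp: vec_eq_iff forall_2)
    then show ?thesis
    proof
      assume h: "d$1 \<noteq> 0"
      show ?thesis
        by (rule exI[of _ "(c - a)$1 / d$1"]) (use h eq in \<open>auto simp: vec_eq_iff forall_2 field_simps\<close>)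
    next
      assume h: "d$2 \<noteq> 0"
      show ?thesis
        by (rule exI[of _ "(c - a)$2 / d$2"]) (use h eq in \<open>auto simp: vec_eq_iff forall_2 field_simps\<close>)
    qed
  qed
  then obtain k where "c - a = k *\<^sub>R d" by blast
  then have "c = (1 - k) *\<^sub>R a + k *\<^sub>R b" by (simp add: d_def algebra_simps)
  then show thesis by (rule that)
qed

lemma ori_zero_collinear:
  assumes "ori a b c = 0" shows "collinear {a, b, c}"
proof (cases "a = b")
  case True then show ?thesis by (simp add: insert_commute)
next
  case False
  then obtain k where k: "c = (1 - k) *\<^sub>R a + k *\<^sub>R b" using ori_zero_line[OF assms] by blast
  have "c - a = k *\<^sub>R (b - a)" unfolding k by (simp add: algebra_simps)
  moreover have "collinear {a, b, c} \<longleftrightarrow> collinear {0, b - a, c - a}"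
    using collinear_3[of b a c] by (simp add: insert_commute)
  moreover have "collinear {0, b - a, k *\<^sub>R (b - a)}" by (auto simp: collinear_lemma)
  ultimately show ?thesis by simp
qed

section \<open>Disjointness and crossing of closed segments\<close>

definition dj :: "real^2 \<Rightarrow> real^2 \<Rightarrow> real^2 \<Rightarrow> real^2 \<Rightarrow> bool" where
  "dj p q r t \<longleftrightarrow> disj_adj {p, q} {r, t}"

lemma dj_flip1: "dj q p r t \<longleftrightarrow> dj p q r t"
  by (simp add: dj_def insert_commute)

lemma dj_flip2: "dj p q t r \<longleftrightarrow> dj p q r t"
  by (simp add: dj_def insert_commute)

lemma dj_sym: "dj r t p q \<longleftrightarrow> dj p q r t"
  by (auto simp: dj_def disj_adj_def)

lemma dj_I:
  assumes "\<And>u v u' v'. \<lbrakk>0 \<le> u; 0 \<le> v; u + v = 1; 0 \<le> u'; 0 \<le> v'; u' + v' = 1;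
     u *\<^sub>R p + v *\<^sub>R q = u' *\<^sub>R r + v' *\<^sub>R t\<rbrakk> \<Longrightarrow> False"
  shows "dj p q r t"
proof -
  have "convex hull {p,q} \<inter> convex hull {r,t} = {}"
  proof (rule equals0I)
    fix x assume "x \<in> convex hull {p,q} \<inter> convex hull {r,t}"
    then obtain u v u' v' where "0 \<le> u" "0 \<le> v" "u + v = 1" "0 \<le> u'" "0 \<le> v'" "u' + v' = 1"
      "x = u *\<^sub>R p + v *\<^sub>R q" "x = u' *\<^sub>R r + v' *\<^sub>R t" by (auto simp: convex_hull_2)
    with assms[of u v u' v'] show False by simp
  qed
  then show ?thesis by (simp add: dj_def disj_adj_def seg_of_def)
qed

text \<open>The factor \<open>k\<close> selects the side, so one lemma serves both orientations. The
  segment \<open>pq\<close> may touch the line \<open>ab\<close>; strictness for \<open>rt\<close>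
  is enough.\<close>

lemma dj_sep:
  assumes "0 \<le> k * ori a b p" "0 \<le> k * ori a b q" "k * ori a b r < 0" "k * ori a b t < 0"
  shows "dj p q r t"
proof (rule dj_I)
  fix u v u' v' :: real
  assume h: "0 \<le> u" "0 \<le> v" "u + v = 1" "0 \<le> u'" "0 \<le> v'" "u' + v' = 1"
     "u *\<^sub>R p + v *\<^sub>R q = u' *\<^sub>R r + v' *\<^sub>R t"
  have "u * ori a b p + v * ori a b q = u' * ori a b r + v' * ori a b t"
    using h ori_affine[of u v a b p q] ori_affine[of u' v' a b r t] by simp
  then have e: "u * (k * ori a b p) + v * (k * ori a b q) = u' * (k * ori a b r) + v' * (k * ori a b t)"
    by (metis (no_types, opaque_lifting) distrib_left mult.left_commute)
  have "0 \<le> u * (k * ori a b p) + v * (k * ori a b q)"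
    using h assms by simp
  moreover have "u' * (k * ori a b r) + v' * (k * ori a b t) < 0"
  proof (cases "u' = 0")
    case True then show ?thesis using h assms by simp
  next
    case False
    then have "u' * (k * ori a b r) < 0" using h assms(3) by (simp add: mult_pos_neg)
    moreover have "v' * (k * ori a b t) \<le> 0" using h assms(4) by (simp add: mult_nonneg_nonpos)
    ultimately show ?thesis by linarith
  qed
  ultimately show False using e by linarith
qed

text \<open>Both segments reach the line \<open>ab\<close>, from opposite sides and only in
  \<open>a\<close> and \<open>b\<close> respectively, which are different points.\<close>

lemma dj_sep0:
  assumes "a \<noteq> b" "0 < k * ori a b q" "k * ori a b t < 0"
  shows "dj a q b t"
proof (rule dj_I)
  fix u v u' v' :: real
  assume h: "0 \<le> u" "0 \<le> v" "u + v = 1" "0 \<le> u'" "0 \<le> v'" "u' + v' = 1"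
     "u *\<^sub>R a + v *\<^sub>R q = u' *\<^sub>R b + v' *\<^sub>R t"
  have "v * ori a b q = v' * ori a b t"
    using h ori_affine[of u v a b a q] ori_affine[of u' v' a b b t] by simp
  then have e: "v * (k * ori a b q) = v' * (k * ori a b t)"
    by (metis mult.left_commute)
  have "v = 0"
  proof (rule ccontr)
    assume "v \<noteq> 0"
    then have "0 < v * (k * ori a b q)" using h assms by simp
    moreover have "v' * (k * ori a b t) \<le> 0" using h assms by (simp add: mult_nonneg_nonpos)
    ultimately show False using e by linarith
  qed
  moreover have "v' = 0" using e \<open>v = 0\<close> assms(3) by auto
  ultimately show False using h assms by simp
qed

text \<open>The signed distances of the ends from the other line are, up to scaling, the weights of
  the intersection point on each segment; \<open>x\<close> and \<open>y\<close> are its two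
  expressions.\<close>

lemma not_djI:
  assumes "0 < k * ori a b c" "k * ori a b d < 0" "0 < l * ori c d a" "l * ori c d b < 0"
  shows "\<not> dj a b c d"
proof -
  define A where "A = k * ori a b c" 
  define B where "B = - (k * ori a b d)"
  define C where "C = l * ori c d a"
  define D where "D = - (l * ori c d b)"
  have pos: "0 < A" "0 < B" "0 < C" "0 < D" using assms by (auto simp: A_def B_def C_def D_def)
  have kl: "k \<noteq> 0" "l \<noteq> 0" using assms by auto
  have ABe: "A + B = k * (ori a b c - ori a b d)" and CDe: "C + D = l * (ori c d a - ori c d b)"
    by (simp_all add: A_def B_def C_def D_def algebra_simps)
  have ne: "ori a b c - ori a b d \<noteq> 0" "ori c d a - ori c d b \<noteq> 0"
    using ABe CDe pos by auto
  have opp: "ori c d a - ori c d b = - (ori a b c - ori a b d)"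
    by (simp add: ori_def algebra_simps)
  define x where "x = (D / (C + D)) *\<^sub>R a + (C / (C + D)) *\<^sub>R b"
  define y where "y = (B / (A + B)) *\<^sub>R c + (A / (A + B)) *\<^sub>R d"
  define N where "N = ori a b c - ori a b d"
  have N: "N \<noteq> 0" using ne by (simp add: N_def)
  have f1: "D / (C + D) = ori c d b / N" "C / (C + D) = - ori c d a / N"
  proof -
    have "C + D = - (l * N)" unfolding CDe opp N_def by (simp add: algebra_simps)
    then show "D / (C + D) = ori c d b / N" "C / (C + D) = - ori c d a / N"
      unfolding C_def D_def using kl N by simp_all
  qed
  have f2: "B / (A + B) = - ori a b d / N" "A / (A + B) = ori a b c / N"
  proof -
    have "A + B = k * N" unfolding ABe N_def by simp
    then show "B / (A + B) = - ori a b d / N" "A / (A + B) = ori a b c / N"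
      unfolding A_def B_def using kl N by simp_all
  qed
  \<comment> \<open>Multiplied by the common denominator \<open>N\<close>, the equality of the two
    expressions becomes a polynomial identity.\<close>
  have "N * (x $ i) = N * (y $ i)" for i
  proof -
    have "N * (x $ i) = ori c d b * a $ i - ori c d a * b $ i"
      unfolding x_def f1 using N by (simp add: field_simps)
    moreover have "N * (y $ i) = - ori a b d * c $ i + ori a b c * d $ i"
      unfolding y_def f2 using N by (simp add: field_simps)
    moreover have "ori c d b * a $ i - ori c d a * b $ i = - ori a b d * c $ i + ori a b c * d $ i"
      using exhaust_2[of i] by (auto simp: ori_def algebra_simps)
    ultimately show ?thesis by simp
  qed
  then have "x = y" using N by (simp add: vec_eq_iff)
  moreover have "x \<in> convex hull {a, b}"
  proof -
    have "0 \<le> D / (C + D)" "0 \<le> C / (C + D)" "D / (C + D) + C / (C + D) = 1"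
      using pos by (auto simp: add_divide_distrib[symmetric])
    then show ?thesis unfolding convex_hull_2 x_def by blast
  qed
  moreover have "y \<in> convex hull {c, d}"
  proof -
    have "0 \<le> B / (A + B)" "0 \<le> A / (A + B)" "B / (A + B) + A / (A + B) = 1"
      using pos by (auto simp: add_divide_distrib[symmetric])
    then show ?thesis unfolding convex_hull_2 y_def by blast
  qed
  ultimately show ?thesis by (auto simp: dj_def disj_adj_def seg_of_def)
qed

lemma dj_share: "\<not> dj p q p r" "\<not> dj p q r p" "\<not> dj q p p r" "\<not> dj q p r p"
  by (auto simp: dj_def disj_adj_def seg_of_def intro: hull_inc)

section \<open>From a witness set \<open>W\<close> to the bound on \<open>mu\<close>\<close>

lemma seg_vertices_eq: "seg_vertices P = {A. A \<subseteq> P \<and> card A = 2}"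
  by (auto simp: seg_vertices_def card_2_iff)

text \<open>The complement of \<open>W\<close> is the mutual-visibility set: each alternative in
  \<open>vis\<close> supplies a geodesic of one, two or three edges whose inner vertices lie in
  \<open>W\<close>.\<close>

lemma mu_lower_bound:
  fixes P :: "(real^2) set"
  assumes fin: "finite P" and W: "W \<subseteq> seg_vertices P" "card W \<le> 9"
    and vis: "\<And>x y. \<lbrakk>x \<in> seg_vertices P; y \<in> seg_vertices P; x \<notin> W; y \<notin> W; x \<noteq> y\<rbrakk> \<Longrightarrow>
      disj_adj x y \<or> (\<exists>w\<in>W. disj_adj x w \<and> disj_adj w y) \<or>
      ((\<forall>z\<in>seg_vertices P. \<not> (disj_adj x z \<and> disj_adj z y)) \<and>
       (\<exists>e\<in>W. \<exists>f\<in>W. disj_adj x e \<and> disj_adj e f \<and> disj_adj f y))"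
  shows "int (mu (seg_vertices P) disj_adj) \<ge> int (card P choose 2) - 9"
proof -
  let ?V = "seg_vertices P"
  have finV: "finite ?V" using fin by (simp add: seg_vertices_eq)
  have cardV: "card ?V = card P choose 2"
    using n_subsets[OF fin, of 2] by (simp add: seg_vertices_eq)
  define U where "U = ?V - W"
  have walk1: "x = y" if "walk ?V disj_adj ys" "hd ys = x" "last ys = y" "length ys \<le> 1" for x y ys
    using that by (cases ys) (auto simp: walk_def)
  have walk2: "x = y \<or> disj_adj x y" if "walk ?V disj_adj ys" "hd ys = x" "last ys = y" "length ys \<le> 2" for x y ys
  proof (cases ys)
    case Nil then show ?thesis using that by (simp add: walk_def)
  next
    case (Cons a zs)
    show ?thesis
    proof (cases zs)
      case Nil then show ?thesis using that Cons by simp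
    next
      case (Cons b r)
      then have "ys = [a, b]" using that \<open>ys = a # zs\<close> by simp
      then show ?thesis using that by (auto simp: walk_def)
    qed
  qed
  have walk3: "x = y \<or> disj_adj x y \<or> (\<exists>z\<in>?V. disj_adj x z \<and> disj_adj z y)"
    if w: "walk ?V disj_adj ys" "hd ys = x" "last ys = y" "length ys \<le> 3" for x y ys
  proof (cases "length ys \<le> 2")
    case True then show ?thesis using walk2 w by blast
  next
    case False
    then have "length ys = Suc (Suc (Suc 0))" using w by simp
    then obtain a b c where ys: "ys = [a, b, c]" by (auto simp: length_Suc_conv)
    then have "disj_adj (ys ! 0) (ys ! Suc 0)" "disj_adj (ys ! Suc 0) (ys ! Suc (Suc 0))"
      using w by (auto simp: walk_def)
    then show ?thesis using w ys by (auto simp: walk_def)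
  qed
  have "mutually_visible ?V disj_adj U x y" if x: "x \<in> U" and y: "y \<in> U" and "x \<noteq> y" for x y
  proof -
    have m: "x \<in> ?V" "y \<in> ?V" "x \<notin> W" "y \<notin> W" using x y by (auto simp: U_def)
    consider (a) "disj_adj x y" | (b) w where "\<not> disj_adj x y" "w \<in> W" "disj_adj x w" "disj_adj w y"
      | (c) e f where "\<not> disj_adj x y" "\<forall>z\<in>?V. \<not> (disj_adj x z \<and> disj_adj z y)" "e \<in> W" "f \<in> W"
          "disj_adj x e" "disj_adj e f" "disj_adj f y"
      using vis[OF m \<open>x \<noteq> y\<close>] by blast
    then show ?thesis
    proof cases
      case a
      have "2 \<le> length ys" if "walk ?V disj_adj ys" "hd ys = x" "last ys = y" for ys
        using walk1[OF that] \<open>x \<noteq> y\<close> by linarith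
      moreover have "walk ?V disj_adj [x, y]" using a m by (auto simp: walk_def less_Suc_eq)
      ultimately show ?thesis unfolding mutually_visible_def shortest_path_def
        by (intro exI[of _ "[x, y]"]) (auto simp: numeral_2_eq_2)
    next
      case b
      have "3 \<le> length ys" if "walk ?V disj_adj ys" "hd ys = x" "last ys = y" for ys
        using walk2[OF that] \<open>x \<noteq> y\<close> b by linarith
      moreover have "walk ?V disj_adj [x, w, y]" using b m W by (auto simp: walk_def less_Suc_eq)
      ultimately show ?thesis unfolding mutually_visible_def shortest_path_def
        using b by (intro exI[of _ "[x, w, y]"]) (auto simp: U_def numeral_3_eq_3)
    next
      case c
      have "4 \<le> length ys" if "walk ?V disj_adj ys" "hd ys = x" "last ys = y" for ys
        using walk3[OF that] \<open>x \<noteq> y\<close> c by force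
      moreover have "walk ?V disj_adj [x, e, f, y]" using c m W by (auto simp: walk_def less_Suc_eq)
      ultimately show ?thesis unfolding mutually_visible_def shortest_path_def
        using c by (intro exI[of _ "[x, e, f, y]"]) (auto simp: U_def eval_nat_numeral)
    qed
  qed
  then have "mutual_visibility_set ?V disj_adj U"
    by (auto simp: mutual_visibility_set_def U_def)
  moreover have "finite {card U | U. mutual_visibility_set ?V disj_adj U}"
  proof (rule finite_subset)
    show "{card U | U. mutual_visibility_set ?V disj_adj U} \<subseteq> card ` Pow ?V"
      by (auto simp: mutual_visibility_set_def)
  qed (use finV in simp)
  ultimately have "card U \<le> mu ?V disj_adj" unfolding mu_def by (intro Max_ge) auto
  moreover have "card U = card ?V - card W"
    unfolding U_def using W finV by (intro card_Diff_subset) (auto intro: finite_subset)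
  moreover have "card W \<le> card ?V" using W finV by (intro card_mono) auto
  ultimately show ?thesis using W cardV by linarith
qed

definition meets_bound :: "(real^2) set \<Rightarrow> bool" where
  "meets_bound P \<longleftrightarrow> int (mu (seg_vertices P) disj_adj) \<ge> int (card P choose 2) - 9"

text \<open>The last disjunct is distance exactly three: no common neighbour exists, inside or outside \<open>W\<close>.\<close>
definition linked :: "(real^2) set \<Rightarrow> ((real^2) \<times> (real^2)) set \<Rightarrow> real^2 \<Rightarrow> real^2 \<Rightarrow> real^2 \<Rightarrow> real^2 \<Rightarrow> bool" where
  "linked P W p q r t \<longleftrightarrow> dj p q r t \<or> (\<exists>(a, b) \<in> W. dj p q a b \<and> dj r t a b) \<or>
     (\<forall>a\<in>P. \<forall>b\<in>P. a \<noteq> b \<longrightarrow> \<not> (dj p q a b \<and> dj r t a b)) \<and>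
     (\<exists>(a, b) \<in> W. \<exists>(c, d) \<in> W. dj p q a b \<and> dj a b c d \<and> dj r t c d)"

lemma linked_commute: "linked P W r t p q \<longleftrightarrow> linked P W p q r t"
proof -
  have "linked P W r t p q" if lk: "linked P W p q r t" for p q r t
  proof -
    consider "dj p q r t" | "\<exists>(a, b) \<in> W. dj p q a b \<and> dj r t a b"
      | "\<forall>a\<in>P. \<forall>b\<in>P. a \<noteq> b \<longrightarrow> \<not> (dj p q a b \<and> dj r t a b)"
        "\<exists>(a, b) \<in> W. \<exists>(c, d) \<in> W. dj p q a b \<and> dj a b c d \<and> dj r t c d"
      using lk unfolding linked_def by argo
    then show ?thesis
    proof cases
      case 1 then show ?thesis by (simp add: linked_def dj_sym[of r t p q])
    next
      case 2 then show ?thesis unfolding linked_def by auto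
    next
      case 3
      from 3(2) obtain a b c d where "(a, b) \<in> W" "(c, d) \<in> W" "dj p q a b" "dj a b c d" "dj r t c d" by auto
      then have "\<exists>(a, b) \<in> W. \<exists>(c, d) \<in> W. dj r t a b \<and> dj a b c d \<and> dj p q c d"
        using dj_sym[of c d a b] by (intro bexI[of _ "(c, d)"] bexI[of _ "(a, b)"] case_prodI2) auto
      then show ?thesis using 3(1) unfolding linked_def by blast
    qed
  qed
  then show ?thesis by blast
qed

lemma linked_flip: "linked P W q p r t \<longleftrightarrow> linked P W p q r t"
  by (simp add: linked_def dj_flip1[of q p])

text \<open>The form in which all later witness sets are given. Segments are compared with the
  entries as two-element sets, so the order within an entry is immaterial, and repetitions only make
  the set smaller.\<close>

lemma pairs_witness:
  assumes fin: "finite P"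
    and W: "length W \<le> 9" "\<And>a b. (a, b) \<in> set W \<Longrightarrow> a \<in> P \<and> b \<in> P \<and> a \<noteq> b"
    and vis: "\<And>p q r t. \<lbrakk>p \<in> P; q \<in> P; r \<in> P; t \<in> P; p \<noteq> q; r \<noteq> t;
      \<forall>(a, b) \<in> set W. {p, q} \<noteq> {a, b}; \<forall>(a, b) \<in> set W. {r, t} \<noteq> {a, b}; {p, q} \<noteq> {r, t}\<rbrakk>
      \<Longrightarrow> linked P (set W) p q r t"
  shows "meets_bound P"
  unfolding meets_bound_def
proof (rule mu_lower_bound[OF fin])
  let ?W = "(\<lambda>(a, b). {a, b}) ` set W"
  show "?W \<subseteq> seg_vertices P"
  proof
    fix x assume "x \<in> ?W"
    then obtain a b where "(a, b) \<in> set W" "x = {a, b}" by auto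
    with W(2)[of a b] have "a \<in> P" "b \<in> P" "a \<noteq> b" "x = {a, b}" by simp_all
    then show "x \<in> seg_vertices P" unfolding seg_vertices_def by (intro CollectI exI[of _ a] exI[of _ b] conjI)
  qed
  show "card ?W \<le> 9" using W(1) card_image_le[of "set W" "\<lambda>(a, b). {a, b}"] card_length[of W] by simp
  fix x y assume xy: "x \<in> seg_vertices P" "y \<in> seg_vertices P" "x \<notin> ?W" "y \<notin> ?W" "x \<noteq> y"
  then obtain p q r t where pq: "x = {p, q}" "p \<in> P" "q \<in> P" "p \<noteq> q"
    and rt: "y = {r, t}" "r \<in> P" "t \<in> P" "r \<noteq> t" by (auto simp: seg_vertices_def)
  have memW: "{a, b} \<in> ?W" if "(a, b) \<in> set W" for a b
    by (rule rev_image_eqI[OF that]) simp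
  have "linked P (set W) p q r t"
  proof (rule vis[OF pq(2,3) rt(2,3) pq(4) rt(4)])
    have nW: "z \<noteq> {a, b}" if "z \<notin> ?W" "(a, b) \<in> set W" for z a b
      using memW[OF that(2)] that(1) by metis
    show "\<forall>(a, b) \<in> set W. {p, q} \<noteq> {a, b}" using nW[OF xy(3)] unfolding pq(1) by auto
    show "\<forall>(a, b) \<in> set W. {r, t} \<noteq> {a, b}" using nW[OF xy(4)] unfolding rt(1) by auto
    show "{p, q} \<noteq> {r, t}" using xy(5) by (simp add: pq rt)
  qed
  then consider "dj p q r t" | "\<exists>(a, b) \<in> set W. dj p q a b \<and> dj r t a b"
      | "\<forall>a\<in>P. \<forall>b\<in>P. a \<noteq> b \<longrightarrow> \<not> (dj p q a b \<and> dj r t a b)"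
        "\<exists>(a, b) \<in> set W. \<exists>(c, d) \<in> set W. dj p q a b \<and> dj a b c d \<and> dj r t c d"
    unfolding linked_def by argo
  then show "disj_adj x y \<or> (\<exists>w\<in>?W. disj_adj x w \<and> disj_adj w y) \<or>
      ((\<forall>z\<in>seg_vertices P. \<not> (disj_adj x z \<and> disj_adj z y)) \<and>
       (\<exists>e\<in>?W. \<exists>f\<in>?W. disj_adj x e \<and> disj_adj e f \<and> disj_adj f y))"
  proof cases
    case 1 then show ?thesis by (simp add: pq rt dj_def)
  next
    case 2
    then obtain a b where ab: "(a, b) \<in> set W" "dj p q a b" "dj r t a b" by auto
    then have "disj_adj x {a, b} \<and> disj_adj {a, b} y"
      using dj_sym[of a b r t] by (simp add: pq rt dj_def)
    then show ?thesis using memW[OF ab(1)] by (intro disjI2 disjI1 bexI)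
  next
    case 3
    from 3(2) obtain a b c d where abcd: "(a, b) \<in> set W" "(c, d) \<in> set W" "dj p q a b" "dj a b c d" "dj r t c d"
      by auto
    have "disj_adj x {a, b} \<and> disj_adj {a, b} {c, d} \<and> disj_adj {c, d} y"
      using abcd dj_sym[of c d r t] by (simp_all add: pq rt dj_def)
    then have "\<exists>e\<in>?W. \<exists>f\<in>?W. disj_adj x e \<and> disj_adj e f \<and> disj_adj f y"
      by (intro bexI[OF _ memW[OF abcd(1)]] bexI[OF _ memW[OF abcd(2)]])
    moreover have "\<not> (disj_adj x z \<and> disj_adj z y)" if zV: "z \<in> seg_vertices P" for z
    proof -
      obtain a b where z: "z = {a, b}" "a \<in> P" "b \<in> P" "a \<noteq> b" using zV by (auto simp: seg_vertices_def)
      then have "\<not> (dj p q a b \<and> dj r t a b)" using 3(1) by blast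
      then show ?thesis using dj_sym[of a b r t] by (simp add: pq rt z(1) dj_def)
    qed
    ultimately show ?thesis by (intro disjI2 conjI ballI)
  qed
qed

section \<open>Affine functionals, for separating lines that need not pass through points of the
  set\<close>

definition aff :: "(real^2 \<Rightarrow> real) \<Rightarrow> bool" where
  "aff f \<longleftrightarrow> (\<forall>u v x y. u + v = 1 \<longrightarrow> f (u *\<^sub>R x + v *\<^sub>R y) = u * f x + v * f y)"

lemma aff_ori: "aff (ori a b)"
  by (simp add: aff_def ori_affine)

lemma aff_inner: "aff (\<lambda>x. d \<bullet> x - c)"
proof -
  have "d \<bullet> (u *\<^sub>R x + v *\<^sub>R y) - c = u * (d \<bullet> x - c) + v * (d \<bullet> y - c)" if "u + v = 1" for u v x y
  proof -
    have "u * c + v * c = (u + v) * c" by (simp only: distrib_right)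
    then have "u * c + v * c = c" using that by simp
    then show ?thesis unfolding inner_add_right inner_scaleR_right right_diff_distrib by linarith
  qed
  then show ?thesis by (simp add: aff_def)
qed

lemma aff_comb:
  assumes "aff f" "aff g" shows "aff (\<lambda>x. k * f x + l * g x)"
  unfolding aff_def
proof (intro allI impI)
  fix u v :: real and x y :: "real^2" assume uv: "u + v = 1"
  have "f (u *\<^sub>R x + v *\<^sub>R y) = u * f x + v * f y" "g (u *\<^sub>R x + v *\<^sub>R y) = u * g x + v * g y"
    using assms uv unfolding aff_def by blast+
  then show "k * f (u *\<^sub>R x + v *\<^sub>R y) + l * g (u *\<^sub>R x + v *\<^sub>R y) = u * (k * f x + l * g x) + v * (k * f y + l * g y)"
    by (simp only: distrib_left mult.left_commute ac_simps)
qed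

text \<open>A lexicographic sign condition is realised by one small coefficient. If
  \<open>m x\<close> is nonnegative, every positive \<open>e\<close> works; if it is negative,
  shrinking \<open>e\<close> only helps. So finitely many thresholds have a usable minimum.\<close>

lemma lex_pos_perturb:
  fixes g m :: "'a \<Rightarrow> real"
  assumes "finite X" "\<And>x. x \<in> X \<Longrightarrow> 0 < g x \<or> (g x = 0 \<and> 0 < m x)"
  shows "\<exists>e>0. \<forall>x\<in>X. 0 < g x + e * m x"
  using assms
proof (induction X rule: finite_induct)
  case empty then show ?case by (intro exI[of _ 1]) auto
next
  case (insert x X)
  then obtain e where e: "e > 0" "\<forall>x\<in>X. 0 < g x + e * m x" by auto
  have "\<exists>d>0. \<forall>c. 0 < c \<and> c \<le> d \<longrightarrow> 0 < g x + c * m x"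
  proof (cases "0 \<le> m x")
    case True
    then show ?thesis using insert.prems[of x] by (intro exI[of _ 1]) (auto intro: add_pos_nonneg)
  next
    case False
    then have gx: "0 < g x" using insert.prems[of x] by auto
    \<comment> \<open>With this bound the perturbation uses up at most half of
      \<open>g x\<close>.\<close>
    have "0 < g x + c * m x" if "0 < c" "c \<le> g x / (2 * (- m x))" for c
    proof -
      have "c * (- m x) \<le> g x / (2 * (- m x)) * (- m x)" using that False by (intro mult_right_mono) auto
      also have "\<dots> = g x / 2" using False by (simp add: field_simps)
      finally show ?thesis using gx by simp
    qed
    moreover have "0 < g x / (2 * (- m x))" using gx False by (simp add: field_simps)
    ultimately show ?thesis by blast
  qed
  then obtain d where d: "d > 0" "\<forall>c. 0 < c \<and> c \<le> d \<longrightarrow> 0 < g x + c * m x" by blast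
  define c where "c = min d e"
  have c: "0 < c" "c \<le> d" "c \<le> e" using d e by (auto simp: c_def)
  have "0 < g y + c * m y" if y: "y \<in> X" for y
  proof (cases "0 \<le> m y")
    case True
    then show ?thesis using insert.prems[of y] y c by (auto intro: add_pos_nonneg)
  next
    case False
    then have "e * m y \<le> c * m y" using c by (intro mult_right_mono_neg) auto
    moreover have "0 < g y + e * m y" using e(2) y by blast
    ultimately show ?thesis by linarith
  qed
  then show ?case using c d by (intro exI[of _ c]) auto
qed

text \<open>Switching the sign \<open>s\<close> replaces the point set by its mirror image, so every lemma below also holds reflected.\<close>
locale planar =
  fixes P :: "(real^2) set" and s :: real
  assumes fin: "finite P" and gp: "general_position P" and sgn: "s = 1 \<or> s = -1"
begin

definition L :: "real^2 \<Rightarrow> real^2 \<Rightarrow> real^2 \<Rightarrow> bool" where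
  "L a b c \<longleftrightarrow> 0 < s * ori a b c"

lemma L_rot: "L a b c \<longleftrightarrow> L b c a"
  by (simp add: L_def ori_rot[of a b c])

lemma L_same [simp]: "\<not> L a a b" "\<not> L a b a" "\<not> L a b b"
  by (simp_all add: L_def)

lemma L_neg: "L b a c \<longleftrightarrow> s * ori a b c < 0"
  using ori_swap[of a b c] by (simp add: L_def)

lemma ori_nz: "\<lbrakk>a \<in> P; b \<in> P; c \<in> P; a \<noteq> b; a \<noteq> c; b \<noteq> c\<rbrakk> \<Longrightarrow> s * ori a b c \<noteq> 0"
  using gp sgn ori_zero_collinear[of a b c] unfolding general_position_def by fastforce

lemma L_swap:
  assumes "a \<in> P" "b \<in> P" "c \<in> P" "a \<noteq> b" "a \<noteq> c" "b \<noteq> c"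
  shows "L b a c \<longleftrightarrow> \<not> L a b c"
proof -
  have "s * ori a b c \<noteq> 0" by (rule ori_nz[OF assms])
  moreover have "s * ori b a c = - (s * ori a b c)" by (simp add: ori_swap[of a b c])
  ultimately show ?thesis unfolding L_def by linarith
qed

lemma L_asym: "L a b c \<Longrightarrow> \<not> L b a c"
  using ori_swap[of a b c] by (simp add: L_def)

lemma L_anti: "L a b c \<Longrightarrow> \<not> L a c b"
  by (simp add: L_def ori_def algebra_simps)

lemma sep:
  assumes "p = a \<or> p = b \<or> L a b p" "q = a \<or> q = b \<or> L a b q" "L b a r" "L b a t"
  shows "dj p q r t"
proof (rule dj_sep[of s a b])
  show "0 \<le> s * ori a b p" "0 \<le> s * ori a b q" using assms(1,2) by (auto simp: L_def)
  show "s * ori a b r < 0" "s * ori a b t < 0" using assms(3,4) L_neg[of b a r] L_neg[of b a t] by (simp_all only:)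
qed

lemma sep_touch:
  assumes "L a b q" "L b a t" shows "dj a q b t"
proof (rule dj_sep0[of a b s])
  show "a \<noteq> b" using assms by auto
  show "0 < s * ori a b q" "s * ori a b t < 0" using assms L_neg[of b a t] by (simp_all only: L_def[of a b q])
qed

lemma same_side_dj:
  assumes "p \<in> P" "q \<in> P" "r \<in> P" "t \<in> P" "p \<noteq> q" "p \<noteq> r" "p \<noteq> t" "q \<noteq> r" "q \<noteq> t"
    and "L p q r \<longleftrightarrow> L p q t"
  shows "dj p q r t"
proof (cases "L p q r")
  case True
  then have "L p q t" using assms(10) by blast
  with True show ?thesis by (blast intro: sep[of p q p q r t])
next
  case False
  then have "\<not> L p q t" using assms(10) by blast
  have "L q p r" using L_swap[OF assms(1-3,5,6,8)] False by blast
  moreover have "L q p t" using L_swap[OF assms(1,2,4,5,7,9)] \<open>\<not> L p q t\<close> by blast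
  ultimately show ?thesis by (blast intro: sep[of p p q q r t])
qed

text \<open>Either diagonal of the quadrilateral \<open>abcd\<close> splits the same signed area, so
  one splitting cannot have two positive parts while the other has two negative ones.\<close>

lemma four_points: "\<not> (L a b c \<and> L a c d \<and> L b a d \<and> L c b d)"
proof
  assume h: "L a b c \<and> L a c d \<and> L b a d \<and> L c b d"
  have "s * ori a b c + s * ori a c d = s * ori a b d + s * ori b c d"
    by (simp add: ori_def algebra_simps)
  moreover have "0 < s * ori a b c" "0 < s * ori a c d" "s * ori a b d < 0" "s * ori b c d < 0"
    using h L_neg[of b a d] L_neg[of c b d] by (simp_all only: L_def[of a b c] L_def[of a c d])
  ultimately show False by linarith
qed

text \<open>Grassmann-Pluecker relation at \<open>v\<close>, with the ray from \<open>v\<close> to \<open>w\<close> as reference direction.\<close>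
lemma L_trans:
  assumes w: "\<And>x. x \<in> {p, q, r} \<Longrightarrow> x = w \<or> L v w x" and "L v p q" "L v q r"
  shows "L v p r"
proof -
  have id: "ori v w q * ori v p r = ori v w p * ori v q r + ori v w r * ori v p q"
    by (simp add: ori_def algebra_simps)
  have "s * s = 1" using sgn by auto
  have id': "(s * ori v w q) * (s * ori v p r) = (s * ori v w p) * (s * ori v q r) + (s * ori v w r) * (s * ori v p q)"
  proof -
    have "(s * ori v w q) * (s * ori v p r) = s * s * (ori v w q * ori v p r)" by simp
    also have "\<dots> = s * s * (ori v w p * ori v q r + ori v w r * ori v p q)" using id by simp
    finally show ?thesis by (simp add: algebra_simps)
  qed
  have pos: "0 < s * ori v p q" "0 < s * ori v q r" using assms by (auto simp: L_def)
  show ?thesis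
  proof (cases "p = w \<or> q = w \<or> r = w")
    case True
    then show ?thesis using w[of p] w[of q] w[of r] assms(2,3) L_anti[of v w] by auto
  next
    case False
    then have "0 < s * ori v w p" "0 < s * ori v w q" "0 < s * ori v w r" using w by (auto simp: L_def)
    then have "0 < (s * ori v w q) * (s * ori v p r)" using id' pos by (simp add: add_pos_pos)
    then show ?thesis using \<open>0 < s * ori v w q\<close> by (simp add: L_def zero_less_mult_iff)
  qed
qed

section \<open>Hull edges, caps and empty ears\<close>

text \<open>\<open>a\<close> and \<open>b\<close> are consecutive on the convex hull.\<close>
definition E :: "real^2 \<Rightarrow> real^2 \<Rightarrow> bool" where
  "E a b \<longleftrightarrow> a \<in> P \<and> b \<in> P \<and> a \<noteq> b \<and> (\<forall>x\<in>P - {a, b}. L a b x)"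

definition cap :: "real^2 \<Rightarrow> real^2 \<Rightarrow> bool" where
  "cap a b \<longleftrightarrow> a \<in> P \<and> b \<in> P \<and> a \<noteq> b \<and>
     (\<exists>f. aff f \<and> 0 < f a \<and> 0 < f b \<and> (\<forall>x\<in>P - {a, b}. f x < 0))"

lemma cap_sym: "cap a b \<Longrightarrow> cap b a"
  by (auto simp: cap_def insert_commute)

lemma cap_in: "cap a b \<Longrightarrow> a \<in> P \<and> b \<in> P \<and> a \<noteq> b"
  by (simp add: cap_def)

lemma cap_dj:
  assumes "cap a b" "p \<in> P - {a, b}" "q \<in> P - {a, b}"
  shows "dj p q a b"
proof (rule dj_I)
  obtain f where f: "aff f" "0 < f a" "0 < f b" "\<And>x. x \<in> P - {a, b} \<Longrightarrow> f x < 0"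
    using assms(1) unfolding cap_def by blast
  fix u v u' v' :: real
  assume h: "0 \<le> u" "0 \<le> v" "u + v = 1" "0 \<le> u'" "0 \<le> v'" "u' + v' = 1"
     "u *\<^sub>R p + v *\<^sub>R q = u' *\<^sub>R a + v' *\<^sub>R b"
  have "u * f p + v * f q = u' * f a + v' * f b"
  proof -
    have "f (u *\<^sub>R p + v *\<^sub>R q) = u * f p + v * f q" "f (u' *\<^sub>R a + v' *\<^sub>R b) = u' * f a + v' * f b"
      using h(3,6) f(1) unfolding aff_def by blast+
    then show ?thesis using h(7) by simp
  qed
  moreover have "u * f p + v * f q \<le> 0"
    using h f(4)[OF assms(2)] f(4)[OF assms(3)] by (simp add: add_nonpos_nonpos mult_nonneg_nonpos)
  moreover have "0 < u' * f a + v' * f b"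
  proof (cases "u' = 0")
    case True then show ?thesis using h f(3) by simp
  next
    case False
    then have "0 < u' * f a" using h f(2) by simp
    moreover have "0 \<le> v' * f b" using h f(3) by simp
    ultimately show ?thesis by linarith
  qed
  ultimately show False by linarith
qed

text \<open>The line \<open>g = 0\<close> may pass through points of \<open>P\<close>;
  \<open>m\<close> decides on which side those belong, and adding a small multiple of
  \<open>m\<close> makes all signs strict.\<close>

lemma cap_lex:
  assumes ab: "a \<in> P" "b \<in> P" "a \<noteq> b" and aff: "aff g" "aff m"
    and pos: "\<And>x. x \<in> {a, b} \<Longrightarrow> 0 < g x \<or> (g x = 0 \<and> 0 < m x)"
    and neg: "\<And>x. x \<in> P - {a, b} \<Longrightarrow> g x < 0 \<or> (g x = 0 \<and> m x < 0)"
  shows "cap a b"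
proof -
  \<comment> \<open>Negating both functionals off \<open>{a, b}\<close> turns the two requirements
    into positivity, so a single \<open>e\<close> serves all points.\<close>
  let ?g = "\<lambda>x. if x \<in> {a, b} then g x else - g x"
  let ?m = "\<lambda>x. if x \<in> {a, b} then m x else - m x"
  have "\<exists>e>0. \<forall>x\<in>P. 0 < ?g x + e * ?m x"
    by (rule lex_pos_perturb[OF fin]) (use pos neg in auto)
  then obtain e where e: "e > 0" "\<And>x. x \<in> P \<Longrightarrow> 0 < ?g x + e * ?m x" by blast
  have "0 < 1 * g a + e * m a" "0 < 1 * g b + e * m b" using e(2)[of a] e(2)[of b] ab by auto
  moreover have "1 * g x + e * m x < 0" if "x \<in> P - {a, b}" for x using e(2)[of x] that by auto
  ultimately show ?thesis unfolding cap_def using ab aff_comb[OF aff, of 1 e] by blast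
qed

text \<open>The hull line is shifted slightly inwards: \<open>0 \<bullet> x - (-1)\<close> is the
  constant 1, which makes the sign positive at \<open>a\<close> and \<open>b\<close>, the only
  points of \<open>P\<close> on the line.\<close>

lemma E_cap: assumes "E a b" shows "cap a b"
proof (rule cap_lex[of a b "\<lambda>x. - s * ori a b x + 0 * ori a b x" "\<lambda>x. 0 \<bullet> x - (-1)"])
  show "aff (\<lambda>x. - s * ori a b x + 0 * ori a b x)" by (rule aff_comb[OF aff_ori aff_ori])
  show "aff (\<lambda>x. 0 \<bullet> x - (-1))" by (rule aff_inner)
qed (use assms in \<open>auto simp: E_def L_def\<close>)

text \<open>\<open>t\<close> is the first point met when the ray from \<open>u\<close> through the next hull vertex \<open>v\<close> rotates about \<open>u\<close>.\<close>
definition pend :: "real^2 \<Rightarrow> real^2 \<Rightarrow> real^2 \<Rightarrow> bool" where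
  "pend u v t \<longleftrightarrow> E u v \<and> t \<in> P - {u, v} \<and> (\<forall>x\<in>P - {u, v, t}. L u t x)"

text \<open>Rotate the line \<open>ut\<close> slightly about the midpoint of \<open>u\<close> and \<open>t\<close>.\<close>
lemma pend_cap: assumes "pend u v t" shows "cap v t"
proof -
  have h: "E u v" "t \<in> P" "t \<noteq> u" "t \<noteq> v" "\<And>x. x \<in> P - {u, v, t} \<Longrightarrow> L u t x"
    using assms unfolding pend_def by auto
  have uv: "u \<in> P" "v \<in> P" "u \<noteq> v" "L u v t" using h unfolding E_def by auto
  let ?m = "\<lambda>x. (t - u) \<bullet> x - (t - u) \<bullet> ((1/2) *\<^sub>R (t + u))"
  have mt: "0 < ?m t" "?m u < 0"
  proof -
    have "0 < (t - u) \<bullet> (t - u)" using h by simp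
    then show "0 < ?m t" "?m u < 0" by (simp_all add: inner_diff inner_add field_simps)
  qed
  show ?thesis
  proof (rule cap_lex[of v t "\<lambda>x. - s * ori u t x + 0 * ori u t x" ?m])
    show "aff (\<lambda>x. - s * ori u t x + 0 * ori u t x)" by (rule aff_comb[OF aff_ori aff_ori])
    show "aff ?m" by (rule aff_inner)
    have "s * ori u t v < 0" using uv(4) L_rot[of t u v] L_rot[of u v t] by (simp add: L_neg[symmetric])
    then show "\<And>x. x \<in> {v, t} \<Longrightarrow> 0 < - s * ori u t x + 0 * ori u t x \<or> (- s * ori u t x + 0 * ori u t x = 0 \<and> 0 < ?m x)"
      using mt by auto
    show "\<And>x. x \<in> P - {v, t} \<Longrightarrow> - s * ori u t x + 0 * ori u t x < 0 \<or> (- s * ori u t x + 0 * ori u t x = 0 \<and> ?m x < 0)"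
    proof -
      fix x assume "x \<in> P - {v, t}"
      then show "- s * ori u t x + 0 * ori u t x < 0 \<or> (- s * ori u t x + 0 * ori u t x = 0 \<and> ?m x < 0)"
        using h(5)[of x] mt by (cases "x = u") (auto simp: L_def)
    qed
  qed (use h uv in auto)
qed

lemma cap_free:
  assumes "cap a b" "p \<in> P" "q \<in> P" "p \<noteq> a" "p \<noteq> b" "q \<noteq> a" "q \<noteq> b"
  shows "dj p q a b" "dj a b p q" "dj p q b a" "dj b a p q"
  using assms cap_dj[of a b p q] by (auto simp: dj_sym[of _ _ p q] dj_flip2[of p q])

text \<open>For consecutive hull vertices \<open>u\<close>, \<open>v\<close>, \<open>w\<close>: the triangle \<open>uvw\<close> contains no further point.\<close>
definition short :: "real^2 \<Rightarrow> real^2 \<Rightarrow> real^2 \<Rightarrow> bool" where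
  "short u v w \<longleftrightarrow> u \<in> P \<and> v \<in> P \<and> w \<in> P \<and> distinct [u, v, w] \<and> L w u v \<and>
     (\<forall>x\<in>P - {u, v, w}. L u w x)"

lemma short_free:
  assumes "short u v w" "p \<in> P" "q \<in> P" "p \<noteq> u" "p \<noteq> v" "p \<noteq> w" "q \<noteq> u" "q \<noteq> v" "q \<noteq> w"
  shows "dj p q u w" "dj u w p q" "dj p q w u" "dj w u p q"
proof -
  have "L u w p" "L u w q" using assms unfolding short_def by auto
  then have "dj u w p q" by (intro sep[of u w u w p q]) auto
  then show "dj p q u w" "dj u w p q" "dj p q w u" "dj w u p q"
    by (simp_all add: dj_sym[of p q] dj_flip1[of u w])
qed

text \<open>Common form of all obstruction data: only segments with an end in \<open>S\<close> can
  hit \<open>ab\<close>. For a cap, \<open>S\<close> is its two points; for the chord of an empty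
  ear, the three corners; for a chord cutting off an empty quadrilateral, the four.\<close>

definition guard :: "real^2 \<Rightarrow> real^2 \<Rightarrow> (real^2) set \<Rightarrow> bool" where
  "guard a b S \<longleftrightarrow> (\<forall>p\<in>P - S. \<forall>q\<in>P - S. dj p q a b)"

lemma guard_cap: "cap a b \<Longrightarrow> guard a b {a, b}"
  using cap_dj by (auto simp: guard_def)

lemma guard_short: "short u v w \<Longrightarrow> guard u w {u, v, w}"
  using short_free(1)[of u v w] by (auto simp: guard_def)

end

section \<open>A finite checker\<close>

text \<open>Labels stand for named points, \<open>Out\<close> for any point without a name;
  \<open>gs\<close> lists segments together with the labels through which alone they can be hit,
  \<open>ex\<close> further disjoint pairs, \<open>W\<close> the chosen segments and \<open>em\<close> the pairs left to a geometric argument.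
  If \<open>opn\<close> is false, all points are named. The list operations are tailor-made so that \<open>code_simp\<close> evaluates
  them by plain rewriting.\<close>

datatype ix = A0 | A1 | A2 | A3 | A4 | A5 | A6 | A7 | A8 | Out

type_synonym ixp = "ix \<times> ix"

primrec mem :: "'a \<Rightarrow> 'a list \<Rightarrow> bool" where
  "mem x [] \<longleftrightarrow> False"
| "mem x (y # ys) \<longleftrightarrow> x = y \<or> mem x ys"

fun peq :: "ixp \<Rightarrow> ixp \<Rightarrow> bool" where
  "peq (a, b) (c, d) \<longleftrightarrow> a = c \<and> b = d \<or> a = d \<and> b = c"

fun avoids :: "ixp \<Rightarrow> ix list \<Rightarrow> bool" where
  "avoids (a, b) S \<longleftrightarrow> \<not> mem a S \<and> \<not> mem b S"

primrec fr_guard :: "(ixp \<times> ix list) list \<Rightarrow> ixp \<Rightarrow> ixp \<Rightarrow> bool" where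
  "fr_guard [] x y \<longleftrightarrow> False"
| "fr_guard (g # gs) x y \<longleftrightarrow> peq x (fst g) \<and> avoids y (snd g) \<or> peq y (fst g) \<and> avoids x (snd g) \<or> fr_guard gs x y"

primrec pmem :: "(ixp \<times> ixp) list \<Rightarrow> ixp \<Rightarrow> ixp \<Rightarrow> bool" where
  "pmem [] x y \<longleftrightarrow> False"
| "pmem (e # es) x y \<longleftrightarrow> peq x (fst e) \<and> peq y (snd e) \<or> peq x (snd e) \<and> peq y (fst e) \<or> pmem es x y"

definition fr :: "(ixp \<times> ix list) list \<Rightarrow> (ixp \<times> ixp) list \<Rightarrow> ixp \<Rightarrow> ixp \<Rightarrow> bool" where
  "fr gs ex x y \<longleftrightarrow> pmem ex x y \<or> fr_guard gs x y"

primrec both_free :: "(ixp \<times> ix list) list \<Rightarrow> (ixp \<times> ixp) list \<Rightarrow> ixp list \<Rightarrow> ixp \<Rightarrow> ixp \<Rightarrow> bool" where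
  "both_free gs ex [] x y \<longleftrightarrow> False"
| "both_free gs ex (w # ws) x y \<longleftrightarrow> fr gs ex x w \<and> fr gs ex y w \<or> both_free gs ex ws x y"

primrec inW :: "ixp list \<Rightarrow> ixp \<Rightarrow> bool" where
  "inW [] x \<longleftrightarrow> False"
| "inW (w # ws) x \<longleftrightarrow> peq x w \<or> inW ws x"

text \<open>Equal label pairs denote the same segment only if \<open>Out\<close> does not occur. In
  the pairs listed by \<open>lpairs\<close> an \<open>Out\<close> always stands second, so looking
  at \<open>snd\<close> suffices.\<close>

definition okp :: "(ixp \<times> ix list) list \<Rightarrow> (ixp \<times> ixp) list \<Rightarrow> ixp list \<Rightarrow> (ixp \<times> ixp) list \<Rightarrow> ixp \<Rightarrow> ixp \<Rightarrow> bool" where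
  "okp gs ex W em x y \<longleftrightarrow> x = y \<and> snd x \<noteq> Out \<or> both_free gs ex W x y \<or> fr gs ex x y \<or> pmem em x y"

text \<open>The diagonal is tested too: two different segments may carry the same label pair when it
  contains \<open>Out\<close>.\<close>

primrec all_ok :: "(ixp \<Rightarrow> ixp \<Rightarrow> bool) \<Rightarrow> ixp list \<Rightarrow> bool" where
  "all_ok f [] \<longleftrightarrow> True"
| "all_ok f (x # xs) \<longleftrightarrow> list_all (f x) (x # xs) \<and> all_ok f xs"

primrec lpairs :: "ix list \<Rightarrow> ixp list" where
  "lpairs [] = [(Out, Out)]"
| "lpairs (i # is) = (i, Out) # map (Pair i) is @ lpairs is"

primrec cpairs :: "ix list \<Rightarrow> ixp list" where
  "cpairs [] = []"
| "cpairs (i # is) = map (Pair i) is @ cpairs is"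

definition chk :: "bool \<Rightarrow> ix list \<Rightarrow> (ixp \<times> ix list) list \<Rightarrow> (ixp \<times> ixp) list \<Rightarrow> ixp list \<Rightarrow> (ixp \<times> ixp) list \<Rightarrow> bool" where
  "chk opn ls gs ex W em \<longleftrightarrow>
     list_all (\<lambda>g. mem (fst (fst g)) ls \<and> mem (snd (fst g)) ls \<and> list_all (\<lambda>i. mem i ls) (snd g)) gs \<and>
     list_all (\<lambda>e. mem (fst (fst e)) ls \<and> mem (snd (fst e)) ls \<and> mem (fst (snd e)) ls \<and> mem (snd (snd e)) ls) ex \<and>
     list_all (\<lambda>w. mem (fst w) ls \<and> mem (snd w) ls \<and> fst w \<noteq> snd w) W \<and>
     all_ok (okp gs ex W em) (filter (\<lambda>x. \<not> inW W x) (if opn then lpairs ls else cpairs ls))"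

lemma mem_iff: "mem x xs \<longleftrightarrow> x \<in> set xs"
  by (induction xs) auto

section \<open>Soundness of the checker\<close>

definition named :: "(ix \<Rightarrow> 'a) \<Rightarrow> ix list \<Rightarrow> ix \<Rightarrow> 'a \<Rightarrow> bool" where
  "named a ls i p \<longleftrightarrow> (if i = Out then p \<notin> a ` set ls else i \<in> set ls \<and> p = a i)"

definition named2 :: "(ix \<Rightarrow> 'a) \<Rightarrow> ix list \<Rightarrow> ixp \<Rightarrow> 'a \<Rightarrow> 'a \<Rightarrow> bool" where
  "named2 a ls x p q \<longleftrightarrow> named a ls (fst x) p \<and> named a ls (snd x) q \<or> named a ls (fst x) q \<and> named a ls (snd x) p"

lemma named_ex: "Out \<notin> set ls \<Longrightarrow> \<exists>i. named a ls i p \<and> (i = Out \<or> i \<in> set ls)"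
proof (cases "p \<in> a ` set ls")
  case True
  then obtain i where "i \<in> set ls" "p = a i" by blast
  moreover assume "Out \<notin> set ls"
  ultimately show ?thesis by (intro exI[of _ i]) (auto simp: named_def)
next
  case False
  then show ?thesis by (intro exI[of _ Out]) (simp add: named_def)
qed

lemma lpairs_cover:
  assumes "Out \<notin> set ls" "p \<noteq> q" "opn \<or> (p \<in> a ` set ls \<and> q \<in> a ` set ls)"
  shows "\<exists>x\<in>set (if opn then lpairs ls else cpairs ls). named2 a ls x p q"
proof -
  have cover: "(i, j) \<in> set (lpairs ls) \<or> (j, i) \<in> set (lpairs ls)"
    if "i = Out \<or> i \<in> set ls" "j = Out \<or> j \<in> set ls" "i \<noteq> j \<or> i = Out" for i j ls
    using that by (induction ls) auto
  have ccover: "(i, j) \<in> set (cpairs ls) \<or> (j, i) \<in> set (cpairs ls)"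
    if "i \<in> set ls" "j \<in> set ls" "i \<noteq> j" for i j ls
    using that by (induction ls) auto
  obtain i j where ij: "named a ls i p" "named a ls j q" "i = Out \<or> i \<in> set ls" "j = Out \<or> j \<in> set ls"
    using named_ex[OF assms(1)] by meson
  have ne: "i \<noteq> j \<or> i = Out" using ij(1,2) assms(2) by (auto simp: named_def split: if_splits)
  have "(i, j) \<in> set (if opn then lpairs ls else cpairs ls) \<or> (j, i) \<in> set (if opn then lpairs ls else cpairs ls)"
  proof (cases opn)
    case True then show ?thesis using cover[OF ij(3,4) ne] by simp
  next
    case False
    then have "i \<noteq> Out" "j \<noteq> Out" using ij(1,2) assms(3) by (auto simp: named_def split: if_splits)
    then show ?thesis using ccover[of i ls j] ij(3,4) ne False by simp
  qed
  then show ?thesis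
  proof
    assume "(i, j) \<in> set (if opn then lpairs ls else cpairs ls)"
    then show ?thesis using ij by (intro bexI[of _ "(i, j)"]) (simp_all add: named2_def)
  next
    assume "(j, i) \<in> set (if opn then lpairs ls else cpairs ls)"
    then show ?thesis using ij by (intro bexI[of _ "(j, i)"]) (simp_all add: named2_def)
  qed
qed

lemma cpairs_in: "(i, j) \<in> set (cpairs ls) \<Longrightarrow> i \<in> set ls \<and> j \<in> set ls"
  by (induction ls) auto

lemma lpairs_fst: "Out \<notin> set ls \<Longrightarrow> x \<in> set (if opn then lpairs ls else cpairs ls) \<Longrightarrow> fst x = Out \<Longrightarrow> snd x = Out"
proof (cases opn)
  assume "Out \<notin> set ls" "x \<in> set (if opn then lpairs ls else cpairs ls)" "fst x = Out" opn
  then show ?thesis by (induction ls) auto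
next
  assume "Out \<notin> set ls" "x \<in> set (if opn then lpairs ls else cpairs ls)" "fst x = Out" "\<not> opn"
  then have "fst x \<in> set ls" by (cases x) (auto dest: cpairs_in)
  then show ?thesis using \<open>Out \<notin> set ls\<close> \<open>fst x = Out\<close> by simp
qed

lemma named2_peq: "peq x y \<Longrightarrow> named2 a ls x p q \<longleftrightarrow> named2 a ls y p q"
  by (cases x; cases y) (auto simp: named2_def)

lemma pmem_iff: "pmem es x y \<Longrightarrow> \<exists>(u, v)\<in>set es. peq x u \<and> peq y v \<or> peq x v \<and> peq y u"
  by (induction es) auto

lemma fr_guard_iff: "fr_guard gs x y \<Longrightarrow> \<exists>(u, S)\<in>set gs. peq x u \<and> avoids y S \<or> peq y u \<and> avoids x S"
  by (induction gs) auto

lemma both_free_iff: "both_free gs ex W x y \<Longrightarrow> \<exists>w\<in>set W. fr gs ex x w \<and> fr gs ex y w"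
  by (induction W) auto

lemma inW_iff: "inW W x \<longleftrightarrow> (\<exists>w\<in>set W. peq x w)"
  by (induction W) auto

lemma all_ok_iff:
  "all_ok f xs \<Longrightarrow> x \<in> set xs \<Longrightarrow> y \<in> set xs \<Longrightarrow> f x y \<or> f y x"
  by (induction xs) (auto simp: list_all_iff)

context planar
begin

text \<open>Every segment outside \<open>W\<close> carries a label pair from the finite list, and
  each reason that \<open>okp\<close> accepts yields a clause of \<open>linked\<close>. As all
  unnamed points share one label, one finite run settles point sets of any size.\<close>

lemma checker:
  assumes chk: "chk opn ls gs ex W em" and cl: "opn \<or> P = a ` set ls" and out: "Out \<notin> set ls" and inj: "inj_on a (set ls)"
    and inP: "\<And>i. i \<in> set ls \<Longrightarrow> a i \<in> P"
    and gs0: "\<And>i j S. ((i, j), S) \<in> set gs \<Longrightarrow> guard (a i) (a j) (a ` set S)"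
    and ex0: "\<And>i j k l. ((i, j), (k, l)) \<in> set ex \<Longrightarrow> dj (a i) (a j) (a k) (a l)"
    and W0: "length W \<le> 9"
    and em: "\<And>x y p q r t. \<lbrakk>(x, y) \<in> set em; p \<in> P; q \<in> P; r \<in> P; t \<in> P; p \<noteq> q; r \<noteq> t;
       named a ls (fst x) p; named a ls (snd x) q; named a ls (fst y) r; named a ls (snd y) t\<rbrakk> \<Longrightarrow>
       linked P (map_prod a a ` set W) p q r t"
  shows "meets_bound P"
proof (rule pairs_witness[OF fin, of "map (map_prod a a) W"])
  have gs: "i \<in> set ls \<and> j \<in> set ls \<and> guard (a i) (a j) (a ` set S)" if "((i, j), S) \<in> set gs" for i j S
    using chk gs0[OF that] that by (fastforce simp: chk_def list_all_iff mem_iff)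
  have ex: "{i, j, k, l} \<subseteq> set ls \<and> dj (a i) (a j) (a k) (a l)" if "((i, j), (k, l)) \<in> set ex" for i j k l
    using chk ex0[OF that] that by (fastforce simp: chk_def list_all_iff mem_iff)
  have W2: "i \<in> set ls \<and> j \<in> set ls \<and> i \<noteq> j" if "(i, j) \<in> set W" for i j
    using chk that by (fastforce simp: chk_def list_all_iff mem_iff)
  note W = W0 W2
  let ?pl = "if opn then lpairs ls else cpairs ls"
  have neOut: "i \<noteq> Out" if "i \<in> set ls" for i using out that by blast
  have nm: "{p, q} = {a i, a j}" if "i \<in> set ls" "j \<in> set ls" "named2 a ls (i, j) p q" for i j p q
  proof -
    have "named a ls i z \<longleftrightarrow> z = a i" "named a ls j z \<longleftrightarrow> z = a j" for z
      using neOut[OF that(1)] neOut[OF that(2)] that(1,2) by (simp_all add: named_def)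
    then have "p = a i \<and> q = a j \<or> q = a i \<and> p = a j" using that(3) by (simp add: named2_def)
    then show ?thesis by auto
  qed
  have nm': "named2 a ls (i, j) (a i) (a j)" if "i \<in> set ls" "j \<in> set ls" for i j
    using neOut[OF that(1)] neOut[OF that(2)] that by (simp add: named2_def named_def)
  have nmp: "{p, q} = {a i, a j}" if "peq x (i, j)" "named2 a ls x p q" "i \<in> set ls" "j \<in> set ls" for x i j p q
    by (rule nm[OF that(3,4) iffD1[OF named2_peq[OF that(1)] that(2)]])
  show "length (map (map_prod a a) W) \<le> 9" using W by simp
  show "x \<in> P \<and> y \<in> P \<and> x \<noteq> y" if xy: "(x, y) \<in> set (map (map_prod a a) W)" for x y
  proof -
    obtain i j where ij: "(i, j) \<in> set W" "x = a i" "y = a j" using xy by auto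
    have "a i \<noteq> a j" using W(2)[OF ij(1)] inj unfolding inj_on_def by blast
    then show ?thesis using W(2)[OF ij(1)] inP ij(2,3) by simp
  qed
  have djset: "dj p q r t" if "{p, q} = {p', q'}" "{r, t} = {r', t'}" "dj p' q' r' t'" for p q r t p' q' r' t'
    using that unfolding dj_def by simp
  have frs: "dj p q r t" if f: "fr gs ex x y" and n: "named2 a ls x p q" "named2 a ls y r t"
    and P: "p \<in> P" "q \<in> P" "r \<in> P" "t \<in> P" for x y p q r t
  proof -
    consider (e) u v where "(u, v) \<in> set ex" "peq x u \<and> peq y v \<or> peq x v \<and> peq y u"
      | (g) u S where "(u, S) \<in> set gs" "peq x u \<and> avoids y S \<or> peq y u \<and> avoids x S"
    proof -
      from f consider "pmem ex x y" | "fr_guard gs x y" unfolding fr_def by blast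
      then show thesis
      proof cases
        case 1 then show thesis using pmem_iff[OF 1] e by auto
      next
        case 2 then show thesis using fr_guard_iff[OF 2] g by auto
      qed
    qed
    then show ?thesis
    proof cases
      case e
      obtain i j k l where uv: "u = (i, j)" "v = (k, l)" by (cases u; cases v)
      have d: "{i, j, k, l} \<subseteq> set ls" "dj (a i) (a j) (a k) (a l)" using ex e(1) uv by auto
      from e(2) show ?thesis
      proof
        assume "peq x u \<and> peq y v"
        then have "{p, q} = {a i, a j}" "{r, t} = {a k, a l}"
          using nmp[OF _ n(1)] nmp[OF _ n(2)] d(1) unfolding uv by simp_all
        then show ?thesis using djset d(2) by blast
      next
        assume "peq x v \<and> peq y u"
        then have "{p, q} = {a k, a l}" "{r, t} = {a i, a j}"
          using nmp[OF _ n(1)] nmp[OF _ n(2)] d(1) unfolding uv by simp_all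
        then show ?thesis using djset[OF _ _ iffD2[OF dj_sym d(2)]] by blast
      qed
    next
      case g
      obtain i j where u: "u = (i, j)" by (cases u)
      have d: "i \<in> set ls" "j \<in> set ls" "guard (a i) (a j) (a ` set S)" using gs g(1) u by auto
      have S: "set S \<subseteq> set ls" using chk g(1) by (fastforce simp: chk_def list_all_iff mem_iff)
      have av: "p \<notin> a ` set S \<and> q \<notin> a ` set S" if "avoids x S" "named2 a ls x p q" for x p q
      proof -
        obtain k l where x: "x = (k, l)" by (cases x)
        have "p \<notin> a ` set S" if "k \<notin> set S" "named a ls k p" for k p
          using that S inj unfolding named_def by (auto split: if_splits simp: inj_on_def)
        then show ?thesis using that unfolding x named2_def by (auto simp: mem_iff)
      qed
      from g(2) show ?thesis
      proof
        assume "peq x u \<and> avoids y S"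
        then have "{p, q} = {a i, a j}" "r \<notin> a ` set S" "t \<notin> a ` set S"
          using nmp[OF _ n(1)] av[OF _ n(2)] d(1,2) unfolding u by simp_all
        moreover from this have "dj r t (a i) (a j)" using d(3) P by (simp add: guard_def)
        ultimately show ?thesis using djset[of p q "a i" "a j" r t r t] dj_sym[of "a i" "a j" r t] by blast
      next
        assume "peq y u \<and> avoids x S"
        then have "{r, t} = {a i, a j}" "p \<notin> a ` set S" "q \<notin> a ` set S"
          using nmp[OF _ n(2)] av[OF _ n(1)] d(1,2) unfolding u by simp_all
        moreover from this have "dj p q (a i) (a j)" using d(3) P by (simp add: guard_def)
        ultimately show ?thesis using djset[of p q p q r t "a i" "a j"] by blast
      qed
    qed
  qed
  fix p q r t
  assume P: "p \<in> P" "q \<in> P" "r \<in> P" "t \<in> P" and ne: "p \<noteq> q" "r \<noteq> t"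
    and nW: "\<forall>(x, y)\<in>set (map (map_prod a a) W). {p, q} \<noteq> {x, y}" "\<forall>(x, y)\<in>set (map (map_prod a a) W). {r, t} \<noteq> {x, y}"
    and neq: "{p, q} \<noteq> {r, t}"
  let ?W = "set (map (map_prod a a) W)"
  have notW: "\<not> inW W x" if n: "named2 a ls x p q" and w: "\<forall>(x, y)\<in>?W. {p, q} \<noteq> {x, y}" for x p q
  proof
    assume "inW W x"
    then obtain i j where ij: "(i, j) \<in> set W" "peq x (i, j)" by (auto simp: inW_iff)
    then have "{p, q} = {a i, a j}" using nmp[OF ij(2) n] W(2)[OF ij(1)] by simp
    moreover have "(a i, a j) \<in> ?W" using ij(1) by force
    ultimately show False using w by auto
  qed
  obtain x where x: "x \<in> set ?pl" "named2 a ls x p q" using lpairs_cover[OF out ne(1), of opn a] cl P by blast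
  obtain y where y: "y \<in> set ?pl" "named2 a ls y r t" using lpairs_cover[OF out ne(2), of opn a] cl P by blast
  have okl: "linked P ?W p q r t" if ok: "okp gs ex W em x y" and n: "named2 a ls x p q" "named2 a ls y r t"
     and P: "p \<in> P" "q \<in> P" "r \<in> P" "t \<in> P" and ne: "p \<noteq> q" "r \<noteq> t" and neq: "{p, q} \<noteq> {r, t}"
     and lp: "x \<in> set ?pl" for x y p q r t
  proof -
    consider (1) "x = y" "snd x \<noteq> Out" | (2) "both_free gs ex W x y" | (3) "fr gs ex x y" | (4) "pmem em x y"
      using ok unfolding okp_def by blast
    then show ?thesis
    proof cases
      case 1
      obtain i j where x: "x = (i, j)" by (cases x)
      moreover have "fst x \<noteq> Out \<Longrightarrow> {p, q} = {r, t}"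
        using n 1 by (auto simp: x named2_def named_def)
      ultimately show ?thesis using lpairs_fst[OF out lp] neq 1(2) by blast
    next
      case 2
      then obtain i j where w: "(i, j) \<in> set W" "fr gs ex x (i, j)" "fr gs ex y (i, j)"
        using both_free_iff[OF 2] by auto
      then have ij: "i \<in> set ls" "j \<in> set ls" using W(2) by auto
      have "dj p q (a i) (a j)" "dj r t (a i) (a j)"
        using frs[OF w(2) n(1) nm'[OF ij]] frs[OF w(3) n(2) nm'[OF ij]] P inP ij by auto
      moreover have "(a i, a j) \<in> ?W" using w(1) by force
      ultimately show ?thesis unfolding linked_def by blast
    next
      case 3
      then show ?thesis using frs n P by (auto simp: linked_def)
    next
      case 4
      then obtain u v where uv: "(u, v) \<in> set em" "peq x u \<and> peq y v \<or> peq x v \<and> peq y u"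
        using pmem_iff[OF 4] by auto
      have L0: "linked P ?W p q r t" if nn: "named2 a ls u p q" "named2 a ls v r t"
        and "p \<in> P" "q \<in> P" "r \<in> P" "t \<in> P" "p \<noteq> q" "r \<noteq> t" for p q r t
      proof -
        obtain p' q' where p': "named a ls (fst u) p'" "named a ls (snd u) q'" "p' = p \<and> q' = q \<or> p' = q \<and> q' = p"
          using nn(1) unfolding named2_def by blast
        obtain r' t' where r': "named a ls (fst v) r'" "named a ls (snd v) t'" "r' = r \<and> t' = t \<or> r' = t \<and> t' = r"
          using nn(2) unfolding named2_def by blast
        have "linked P (map_prod a a ` set W) p' q' r' t'"
          by (rule em[OF uv(1)]) (use p' r' that in auto)
        moreover have "linked P V q p r t = linked P V p q r t" "linked P V p q t r = linked P V p q r t"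
           "linked P V q p t r = linked P V p q r t" for V
          using linked_flip[of P V] linked_commute[of P V] by blast+
        ultimately show ?thesis using p'(3) r'(3) by auto
      qed
      from uv(2) show ?thesis
      proof
        assume "peq x u \<and> peq y v"
        then show ?thesis by (intro L0 iffD1[OF named2_peq n(1)] iffD1[OF named2_peq n(2)] P ne) simp_all
      next
        assume "peq x v \<and> peq y u"
        then have "linked P ?W r t p q" by (intro L0 iffD1[OF named2_peq n(1)] iffD1[OF named2_peq n(2)] P ne) simp_all
        then show ?thesis using linked_commute by blast
      qed
    qed
  qed
  have "okp gs ex W em x y \<or> okp gs ex W em y x"
  proof (rule all_ok_iff)
    show "all_ok (okp gs ex W em) (filter (\<lambda>x. \<not> inW W x) ?pl)" using chk by (simp add: chk_def)
  qed (use x y notW nW in auto)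
  then show "linked P ?W p q r t"
    using okl[OF _ x(2) y(2) P ne neq x(1)] okl[OF _ y(2) x(2) P(3,4,1,2) ne(2,1) _ y(1)] neq linked_commute[of P ?W r t p q] by auto
qed

section \<open>Labels as positions in a list of points\<close>

definition ixs :: "ix list" where "ixs = [A0, A1, A2, A3, A4, A5, A6, A7, A8]"

primrec pick :: "'a list \<Rightarrow> ix \<Rightarrow> 'a" where
  "pick vs A0 = vs ! 0" | "pick vs A1 = vs ! 1" | "pick vs A2 = vs ! 2" | "pick vs A3 = vs ! 3"
| "pick vs A4 = vs ! 4" | "pick vs A5 = vs ! 5" | "pick vs A6 = vs ! 6" | "pick vs A7 = vs ! 7"
| "pick vs A8 = vs ! 8" | "pick vs Out = undefined"

lemma pick_ixs: "i < 9 \<Longrightarrow> pick vs (ixs ! i) = vs ! i"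
proof -
  assume "i < 9"
  then have "i = 0 \<or> i = 1 \<or> i = 2 \<or> i = 3 \<or> i = 4 \<or> i = 5 \<or> i = 6 \<or> i = 7 \<or> i = 8" by auto
  then show ?thesis by (elim disjE) (simp_all add: ixs_def)
qed

lemma map_pick: assumes "length vs \<le> 9" shows "map (pick vs) (take (length vs) ixs) = vs"
proof (rule nth_equalityI)
  have l: "length ixs = 9" by (simp add: ixs_def)
  then show "length (map (pick vs) (take (length vs) ixs)) = length vs" using assms by simp
  fix i assume "i < length (map (pick vs) (take (length vs) ixs))"
  then have "i < length vs" "i < 9" using l by simp_all
  then show "map (pick vs) (take (length vs) ixs) ! i = vs ! i" using l pick_ixs[of i vs] by simp
qed

lemma pick_image: "length vs \<le> 9 \<Longrightarrow> pick vs ` set (take (length vs) ixs) = set vs"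
  using map_pick[of vs] by (metis list.set_map)

lemma pick_inj: "length vs \<le> 9 \<Longrightarrow> distinct vs \<Longrightarrow> inj_on (pick vs) (set (take (length vs) ixs))"
  using map_pick[of vs] by (metis distinct_map)

text \<open>The obligation behind an entry of \<open>em\<close>: each occurrence of
  \<open>Out\<close> ranges independently over the points outside \<open>vs\<close>.\<close>

definition joined :: "(real^2) list \<Rightarrow> ixp list \<Rightarrow> ixp \<Rightarrow> ixp \<Rightarrow> bool" where
  "joined vs W x y \<longleftrightarrow> (\<forall>p\<in>P. \<forall>q\<in>P. \<forall>r\<in>P. \<forall>t\<in>P. p \<noteq> q \<longrightarrow> r \<noteq> t \<longrightarrow>
     (if fst x = Out then p \<notin> set vs else p = pick vs (fst x)) \<longrightarrow> (if snd x = Out then q \<notin> set vs else q = pick vs (snd x)) \<longrightarrow>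
     (if fst y = Out then r \<notin> set vs else r = pick vs (fst y)) \<longrightarrow> (if snd y = Out then t \<notin> set vs else t = pick vs (snd y)) \<longrightarrow>
     linked P (map_prod (pick vs) (pick vs) ` set W) p q r t)"

text \<open>With labels read as list positions, all geometric hypotheses become
  \<open>list_all\<close> statements over concrete lists, which simplification splits into the
  individual facts.\<close>

lemma checker_list:
  fixes vs :: "(real^2) list"
  assumes chk: "chk opn (take (length vs) ixs) gs ex W em" and vs: "length vs \<le> 9" "distinct vs" "set vs \<subseteq> P"
    and cl: "opn \<or> P \<subseteq> set vs"
    and gs: "list_all (\<lambda>((i, j), S). guard (pick vs i) (pick vs j) (pick vs ` set S)) gs"
    and ex: "list_all (\<lambda>((i, j), (k, l)). dj (pick vs i) (pick vs j) (pick vs k) (pick vs l)) ex"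
    and W: "length W \<le> 9"
    and em: "list_all (\<lambda>(x, y). joined vs W x y) em"
  shows "meets_bound P"
proof (rule checker[OF chk _ _ pick_inj[OF vs(1,2)] _ _ _ W])
  note img = pick_image[OF vs(1)]
  show "opn \<or> P = pick vs ` set (take (length vs) ixs)" using cl vs(3) img by auto
  show "Out \<notin> set (take (length vs) ixs)" by (auto simp: ixs_def dest: in_set_takeD)
  show "pick vs i \<in> P" if "i \<in> set (take (length vs) ixs)" for i using that img vs(3) by blast
  show "guard (pick vs i) (pick vs j) (pick vs ` set S)" if "((i, j), S) \<in> set gs" for i j S
    using gs that by (auto simp: list_all_iff)
  show "dj (pick vs i) (pick vs j) (pick vs k) (pick vs l)" if "((i, j), (k, l)) \<in> set ex" for i j k l
    using ex that by (auto simp: list_all_iff)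
  fix x y p q r t
  assume h: "(x, y) \<in> set em" "p \<in> P" "q \<in> P" "r \<in> P" "t \<in> P" "p \<noteq> q" "r \<noteq> t"
    "named (pick vs) (take (length vs) ixs) (fst x) p" "named (pick vs) (take (length vs) ixs) (snd x) q"
    "named (pick vs) (take (length vs) ixs) (fst y) r" "named (pick vs) (take (length vs) ixs) (snd y) t"
  have n: "if i = Out then z \<notin> set vs else z = pick vs i" if "named (pick vs) (take (length vs) ixs) i z" for i z
    using that img by (auto simp: named_def split: if_splits)
  obtain i j where x: "x = (i, j)" by (cases x)
  obtain k l where y: "y = (k, l)" by (cases y)
  show "linked P (map_prod (pick vs) (pick vs) ` set W) p q r t"
    using em h(1) h(2-7) n[OF h(8)] n[OF h(9)] n[OF h(10)] n[OF h(11)]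
    unfolding list_all_iff joined_def x y by fastforce
qed

text \<open>The line \<open>ut\<close> has all points other than \<open>u\<close>, \<open>v\<close>,
  \<open>t\<close> on one side, so it separates the segment \<open>ut\<close> from every segment
  avoiding these three.\<close>

lemma guard_pend: assumes "pend u v t" shows "guard u t {u, v, t}"
  unfolding guard_def
proof (intro ballI)
  fix p q assume "p \<in> P - {u, v, t}" "q \<in> P - {u, v, t}"
  then have "L u t p" "L u t q" using assms unfolding pend_def by blast+
  then have "dj u t p q" by (intro sep[of u t u t p q]) auto
  then show "dj p q u t" by (simp add: dj_sym)
qed

section \<open>The hull polygon\<close>

lemma cross:
  assumes "L a b c" "L b a d" "L d c a" "L c d b" shows "\<not> dj a b c d"
proof (rule not_djI[of s a b c d "- s"])
  show "0 < s * ori a b c" "s * ori a b d < 0" using assms(1,2) L_neg[of b a d] by (simp_all add: L_def)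
  show "0 < - s * ori c d a" using assms(3) L_neg[of d c a] by simp
  show "- s * ori c d b < 0" using assms(4) by (simp add: L_def)
qed

text \<open>General position makes the relation \<open>L v\<close> a tournament on \<open>A\<close>;
  transitivity is a hypothesis because it can fail when \<open>A\<close> surrounds
  \<open>v\<close>.\<close>

lemma least_around:
  assumes "finite A" "A \<noteq> {}" "A \<subseteq> P - {v}" "v \<in> P"
    and tr: "\<And>p q r. \<lbrakk>p \<in> A; q \<in> A; r \<in> A; L v p q; L v q r\<rbrakk> \<Longrightarrow> L v p r"
  shows "\<exists>c\<in>A. \<forall>d\<in>A - {c}. L v c d"
  using assms(1-3) tr
proof (induction A rule: finite_ne_induct)
  case (singleton x) then show ?case by simp
next
  case (insert x F)
  have "\<exists>c\<in>F. \<forall>d\<in>F - {c}. L v c d"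
  proof (rule insert.IH)
    show "F \<subseteq> P - {v}" using insert.prems by blast
    show "L v p r" if "p \<in> F" "q \<in> F" "r \<in> F" "L v p q" "L v q r" for p q r
      using insert.prems(2)[of p q r] that by blast
  qed
  then obtain c where c: "c \<in> F" "\<And>d. d \<in> F - {c} \<Longrightarrow> L v c d" by blast
  show ?case
  proof (cases "L v c x")
    case True
    then show ?thesis using c by (intro bexI[of _ c]) auto
  next
    case False
    have "v \<noteq> c" "v \<noteq> x" "c \<noteq> x" "c \<in> P" "x \<in> P" using insert.prems(1) insert.hyps c(1) by auto
    then have "L c v x" using False L_swap[of v c x] assms(4) by blast
    then have xc: "L v x c" using L_rot[of v x c] L_rot[of x c v] by blast
    have "L v x d" if "d \<in> insert x F - {x}" for d
    proof (cases "d = c")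
      case True then show ?thesis using xc by simp
    next
      case False
      then have "L v c d" using c(2) that by blast
      then show ?thesis using insert.prems(2)[of x c d] xc c(1) that by blast
    qed
    then show ?thesis by blast
  qed
qed

text \<open>A hull edge at \<open>v\<close> confines all other points to a half plane, where turning
  about \<open>v\<close> is a linear order.\<close>

lemma E_trans:
  assumes "E v w" "p \<in> P - {v}" "q \<in> P - {v}" "r \<in> P - {v}" "L v p q" "L v q r"
  shows "L v p r"
  by (rule L_trans[of p q r w v]) (use assms in \<open>auto simp: E_def\<close>)

text \<open>One step of gift wrapping: all points lie on one side of \<open>uv\<close>, hence are
  linearly ordered around \<open>v\<close>, and the first of them is the next hull vertex.\<close>

lemma E_next: assumes "E u v" "card P \<ge> 3" shows "\<exists>w. E v w"
proof -
  have uv: "u \<in> P" "v \<in> P" "u \<noteq> v" "\<And>x. x \<in> P - {u, v} \<Longrightarrow> L u v x" using assms(1) by (auto simp: E_def)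
  let ?A = "P - {u, v}"
  have "?A \<noteq> {}"
  proof
    assume "?A = {}"
    then have "P \<subseteq> {u, v}" by blast
    then have "card P \<le> card {u, v}" by (intro card_mono) auto
    then show False using assms(2) uv(3) by simp
  qed
  have "\<exists>c\<in>?A. \<forall>d\<in>?A - {c}. L v c d"
  proof (rule least_around)
    fix p q r assume h: "p \<in> ?A" "q \<in> ?A" "r \<in> ?A" "L v p q" "L v q r"
    text \<open>The argument of \<open>L_trans\<close> reflected: here every point lies to the right of the ray from v to u.\<close>
    have id: "ori v u q * ori v p r = ori v u p * ori v q r + ori v u r * ori v p q"
      by (simp add: ori_def algebra_simps)
    have neg: "s * ori v u x < 0" if "x \<in> ?A" for x
      using uv(4)[OF that] L_neg[of u v x] by simp
    have ss: "s * s = 1" using sgn by auto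
    have "(s * ori v u q) * (s * ori v p r) = (s * ori v u p) * (s * ori v q r) + (s * ori v u r) * (s * ori v p q)"
    proof -
      have "(s * ori v u q) * (s * ori v p r) = s * s * (ori v u q * ori v p r)" by simp
      also have "\<dots> = s * s * (ori v u p * ori v q r + ori v u r * ori v p q)" using id by simp
      finally show ?thesis by (simp add: algebra_simps)
    qed
    moreover have "(s * ori v u p) * (s * ori v q r) < 0" "(s * ori v u r) * (s * ori v p q) < 0"
      using neg h by (auto simp: L_def mult_neg_pos)
    ultimately have "(s * ori v u q) * (s * ori v p r) < 0" by linarith
    then show "L v p r" using neg[OF h(2)] by (simp add: L_def mult_less_0_iff)
  qed (use fin uv \<open>?A \<noteq> {}\<close> in auto)
  then obtain c where c: "c \<in> ?A" "\<And>d. d \<in> ?A - {c} \<Longrightarrow> L v c d" by blast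
  have "L v c u" using uv(4)[OF c(1)] L_rot[of u v c] by blast
  then have "E v c" using c uv by (auto simp: E_def)
  then show ?thesis by blast
qed

lemma E_inj: assumes "E a c" "E b c" shows "a = b"
proof (rule ccontr)
  assume "a \<noteq> b"
  then have "L a c b" "L b c a" using assms by (auto simp: E_def)
  then show False using L_rot[of a c b] L_asym[of c b a] by blast
qed

lemma E_start: assumes "card P \<ge> 3" shows "\<exists>v w. E v w"
proof -
  have "P \<noteq> {}" using assms by auto
  then have "Max (norm ` P) \<in> norm ` P" using fin by (intro Max_in) auto
  then obtain v where "v \<in> P" "Max (norm ` P) = norm v" by blast
  moreover have "norm x \<le> Max (norm ` P)" if "x \<in> P" for x using fin that by (intro Max_ge) auto
  ultimately have v: "v \<in> P" "\<And>x. x \<in> P \<Longrightarrow> norm x \<le> norm v" by simp_all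
  text \<open>The farthest point from the origin is a hull vertex.\<close>
  define t where "t = v + (\<chi> i. if i = 1 then - s * (v $ 2) else s * (v $ 1))"
  \<comment> \<open>The vector \<open>t - v\<close> is \<open>v\<close> turned by a right angle in
    the sense given by \<open>s\<close>, so \<open>L v t p\<close> says that \<open>p\<close> lies
    strictly inside the tangent at \<open>v\<close> to the circle about the origin.\<close>
  have pos: "L v t p" if "p \<in> P - {v}" for p
  proof -
    have "p \<bullet> v \<le> norm p * norm v" by (rule norm_cauchy_schwarz)
    also have "\<dots> \<le> norm v * norm v" using v(2) that by (intro mult_right_mono) auto
    also have "\<dots> = v \<bullet> v" by (simp add: dot_square_norm power2_eq_square)
    finally have le: "p \<bullet> v \<le> v \<bullet> v" .
    have "p \<bullet> v \<noteq> v \<bullet> v"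
    proof
      assume e: "p \<bullet> v = v \<bullet> v"
      have "(norm (p - v))\<^sup>2 = p \<bullet> p - 2 * (p \<bullet> v) + v \<bullet> v"
        by (simp add: power2_norm_eq_inner inner_diff inner_commute)
      also have "\<dots> = p \<bullet> p - v \<bullet> v" using e by simp
      also have "\<dots> \<le> 0"
        using v(2)[of p] that by (simp add: dot_square_norm power_mono)
      finally show False using that by simp
    qed
    then have "0 < v \<bullet> v - p \<bullet> v" using le by simp
    moreover have "s * ori v t p = v \<bullet> v - p \<bullet> v"
    proof -
      have "s * s = 1" using sgn by auto
      then have ss: "s * (s * x) = x" for x by (metis mult.assoc mult_1)
      show ?thesis unfolding ori_def t_def inner_vec_def
        by (simp add: sum_2 algebra_simps ss)
    qed
    ultimately show ?thesis by (simp add: L_def)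
  qed
  have "\<exists>c\<in>P - {v}. \<forall>d\<in>P - {v} - {c}. L v c d"
  proof (rule least_around)
    show "P - {v} \<noteq> {}"
    proof
      assume "P - {v} = {}"
      then have "card P \<le> card {v}" by (intro card_mono) auto
      then show False using assms by simp
    qed
    fix p q r assume h: "p \<in> P - {v}" "q \<in> P - {v}" "r \<in> P - {v}" "L v p q" "L v q r"
    show "L v p r" by (rule L_trans[of p q r t v]) (use h pos in auto)
  qed (use fin v in auto)
  then show ?thesis using v(1) by (auto simp: E_def)
qed

section \<open>Hull vertices in cyclic order\<close>

definition cyc :: "(real^2) list \<Rightarrow> bool" where
  "cyc vs \<longleftrightarrow> distinct vs \<and> 3 \<le> length vs \<and> (\<forall>i < length vs. E (vs ! i) (vs ! (Suc i mod length vs)))"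

text \<open>Following hull edges must repeat a vertex, and as predecessors are unique
  (\<open>E_inj\<close>), a repetition can be shifted back to the start; the least period
  \<open>h\<close> gives the cycle. Period 2 would put every further point on both sides of one
  line.\<close>

lemma cyc_exists: assumes "card P \<ge> 3" shows "\<exists>vs. cyc vs"
proof -
  obtain v0 w0 where v0: "E v0 w0" using E_start[OF assms] by blast
  define f where "f v = (SOME w. E v w)" for v
  have f: "E v (f v)" if "\<exists>w. E v w" for v unfolding f_def by (rule someI_ex[OF that])
  define g where "g k = (f ^^ k) v0" for k
  have gE: "E (g k) (g (Suc k))" for k
  proof (induction k)
    case 0 then show ?case using f[of v0] v0 by (auto simp: g_def)
  next
    case (Suc k)
    then show ?case using f[of "g (Suc k)"] E_next[OF Suc assms] by (simp add: g_def)
  qed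
  have gP: "g k \<in> P" for k using gE[of k] by (simp add: E_def)
  have unshift: "g i = g (i + d) \<Longrightarrow> g 0 = g d" for i d :: nat
  proof (induction i)
    case (Suc i)
    then show ?case using E_inj[OF gE[of i], of "g (i + d)"] gE[of "i + d"] by simp
  qed simp
  have "\<not> inj g" using gP finite_subset[OF _ fin, of "range g"] finite_imageD[of g UNIV] by auto
  then obtain i j where "g i = g j" "i < j" unfolding inj_def by (metis linorder_neqE_nat)
  then have "g 0 = g (j - i)" "0 < j - i" using unshift[of i "j - i"] by auto
  then have ex: "\<exists>h. 0 < h \<and> g h = g 0" by metis
  define h where "h = (LEAST h. 0 < h \<and> g h = g 0)"
  have h: "0 < h" "g h = g 0" using LeastI_ex[OF ex] by (simp_all add: h_def)
  have hmin: "g k \<noteq> g 0" if "0 < k" "k < h" for k using not_less_Least[of k "\<lambda>h. 0 < h \<and> g h = g 0"] that by (auto simp: h_def)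
  have dist: "g i \<noteq> g j" if "i < j" "j < h" for i j
  proof
    assume "g i = g j"
    then have "g 0 = g (j - i)" using unshift[of i "j - i"] that by simp
    moreover have "0 < j - i" "j - i < h" using that by simp_all
    ultimately show False using hmin by metis
  qed
  have "h \<noteq> 1" using gE[of 0] h by (auto simp: E_def)
  moreover have "h \<noteq> 2"
  proof
    assume h2: "h = 2"
    have e: "E (g 0) (g 1)" "E (g 1) (g 0)" using gE[of 0] gE[of 1] h h2 by (simp_all add: numeral_2_eq_2)
    have "\<not> P \<subseteq> {g 0, g 1}"
    proof
      assume "P \<subseteq> {g 0, g 1}"
      then have "card P \<le> card {g 0, g 1}" by (intro card_mono) auto
      also have "\<dots> \<le> 2" by (simp add: card_insert_if)
      finally show False using assms by simp
    qed
    then obtain x where "x \<in> P" "x \<noteq> g 0" "x \<noteq> g 1" by blast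
    then have "L (g 0) (g 1) x" "L (g 1) (g 0) x" using e by (auto simp: E_def)
    then show False using L_asym by blast
  qed
  ultimately have "3 \<le> h" using h by linarith
  moreover have "distinct (map g [0..<h])"
  proof -
    have "inj_on g {0..<h}" unfolding inj_on_def using dist by (metis atLeastLessThan_iff linorder_neqE_nat)
    then show ?thesis by (simp add: distinct_map)
  qed
  moreover have "E (map g [0..<h] ! i) (map g [0..<h] ! (Suc i mod length (map g [0..<h])))" if "i < h" for i
  proof (cases "Suc i = h")
    case True then show ?thesis using gE[of i] h by simp
  next
    case False then show ?thesis using gE[of i] that by simp
  qed
  ultimately have "cyc (map g [0..<h])" by (simp add: cyc_def)
  then show ?thesis by blast
qed

lemma cyc_rotate: assumes "cyc vs" shows "cyc (rotate k vs)"
proof -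
  let ?n = "length vs"
  have n: "0 < ?n" using assms by (auto simp: cyc_def)
  have "E (rotate k vs ! i) (rotate k vs ! (Suc i mod ?n))" if "i < ?n" for i
  proof -
    have "rotate k vs ! i = vs ! ((k + i) mod ?n)" "rotate k vs ! (Suc i mod ?n) = vs ! ((k + Suc i mod ?n) mod ?n)"
      using that n by (auto simp: nth_rotate add.commute)
    moreover have "(k + Suc i mod ?n) mod ?n = Suc ((k + i) mod ?n) mod ?n" by (simp add: mod_simps)
    ultimately show ?thesis using assms n by (auto simp: cyc_def)
  qed
  then show ?thesis using assms by (simp add: cyc_def)
qed

text \<open>Seen from \<open>vs ! i\<close>, every later hull edge turns in the same direction, and
  \<open>E_trans\<close> at \<open>vs ! i\<close> chains these turns.\<close>

lemma cyc_L:
  assumes "cyc vs" "i < j" "j < k" "k < length vs" shows "L (vs ! i) (vs ! j) (vs ! k)"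
proof -
  have Es: "E (vs ! m) (vs ! Suc m)" if "Suc m < length vs" for m
    using assms(1) that unfolding cyc_def by (metis Suc_lessD mod_less)
  have ne: "vs ! a \<noteq> vs ! b" if "a \<noteq> b" "a < length vs" "b < length vs" for a b
    using assms(1) that by (simp add: cyc_def nth_eq_iff_index_eq)
  have inP: "vs ! a \<in> P" if "a < length vs" for a using assms(1) that by (auto simp: cyc_def E_def)
  have "j < k \<Longrightarrow> k < length vs \<Longrightarrow> L (vs ! i) (vs ! j) (vs ! k)"
  proof (induction k)
    case (Suc k)
    have step: "L (vs ! i) (vs ! m) (vs ! Suc m)" if "i < m" "Suc m < length vs" for m
    proof -
      have "L (vs ! m) (vs ! Suc m) (vs ! i)"
        using Es[OF that(2)] inP[of i] ne[of i m] ne[of i "Suc m"] that by (auto simp: E_def)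
      then show ?thesis using L_rot by blast
    qed
    show ?case
    proof (cases "j = k")
      case True then show ?thesis using step[of k] Suc.prems assms(2) by simp
    next
      case False
      then have jk: "L (vs ! i) (vs ! j) (vs ! k)" using Suc by simp
      show ?thesis
        by (rule E_trans[OF Es[of i], of "vs ! j" "vs ! k"])
          (use Suc.prems assms(2) False jk step[of k] inP ne[of i] in auto)
    qed
  qed simp
  then show ?thesis using assms by blast
qed

text \<open>The ear triangle \<open>uvw\<close> contains further points, and \<open>t\<close> is the first of them around \<open>u\<close>.\<close>
definition ear :: "real^2 \<Rightarrow> real^2 \<Rightarrow> real^2 \<Rightarrow> real^2 \<Rightarrow> bool" where
  "ear u v w t \<longleftrightarrow> pend u v t \<and> t \<noteq> w \<and> L w u t"

text \<open>Let \<open>t\<close> be the first point after \<open>v\<close> in the rotation about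
  \<open>u\<close>. If \<open>t\<close> were \<open>w\<close>, nothing could lie in the ear; so in a
  nonempty ear \<open>t\<close> comes before \<open>w\<close>.\<close>

lemma ear_cases:
  assumes "E u v" "E v w" "u \<noteq> w" shows "short u v w \<or> (\<exists>t. ear u v w t)"
proof (cases "\<forall>x\<in>P - {u, v, w}. L u w x")
  case True
  have "L u v w" using assms by (auto simp: E_def)
  then show ?thesis using True assms L_rot[of w u v] unfolding short_def E_def by auto
next
  case False
  then obtain z where z: "z \<in> P - {u, v, w}" "\<not> L u w z" by blast
  have uv: "u \<in> P" "v \<in> P" "w \<in> P" "u \<noteq> v" "v \<noteq> w" using assms by (auto simp: E_def)
  have "\<exists>c\<in>P - {u, v}. \<forall>d\<in>P - {u, v} - {c}. L u c d"
  proof (rule least_around)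
    show "L u p r" if "p \<in> P - {u, v}" "q \<in> P - {u, v}" "r \<in> P - {u, v}" "L u p q" "L u q r" for p q r
      by (rule E_trans[OF assms(1)]) (use that in blast)+
    show "P - {u, v} \<noteq> {}" using z by blast
  qed (use fin uv in auto)
  then obtain t where t: "t \<in> P - {u, v}" "\<And>d. d \<in> P - {u, v, t} \<Longrightarrow> L u t d" by blast
  have "t \<noteq> w" using t z by auto
  then have "L u t w" using t(2) uv assms(3) by auto
  then have "L w u t" using L_rot by blast
  moreover have "pend u v t" using t assms(1) by (auto simp: pend_def)
  ultimately show ?thesis using \<open>t \<noteq> w\<close> by (auto simp: ear_def)
qed

text \<open>A point inside the triangle \<open>xyz\<close> is a convex combination of its corners,
  so no affine functional is negative at the corners and positive at \<open>t\<close>.\<close>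

lemma cap_not_tri:
  assumes "cap v t" "x \<in> P - {v, t}" "y \<in> P - {v, t}" "z \<in> P - {v, t}"
    and tri: "L x y t" "L y z t" "L z x t"
  shows False
proof -
  obtain f where f: "aff f" "0 < f t" "\<And>x. x \<in> P - {v, t} \<Longrightarrow> f x < 0"
    using assms(1) unfolding cap_def by blast
  \<comment> \<open>The areas of the opposite subtriangles are the barycentric weights of
    \<open>t\<close>. They are applied in two stages, via \<open>w\<close> on \<open>yz\<close>,
    because \<open>aff\<close> speaks of two points only.\<close>
  define A where "A = s * ori y z t"
  define B where "B = s * ori z x t"
  define C where "C = s * ori x y t"
  have pos: "0 < A" "0 < B" "0 < C" using tri by (auto simp: L_def A_def B_def C_def)
  have comp: "(A + B + C) * t $ i = A * x $ i + B * y $ i + C * z $ i" for i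
    using exhaust_2[of i] by (auto simp: A_def B_def C_def ori_def algebra_simps)
  define w where "w = (B / (B + C)) *\<^sub>R y + (C / (B + C)) *\<^sub>R z"
  have "t = (A / (A + B + C)) *\<^sub>R x + ((B + C) / (A + B + C)) *\<^sub>R w"
  proof -
    have "t $ i = ((A / (A + B + C)) *\<^sub>R x + ((B + C) / (A + B + C)) *\<^sub>R w) $ i" for i
    proof -
      have "(B + C) * w $ i = B * y $ i + C * z $ i"
        using pos by (simp add: w_def distrib_left)
      then have "((A / (A + B + C)) *\<^sub>R x + ((B + C) / (A + B + C)) *\<^sub>R w) $ i = (A * x $ i + B * y $ i + C * z $ i) / (A + B + C)"
        by (simp add: add_divide_distrib[symmetric])
      also have "\<dots> = t $ i" using comp[of i] pos by (simp add: field_simps)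
      finally show ?thesis by simp
    qed
    then show ?thesis by (simp add: vec_eq_iff)
  qed
  moreover have "A / (A + B + C) + (B + C) / (A + B + C) = 1" "B / (B + C) + C / (B + C) = 1"
    using pos by (simp_all add: add_divide_distrib[symmetric])
  ultimately have "f t = A / (A + B + C) * f x + (B + C) / (A + B + C) * f w" "f w = B / (B + C) * f y + C / (B + C) * f z"
    using f(1) unfolding aff_def w_def by metis+
  moreover have "f x < 0" "f y < 0" "f z < 0" using f(3) assms by auto
  moreover have "0 < A / (A + B + C)" "0 < (B + C) / (A + B + C)" "0 < B / (B + C)" "0 < C / (B + C)"
    using pos by simp_all
  ultimately have "f w < 0" "f t < 0 \<or> 0 \<le> f w"
    using mult_pos_neg[of "B / (B + C)" "f y"] mult_pos_neg[of "C / (B + C)" "f z"]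
      mult_pos_neg[of "A / (A + B + C)" "f x"] mult_pos_neg[of "(B + C) / (A + B + C)" "f w"] by linarith+
  then have "f t < 0" by linarith
  then show False using f(2) by simp
qed

text \<open>A point where \<open>aa'\<close> meets the line \<open>cd\<close> would lie on the segment \<open>cd\<close> or beyond one of its ends;
  each position contradicts one of the three separating lines.\<close>
lemma cap_line:
  assumes "cap a a'" "cap c c'" "cap d d'" "c \<noteq> d"
    "c \<notin> {a, a'}" "d \<notin> {a, a'}" "{a, a', d} \<inter> {c, c'} = {}" "{a, a', c} \<inter> {d, d'} = {}"
  shows "L c d a \<longleftrightarrow> L c d a'"
proof -
  have "\<not> (L c d b \<and> L d c b')" if h: "{b, b'} = {a, a'}" for b b'
  proof
    assume "L c d b \<and> L d c b'"
    then have pos: "0 < s * ori c d b" "s * ori c d b' < 0" using L_neg[of d c b'] by (auto simp: L_def)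
    obtain fa where fa: "aff fa" "0 < fa b" "0 < fa b'" "fa c < 0" "fa d < 0"
      using assms(1,2,3,5,6) h unfolding cap_def by (smt (verit) Diff_iff doubleton_eq_iff)
    obtain fc where fc: "aff fc" "0 < fc c" "fc b < 0" "fc b' < 0" "fc d < 0"
    proof -
      obtain f where "aff f" "0 < f c" "\<And>x. x \<in> P - {c, c'} \<Longrightarrow> f x < 0" using assms(2) unfolding cap_def by blast
      moreover have "b \<in> P - {c, c'}" "b' \<in> P - {c, c'}" "d \<in> P - {c, c'}"
        using assms h by (auto simp: cap_def doubleton_eq_iff)
      ultimately show thesis using that by blast
    qed
    obtain fd where fd: "aff fd" "0 < fd d" "fd b < 0" "fd b' < 0" "fd c < 0"
    proof -
      obtain f where "aff f" "0 < f d" "\<And>x. x \<in> P - {d, d'} \<Longrightarrow> f x < 0" using assms(3) unfolding cap_def by blast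
      moreover have "b \<in> P - {d, d'}" "b' \<in> P - {d, d'}" "c \<in> P - {d, d'}"
        using assms h by (auto simp: cap_def doubleton_eq_iff)
      ultimately show thesis using that by blast
    qed
    define u where "u = s * ori c d b"
    define u' where "u' = - (s * ori c d b')"
    have uu: "0 < u" "0 < u'" using pos by (auto simp: u_def u'_def)
    define al be where "al = u' / (u + u')" and "be = u / (u + u')"
    have cv: "0 < al" "0 < be" using uu by (auto simp: al_def be_def)
    define y where "y = al *\<^sub>R b + be *\<^sub>R b'"
    have one: "al + be = 1" using uu by (simp add: al_def be_def add_divide_distrib[symmetric] add.commute)
    have "s * ori c d y = al * (s * ori c d b) + be * (s * ori c d b')"
      unfolding y_def ori_affine[OF one] by (simp add: algebra_simps)
    also have "\<dots> = al * u - be * u'" by (simp add: u_def u'_def)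
    also have "\<dots> = 0" by (simp add: al_def be_def)
    finally have "s * ori c d y = 0" .
    then have "ori c d y = 0" using sgn by auto
    then obtain k where k: "y = (1 - k) *\<^sub>R c + k *\<^sub>R d" using ori_zero_line assms(4) by blast
    have on: "f y = al * f b + be * f b'" if "aff f" for f
      using that one unfolding aff_def y_def by blast
    have ya: "0 < fa y" using on[OF fa(1)] cv fa by (simp add: add_pos_pos)
    have yc: "fc y < 0" using on[OF fc(1)] cv fc by (simp add: add_neg_neg mult_pos_neg)
    have yd: "fd y < 0" using on[OF fd(1)] cv fd by (simp add: add_neg_neg mult_pos_neg)
    have lin: "f y = (1 - k) * f c + k * f d" if "aff f" for f
      using that unfolding aff_def k by (metis diff_add_cancel)
    consider "0 \<le> k" "k \<le> 1" | "k > 1" | "k < 0" by linarith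
    then show False
    proof cases
      case 1
      then have "fa y \<le> 0" using lin[OF fa(1)] fa by (simp add: add_nonpos_nonpos mult_nonneg_nonpos)
      then show False using ya by simp
    next
      case 2
      then have "0 < (1 - k) * fd c" "0 < k * fd d" using fd by (simp_all add: mult_neg_neg)
      then show False using lin[OF fd(1)] yd by linarith
    next
      case 3
      then have "0 < (1 - k) * fc c" "0 < k * fc d" using fc by (simp_all add: mult_neg_neg)
      then show False using lin[OF fc(1)] yc by linarith
    qed
  qed
  then have n: "\<not> (L c d a \<and> L d c a')" "\<not> (L c d a' \<and> L d c a)" by blast+
  have "L d c x \<longleftrightarrow> \<not> L c d x" if "x \<in> {a, a'}" for x
    by (rule L_swap) (use assms that in \<open>auto simp: cap_def\<close>)
  then show ?thesis using n by blast
qed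

lemma linked_dj: "dj p q r t \<Longrightarrow> linked P W p q r t"
  by (simp add: linked_def)

lemma linked_via:
  assumes "(i, j) \<in> set W" "dj p q (a i) (a j)" "dj r t (a i) (a j)"
  shows "linked P (map_prod a a ` set W) p q r t"
proof -
  have "(a i, a j) \<in> map_prod a a ` set W" using assms(1) by force
  moreover have "case (a i, a j) of (x, y) \<Rightarrow> dj p q x y \<and> dj r t x y" using assms(2,3) by simp
  ultimately have "\<exists>(x, y)\<in>map_prod a a ` set W. dj p q x y \<and> dj r t x y" by (rule bexI[rotated])
  then show ?thesis unfolding linked_def by (rule disjI2[OF disjI1])
qed

lemma sep_touch2:
  assumes "L b a q" "L a b t" shows "dj a q b t"
proof (rule dj_sep0[of a b "- s"])
  show "a \<noteq> b" using assms by auto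
  show "0 < - s * ori a b q" using assms(1) L_neg[of b a q] by simp
  show "- s * ori a b t < 0" using assms(2) by (simp add: L_def)
qed

text \<open>Here \<open>z\<close> lies inside the triangle \<open>xyw\<close>. Weighting the
  orientations of \<open>xzq\<close>, \<open>yzq\<close>, \<open>wzq\<close> by the barycentric
  coordinates of \<open>z\<close> gives zero, so they cannot all be positive.\<close>

lemma tri_star:
  assumes "L x y z" "L y w z" "L w x z" "L x z q" "L y z q" "L w z q" shows False
proof -
  have "ori y w z * ori x z q + ori w x z * ori y z q + ori x y z * ori w z q = 0"
    by (simp add: ori_def algebra_simps)
  moreover have "s * s = 1" using sgn by auto
  then have ss: "(s * x) * (s * y) = x * y" for x y by (metis mult.assoc mult.left_commute mult_1)
  have "0 < (s * ori y w z) * (s * ori x z q)" "0 < (s * ori w x z) * (s * ori y z q)" "0 < (s * ori x y z) * (s * ori w z q)"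
    using assms unfolding L_def by (rule_tac [!] mult_pos_pos)
  ultimately show False unfolding ss by linarith
qed

lemma cyc_E: "cyc vs \<Longrightarrow> i < length vs \<Longrightarrow> E (vs ! i) (vs ! (Suc i mod length vs))"
  by (simp add: cyc_def)

lemma cyc_cross:
  assumes "cyc vs" "i < j" "j < k" "k < l" "l < length vs"
  shows "\<not> dj (vs ! i) (vs ! k) (vs ! j) (vs ! l)" "\<not> dj (vs ! j) (vs ! l) (vs ! i) (vs ! k)"
proof -
  have L4: "L (vs ! i) (vs ! j) (vs ! k)" "L (vs ! i) (vs ! j) (vs ! l)" "L (vs ! i) (vs ! k) (vs ! l)" "L (vs ! j) (vs ! k) (vs ! l)"
    using assms by (auto intro!: cyc_L)
  have "\<not> dj (vs ! i) (vs ! k) (vs ! l) (vs ! j)"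
  proof (rule cross)
    show "L (vs ! i) (vs ! k) (vs ! l)" by (rule L4)
    show "L (vs ! k) (vs ! i) (vs ! j)" using L4(1) L_rot by blast
    show "L (vs ! j) (vs ! l) (vs ! i)" using L4(2) L_rot by blast
    show "L (vs ! l) (vs ! j) (vs ! k)" using L4(4) L_rot by blast
  qed
  then show "\<not> dj (vs ! i) (vs ! k) (vs ! j) (vs ! l)" "\<not> dj (vs ! j) (vs ! l) (vs ! i) (vs ! k)"
    by (simp_all add: dj_flip2[of _ _ "vs ! l"] dj_sym[of "vs ! j"])
qed

text \<open>By \<open>cap_line\<close>, replacing a point by its partner in the same cap keeps the
  orientation; this is done for the three points in turn.\<close>

lemma caps_sign:
  assumes "cap a a'" "cap b b'" "cap c c'" "distinct [a, a', b, b', c, c']"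
    "x \<in> {a, a'}" "y \<in> {b, b'}" "z \<in> {c, c'}"
  shows "L x y z \<longleftrightarrow> L a b c"
proof -
  have "\<exists>x'. cap x x' \<and> {x, x'} = {a, a'}" "\<exists>y'. cap y y' \<and> {y, y'} = {b, b'}" "\<exists>z'. cap z z' \<and> {z, z'} = {c, c'}"
    using assms cap_sym by (auto simp: insert_commute)
  then obtain x' y' z' where o: "cap x x'" "{x, x'} = {a, a'}" "cap y y'" "{y, y'} = {b, b'}" "cap z z'" "{z, z'} = {c, c'}" by blast
  have "L y z x \<longleftrightarrow> L y z a"
  proof (cases "x = a")
    case False
    then have "x = a'" using assms by simp
    show ?thesis unfolding \<open>x = a'\<close>
      by (rule cap_line[OF assms(1) o(3,5), symmetric]) (use assms o in auto)
  qed simp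
  moreover have "L z a y \<longleftrightarrow> L z a b"
  proof (cases "y = b")
    case False
    then have "y = b'" using assms by simp
    show ?thesis unfolding \<open>y = b'\<close>
      by (rule cap_line[OF assms(2) o(5) assms(1), symmetric]) (use assms o in auto)
  qed simp
  moreover have "L a b z \<longleftrightarrow> L a b c"
  proof (cases "z = c")
    case False
    then have "z = c'" using assms by simp
    show ?thesis unfolding \<open>z = c'\<close>
      by (rule cap_line[OF assms(3) assms(1,2), symmetric]) (use assms in auto)
  qed simp
  ultimately show ?thesis using L_rot by blast
qed

section \<open>Witness sets for the individual configurations\<close>

lemma heptagon_far:
  assumes c: "cyc [w0, w1, w2, w3, w4, w5, w6]" and cl: "P \<subseteq> {w0, w1, w2, w3, w4, w5, w6}"
    and W: "(w1, w2) \<in> W" "(w3, w4) \<in> W"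
  shows "linked P W w0 w4 w2 w5"
proof -
  let ?w = "[w0, w1, w2, w3, w4, w5, w6]"
  have dist: "distinct ?w" using c by (simp add: cyc_def)
  have inP: "set ?w \<subseteq> P"
  proof
    fix x assume "x \<in> set ?w"
    then obtain i where "i < length ?w" "x = ?w ! i" by (metis in_set_conv_nth)
    then show "x \<in> P" using cyc_E[OF c, of i] by (simp add: E_def)
  qed
  have e: "E w1 w2" "E w3 w4" using cyc_E[OF c, of 1] cyc_E[OF c, of 3] by simp_all
  have "dj w0 w4 w1 w2" "dj w1 w2 w3 w4" "dj w2 w5 w3 w4"
    using cap_free[OF E_cap[OF e(1)], of w0 w4] cap_free[OF E_cap[OF e(2)], of w1 w2]
      cap_free[OF E_cap[OF e(2)], of w2 w5] inP dist by auto
  then have "\<exists>(a, b)\<in>W. \<exists>(c, d)\<in>W. dj w0 w4 a b \<and> dj a b c d \<and> dj w2 w5 c d"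
    using W by (intro bexI[of _ "(w1, w2)"] bexI[of _ "(w3, w4)"] case_prodI2) auto
  moreover have "\<not> (dj w0 w4 a b \<and> dj w2 w5 a b)" if ab: "a \<in> P" "b \<in> P" "a \<noteq> b" for a b
  proof
    assume h: "dj w0 w4 a b \<and> dj w2 w5 a b"
    have "a \<notin> {w0, w4, w2, w5}" "b \<notin> {w0, w4, w2, w5}" using h dj_share by auto
    then have "a \<in> {w1, w3, w6}" "b \<in> {w1, w3, w6}" using ab cl by auto
    moreover have "\<not> dj w2 w5 w1 w3" "\<not> dj w0 w4 w1 w6" "\<not> dj w2 w5 w3 w6"
      using cyc_cross[OF c, of 1 2 3 5] cyc_cross[OF c, of 0 1 4 6] cyc_cross[OF c, of 2 3 5 6] by simp_all
    ultimately show False using h ab(3) dj_flip2 by blast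
  qed
  ultimately show ?thesis unfolding linked_def by (intro disjI2 conjI) auto
qed

text \<open>A pair hitting the hull edges and the caps \<open>v1a\<close>, \<open>v2b\<close>,
  \<open>v0c\<close> either has all three hull vertices among its ends, which forces a hull edge,
  or, up to rotation, contains \<open>v0\<close>, \<open>v2\<close>, \<open>a\<close>. In the latter
  case \<open>v2a\<close> and \<open>v0v2\<close> are in \<open>W\<close>, and \<open>v0a\<close> is
  protected by \<open>guard_pend\<close>.\<close>

lemma triangle_three:
  assumes e: "E v0 v1" "E v1 v2" "E v2 v0"
    and p: "pend v0 v1 a" "pend v1 v2 b" "pend v2 v0 c" and dist: "distinct [v0, v1, v2, a, b, c]"
  shows "meets_bound P"
proof -
  let ?vs = "[v0, v1, v2, a, b, c]"
  let ?W = "[(A0, A1), (A1, A2), (A2, A0), (A1, A3), (A2, A3), (A2, A4), (A0, A4), (A0, A5), (A1, A5)]"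
  let ?gs = "[((A0, A1), [A0, A1]), ((A1, A2), [A1, A2]), ((A2, A0), [A2, A0]), ((A1, A3), [A1, A3]), ((A0, A3), [A0, A1, A3]), ((A2, A4), [A2, A4]), ((A1, A4), [A1, A2, A4]), ((A0, A5), [A0, A5]), ((A2, A5), [A2, A0, A5])]"
  note g = e[THEN E_cap, THEN guard_cap] p[THEN pend_cap, THEN guard_cap] p[THEN guard_pend]
  have inP: "set ?vs \<subseteq> P" using e p by (auto simp: E_def pend_def)
  show ?thesis
  proof (rule checker_list[where vs = ?vs and opn = True and gs = ?gs and ex = "[]" and W = ?W and em = "[]"])
    show "chk True (take (length ?vs) ixs) ?gs [] ?W []" by (simp add: ixs_def, code_simp)
    show "distinct ?vs" using dist by simp
    show "set ?vs \<subseteq> P" using inP by simp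
    show "list_all (\<lambda>((i, j), S). guard (pick ?vs i) (pick ?vs j) (pick ?vs ` set S)) ?gs" using g by simp
  qed simp_all
qed

text \<open>The set \<open>W\<close> of \<open>triangle_three\<close> with the first two ear points
  identified.\<close>

lemma triangle_two:
  assumes e: "E v0 v1" "E v1 v2" "E v2 v0"
    and p: "pend v0 v1 a" "pend v1 v2 a" "pend v2 v0 b" and dist: "distinct [v0, v1, v2, a, b]"
  shows "meets_bound P"
proof -
  let ?vs = "[v0, v1, v2, a, b]"
  let ?W = "[(A0, A1), (A1, A2), (A2, A0), (A1, A3), (A2, A3), (A0, A3), (A0, A4), (A1, A4)]"
  let ?gs = "[((A0, A1), [A0, A1]), ((A1, A2), [A1, A2]), ((A2, A0), [A2, A0]), ((A1, A3), [A1, A3]), ((A0, A3), [A0, A1, A3]), ((A2, A3), [A2, A3]), ((A1, A3), [A1, A2, A3]), ((A0, A4), [A0, A4]), ((A2, A4), [A2, A0, A4])]"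
  note g = e[THEN E_cap, THEN guard_cap] p[THEN pend_cap, THEN guard_cap] p[THEN guard_pend]
  have inP: "set ?vs \<subseteq> P" using e p by (auto simp: E_def pend_def)
  show ?thesis
  proof (rule checker_list[where vs = ?vs and opn = True and gs = ?gs and ex = "[]" and W = ?W and em = "[]"])
    show "chk True (take (length ?vs) ixs) ?gs [] ?W []" by (simp add: ixs_def, code_simp)
    show "distinct ?vs" using dist by simp
    show "set ?vs \<subseteq> P" using inP by simp
    show "list_all (\<lambda>((i, j), S). guard (pick ?vs i) (pick ?vs j) (pick ?vs ` set S)) ?gs" using g by simp
  qed simp_all
qed

text \<open>The set \<open>W\<close> of \<open>triangle_three\<close> with all three ear points
  identified.\<close>

lemma triangle_one:
  assumes e: "E v0 v1" "E v1 v2" "E v2 v0"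
    and p: "pend v0 v1 a" "pend v1 v2 a" "pend v2 v0 a" and dist: "distinct [v0, v1, v2, a]"
  shows "meets_bound P"
proof -
  let ?vs = "[v0, v1, v2, a]"
  let ?W = "[(A0, A1), (A1, A2), (A2, A0), (A1, A3), (A2, A3), (A0, A3)]"
  let ?gs = "[((A0, A1), [A0, A1]), ((A1, A2), [A1, A2]), ((A2, A0), [A2, A0]), ((A1, A3), [A1, A3]), ((A0, A3), [A0, A1, A3]), ((A2, A3), [A2, A3]), ((A1, A3), [A1, A2, A3]), ((A0, A3), [A0, A3]), ((A2, A3), [A2, A0, A3])]"
  note g = e[THEN E_cap, THEN guard_cap] p[THEN pend_cap, THEN guard_cap] p[THEN guard_pend]
  have inP: "set ?vs \<subseteq> P" using e p by (auto simp: E_def pend_def)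
  show ?thesis
  proof (rule checker_list[where vs = ?vs and opn = True and gs = ?gs and ex = "[]" and W = ?W and em = "[]"])
    show "chk True (take (length ?vs) ixs) ?gs [] ?W []" by (simp add: ixs_def, code_simp)
    show "distinct ?vs" using dist by simp
    show "set ?vs \<subseteq> P" using inP by simp
    show "list_all (\<lambda>((i, j), S). guard (pick ?vs i) (pick ?vs j) (pick ?vs ` set S)) ?gs" using g by simp
  qed simp_all
qed

text \<open>With all pairs of the five named points but \<open>v0v1\<close> in \<open>W\<close>,
  only \<open>v1p\<close> and \<open>v3q\<close> with \<open>p\<close>, \<open>q\<close> unnamed
  remain. The segment \<open>v0z\<close> always misses \<open>v3q\<close>; if \<open>v1p\<close>
  does not leave \<open>v0z\<close> on one side, \<open>v2z\<close> is tried instead, and if that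
  fails too, the line \<open>v1z\<close> separates \<open>v1p\<close> from \<open>v3q\<close>. The
  last step needs \<open>z\<close> and \<open>v0\<close> on the same side of
  \<open>v1v3\<close>.\<close>

lemma quadrilateral:
  assumes e: "E v0 v1" "E v1 v2" "E v2 v3" "E v3 v0"
    and z: "ear v0 v1 v2 z" "L v1 v3 z" and dist: "distinct [v0, v1, v2, v3, z]"
  shows "meets_bound P"
proof -
  let ?vs = "[v0, v1, v2, v3, z]"
  let ?W = "[(A0, A2), (A0, A3), (A0, A4), (A1, A2), (A1, A3), (A1, A4), (A2, A3), (A2, A4), (A3, A4)]"
  let ?gs = "[((A0, A1), [A0, A1]), ((A1, A2), [A1, A2]), ((A2, A3), [A2, A3]), ((A3, A0), [A3, A0]), ((A1, A4), [A1, A4])]"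
  let ?em = "[((A1, Out), (A3, Out))]"
  let ?R = "linked P (map_prod (pick ?vs) (pick ?vs) ` set ?W)"
  have c: "cap v1 z" using z(1) pend_cap unfolding ear_def by blast
  note g = e[THEN E_cap, THEN guard_cap] guard_cap[OF c]
  have inP: "set ?vs \<subseteq> P" using e z by (auto simp: E_def ear_def pend_def)
  have G: "?R v1 p v3 q" if pq: "p \<in> P" "q \<in> P" "p \<notin> set ?vs" "q \<notin> set ?vs" for p q
  proof -
    have far: "L v0 z x" if "x \<in> P" "x \<noteq> v0" "x \<noteq> v1" "x \<noteq> z" for x using z that by (auto simp: ear_def pend_def)
    have edge: "L a b x" if "E a b" "x \<in> P" "x \<noteq> a" "x \<noteq> b" for a b x using that by (auto simp: E_def)
    have P: "v0 \<in> P" "v1 \<in> P" "v2 \<in> P" "v3 \<in> P" "z \<in> P" using inP by simp_all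
    have ne: "v0 \<noteq> v1" "v0 \<noteq> v2" "v0 \<noteq> v3" "v0 \<noteq> z" "v1 \<noteq> v2" "v1 \<noteq> v3" "v1 \<noteq> z" "v2 \<noteq> v3" "v2 \<noteq> z" "v3 \<noteq> z"
      "p \<noteq> v0" "p \<noteq> v1" "p \<noteq> v2" "p \<noteq> v3" "p \<noteq> z" "q \<noteq> v0" "q \<noteq> v1" "q \<noteq> v2" "q \<noteq> v3" "q \<noteq> z"
      using dist pq by auto
    have h: "L v1 p v0" "L p v1 v2" "L z v2 v3"
      using edge[OF e(1) pq(1)] edge[OF e(2) pq(1)] edge[OF e(3) P(5)] ne L_rot by blast+
    show ?thesis
    proof (cases "L v1 p z")
      case True
      have 1: "dj v1 p v0 z" by (rule sep[of v1 p v1 p v0 z]) (use h True in simp_all)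
      have "dj v0 z v3 q" by (rule sep[of v0 z v0 z v3 q]) (use far P pq ne in simp_all)
      then have 2: "dj v3 q v0 z" by (simp add: dj_sym)
      show ?thesis by (rule linked_via[of A0 A4]) (use 1 2 in simp_all)
    next
      case nT: False
      then have pz: "L p v1 z" using L_swap[of v1 p z] P pq ne by blast
      show ?thesis
      proof (cases "L v2 q z")
        case True
        then have "L z v2 q" using L_rot by blast
        then have "dj v2 z v3 q" by (intro sep[of v2 v2 z z v3 q]) (use h in simp_all)
        then have 1: "dj v3 q v2 z" by (simp add: dj_sym)
        have 2: "dj v1 p v2 z" by (rule sep[of v1 v1 p p v2 z]) (use h pz in simp_all)
        show ?thesis by (rule linked_via[of A2 A4]) (use 1 2 in simp_all)
      next
        case False
        then have "L q v2 z" using L_swap[of v2 q z] P pq ne by blast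
        then have q2: "L v2 z q" using L_rot by blast
        \<comment> \<open>The point \<open>z\<close> lies inside the triangle \<open>v0v1v2\<close>,
          so \<open>q\<close> cannot be on the same side of all three rays from its corners through
          \<open>z\<close>.\<close>
        have "\<not> L v1 z q"
        proof
          assume "L v1 z q"
          moreover have "L v0 z q" using far[of q] pq ne by blast
          moreover have "L v0 v1 z" "L v1 v2 z" using edge[OF e(1) P(5)] edge[OF e(2) P(5)] ne by blast+
          moreover have "L v2 v0 z" using z by (simp add: ear_def)
          ultimately show False using tri_star[of v0 v1 z v2 q] q2 by blast
        qed
        then have "L z v1 q" using L_swap[of v1 z q] P pq ne by blast
        moreover have "L z v1 v3" using z(2) L_rot by blast
        moreover have "L v1 z p" using pz L_rot by blast
        ultimately have "dj v1 p v3 q" by (intro sep[of v1 v1 z p v3 q]) simp_all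
        then show ?thesis by (rule linked_dj)
      qed
    qed
  qed
  show ?thesis
  proof (rule checker_list[where vs = ?vs and opn = True and gs = ?gs and ex = "[]" and W = ?W and em = "?em"])
    show "chk True (take (length ?vs) ixs) ?gs [] ?W ?em" by (simp add: ixs_def, code_simp)
    show "distinct ?vs" using dist by simp
    show "set ?vs \<subseteq> P" using inP by simp
    show "list_all (\<lambda>((i, j), S). guard (pick ?vs i) (pick ?vs j) (pick ?vs ` set S)) ?gs" using g by simp
    show "list_all (\<lambda>(x, y). joined ?vs ?W x y) ?em" using G by (auto simp: joined_def)
  qed simp_all
qed

text \<open>A pair hitting all five hull edges has at least three hull vertices among its ends, so
  one of the segments joins two of them. All such segments are in \<open>W\<close> except
  \<open>v0v2\<close>, which is shielded by its empty ear.\<close>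

lemma pentagon:
  assumes e: "E v0 v1" "E v1 v2" "E v2 v3" "E v3 v4" "E v4 v0"
    and sh: "short v0 v1 v2" and dist: "distinct [v0, v1, v2, v3, v4]"
  shows "meets_bound P"
proof -
  let ?vs = "[v0, v1, v2, v3, v4]"
  let ?W = "[(A0, A1), (A0, A3), (A0, A4), (A1, A2), (A1, A3), (A1, A4), (A2, A3), (A2, A4), (A3, A4)]"
  let ?gs = "[((A0, A1), [A0, A1]), ((A1, A2), [A1, A2]), ((A2, A3), [A2, A3]), ((A3, A4), [A3, A4]), ((A4, A0), [A4, A0]), ((A0, A2), [A0, A1, A2])]"
  note g = e[THEN E_cap, THEN guard_cap] sh[THEN guard_short]
  have inP: "set ?vs \<subseteq> P" using e by (auto simp: E_def)
  show ?thesis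
  proof (rule checker_list[where vs = ?vs and opn = True and gs = ?gs and ex = "[]" and W = ?W and em = "[]"])
    show "chk True (take (length ?vs) ixs) ?gs [] ?W []" by (simp add: ixs_def, code_simp)
    show "distinct ?vs" using dist by simp
    show "set ?vs \<subseteq> P" using inP by simp
    show "list_all (\<lambda>((i, j), S). guard (pick ?vs i) (pick ?vs j) (pick ?vs ` set S)) ?gs" using g by simp
  qed simp_all
qed

text \<open>Arises when two neighbouring ears have the same first point \<open>t\<close>. To hit all
  five caps takes three named points, hence a segment between two of them; only the cap
  \<open>ab\<close> among these segments is outside \<open>W\<close>.\<close>

lemma cap_triangle:
  assumes c: "cap d a" "cap a b" "cap b c" "cap b t" "cap c t" and dist: "distinct [d, a, b, c, t]"
  shows "meets_bound P"
proof -
  let ?vs = "[d, a, b, c, t]"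
  let ?W = "[(A0, A1), (A0, A2), (A0, A3), (A0, A4), (A1, A3), (A1, A4), (A2, A3), (A2, A4), (A3, A4)]"
  let ?gs = "[((A0, A1), [A0, A1]), ((A1, A2), [A1, A2]), ((A2, A3), [A2, A3]), ((A2, A4), [A2, A4]), ((A3, A4), [A3, A4])]"
  note g = c[THEN guard_cap]
  have inP: "set ?vs \<subseteq> P" using c by (auto simp: cap_def)
  show ?thesis
  proof (rule checker_list[where vs = ?vs and opn = True and gs = ?gs and ex = "[]" and W = ?W and em = "[]"])
    show "chk True (take (length ?vs) ixs) ?gs [] ?W []" by (simp add: ixs_def, code_simp)
    show "distinct ?vs" using dist by simp
    show "set ?vs \<subseteq> P" using inP by simp
    show "list_all (\<lambda>((i, j), S). guard (pick ?vs i) (pick ?vs j) (pick ?vs ` set S)) ?gs" using g by simp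
  qed simp_all
qed

text \<open>The pairs in \<open>?em\<close> join \<open>v2\<close> and \<open>i\<close> to
  \<open>z\<close> and \<open>q\<close>, where \<open>i\<close> is \<open>v0\<close> or
  \<open>v5\<close>. The line \<open>v2i\<close> decides: if \<open>q\<close> and \<open>z\<close>
  are on different sides, the segments are disjoint; otherwise \<open>v4u\<close> lies across the
  line and misses both.\<close>

lemma hexagon_two_ears:
  assumes e: "E v0 v1" "E v1 v2" "E v2 v3" "E v3 v4" "E v4 v5" "E v5 v0"
    and sh: "short v5 v0 v1" "short v1 v2 v3" and zu: "ear v0 v1 v2 z" "ear v2 v3 v4 u"
    and v: "L v2 v5 v0" "L v2 v4 v5" "L v2 v4 v0" and dist: "distinct [v0, v1, v2, v3, v4, v5]"
  shows "meets_bound P"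
proof -
  let ?vs = "[v0, v1, v2, v3, v4, v5, z, u]"
  let ?W = "[(A1, A2), (A2, A3), (A5, A0), (A1, A6), (A0, A2), (A0, A3), (A5, A2), (A5, A3), (A4, A7)]"
  let ?gs = "[((A0, A1), [A0, A1]), ((A1, A2), [A1, A2]), ((A2, A3), [A2, A3]), ((A3, A4), [A3, A4]), ((A4, A5), [A4, A5]), ((A5, A0), [A5, A0]), ((A5, A1), [A5, A0, A1]), ((A1, A3), [A1, A2, A3]), ((A1, A6), [A1, A6])]"
  let ?em = "[((A2, A6), (A0, A4)), ((A2, A6), (A0, A6)), ((A2, A6), (A0, A7)), ((A2, A6), (A0, Out)), ((A2, A6), (A5, A4)), ((A2, A6), (A5, A6)), ((A2, A6), (A5, A7)), ((A2, A6), (A5, Out)), ((A6, A0), (A2, A4)), ((A6, A0), (A2, A7)), ((A6, A0), (A2, Out)), ((A6, A5), (A2, A4)), ((A6, A5), (A2, A7)), ((A6, A5), (A2, Out))]"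
  let ?R = "linked P (map_prod (pick ?vs) (pick ?vs) ` set ?W)"
  have c: "cap v1 z" using zu(1) pend_cap unfolding ear_def by blast
  note g = e[THEN E_cap, THEN guard_cap] sh[THEN guard_short] guard_cap[OF c]
  have inP: "set ?vs \<subseteq> P" using e zu by (auto simp: E_def ear_def pend_def)
  have P: "v0 \<in> P" "v2 \<in> P" "v4 \<in> P" "v5 \<in> P" "z \<in> P" "u \<in> P" using inP by simp_all
  have zn: "z \<notin> {v0, v1, v2}" "L v2 v0 z" using zu(1) by (auto simp: ear_def pend_def)
  have un: "u \<notin> {v2, v3, v4}" "\<And>x. x \<in> P - {v2, v3, u} \<Longrightarrow> L v2 u x" using zu(2) by (auto simp: ear_def pend_def)
  have "v0 \<noteq> u"
  proof
    assume "v0 = u"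
    then have "L v2 v0 v5" using un(2)[of v5] P dist by auto
    then show False using v(1) L_anti by blast
  qed
  moreover have "v5 \<noteq> u"
  proof
    assume "v5 = u"
    then have "L v2 v5 v4" using un(2)[of v4] P dist by auto
    then show False using v(2) L_anti by blast
  qed
  ultimately have u: "L v2 u v0" "L v2 u v5" using un(2) P dist by auto
  have "u \<noteq> z" using u(1) zn(2) L_anti by blast
  have "v1 \<noteq> u"
  proof
    assume "v1 = u"
    moreover have "L v1 v2 v0" using e P dist by (auto simp: E_def)
    ultimately show False using u(1) L_rot L_asym by blast
  qed
  have z5: "L v2 v5 z"
    by (rule E_trans[OF e(3), of v5 v0 z]) (use v zn P dist in auto)
  have "v3 \<noteq> z"
  proof
    assume "v3 = z"
    moreover have "L v2 v3 v0" using e P dist inP by (auto simp: E_def)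
    ultimately show False using zn(2) L_anti by blast
  qed
  moreover have "v4 \<noteq> z" using zn(2) v(3) L_anti by blast
  moreover have "v5 \<noteq> z" using zn(2) v(1) L_anti by blast
  ultimately have dist: "distinct ?vs" using dist zn un \<open>v0 \<noteq> u\<close> \<open>v5 \<noteq> u\<close> \<open>v1 \<noteq> u\<close> \<open>u \<noteq> z\<close> by auto
  have H: "?R v2 z i q \<and> ?R z i v2 q"
    if i: "i = v0 \<or> i = v5" and q: "q \<in> P" "q \<noteq> i" "q \<noteq> v2" for i q
  proof -
    have iz: "L v2 i z" using i zn(2) z5 by auto
    have i4: "L i v2 v4" "L i v2 u" using i v u L_rot by blast+
    have iP: "i \<in> P" "i \<noteq> v2" using i P dist by auto
    show ?thesis
    proof (cases "L i v2 q")
      case True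
      have "dj v2 z i q" by (rule sep_touch[OF iz True])
      moreover have "dj i z v2 q" by (rule sep_touch2[OF iz True])
      ultimately show ?thesis using linked_dj dj_flip1 by blast
    next
      case False
      then have qi: "L v2 i q" using L_swap[of i v2 q] iP P q by blast
      have "dj v2 z v4 u" by (rule sep[of v2 v2 i z v4 u]) (use iz i4 in simp_all)
      moreover have "dj i q v4 u" by (rule sep[of i v2 i q v4 u]) (use qi i4 in simp_all)
      moreover have "dj z i v4 u" by (rule sep[of z v2 i i v4 u]) (use iz i4 in simp_all)
      moreover have "dj v2 q v4 u" by (rule sep[of v2 v2 i q v4 u]) (use qi i4 in simp_all)
      ultimately show ?thesis by (intro conjI linked_via[of A4 A7]) simp_all
    qed
  qed
  show ?thesis
  proof (rule checker_list[where vs = ?vs and opn = True and gs = ?gs and ex = "[]" and W = ?W and em = "?em"])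
    show "chk True (take (length ?vs) ixs) ?gs [] ?W ?em" by (simp add: ixs_def, code_simp)
    show "distinct ?vs" using dist by simp
    show "set ?vs \<subseteq> P" using inP by simp
    show "list_all (\<lambda>((i, j), S). guard (pick ?vs i) (pick ?vs j) (pick ?vs ` set S)) ?gs" using g by simp
    show "list_all (\<lambda>(x, y). joined ?vs ?W x y) ?em" using H[of v0] H[of v5] dist P by (auto simp: joined_def)
  qed simp_all
qed

text \<open>The segment \<open>yz\<close> misses every hull edge and the chords of the four empty
  ears, so it is a common neighbour of any two of these, for instance of the crossing chords
  \<open>v5v1\<close> and \<open>v4v0\<close>.\<close>

lemma hexagon_open:
  assumes e: "E v0 v1" "E v1 v2" "E v2 v3" "E v3 v4" "E v4 v5" "E v5 v0"
    and sh: "short v5 v0 v1" "short v1 v2 v3" "short v2 v3 v4" "short v4 v5 v0" and yz: "y \<in> P" "z \<in> P" and dist: "distinct [v0, v1, v2, v3, v4, v5, y, z]"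
  shows "meets_bound P"
proof -
  let ?vs = "[v0, v1, v2, v3, v4, v5, y, z]"
  let ?W = "[(A0, A2), (A0, A3), (A0, A5), (A1, A2), (A2, A3), (A2, A5), (A3, A4), (A3, A5), (A6, A7)]"
  let ?gs = "[((A0, A1), [A0, A1]), ((A1, A2), [A1, A2]), ((A2, A3), [A2, A3]), ((A3, A4), [A3, A4]), ((A4, A5), [A4, A5]), ((A5, A0), [A5, A0]), ((A5, A1), [A5, A0, A1]), ((A1, A3), [A1, A2, A3]), ((A2, A4), [A2, A3, A4]), ((A4, A0), [A4, A5, A0])]"
  note g = e[THEN E_cap, THEN guard_cap] sh[THEN guard_short]
  have inP: "set ?vs \<subseteq> P" using e yz by (auto simp: E_def)
  show ?thesis
  proof (rule checker_list[where vs = ?vs and opn = True and gs = ?gs and ex = "[]" and W = ?W and em = "[]"])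
    show "chk True (take (length ?vs) ixs) ?gs [] ?W []" by (simp add: ixs_def, code_simp)
    show "distinct ?vs" using dist by simp
    show "set ?vs \<subseteq> P" using inP by simp
    show "list_all (\<lambda>((i, j), S). guard (pick ?vs i) (pick ?vs j) (pick ?vs ` set S)) ?gs" using g by simp
  qed simp_all
qed

text \<open>All pairs but \<open>v3v5\<close> of the five points \<open>v1\<close>,
  \<open>v3\<close>, \<open>v4\<close>, \<open>v5\<close>, \<open>z\<close>; the omitted one is the
  chord of the empty ear at \<open>v4\<close>.\<close>

lemma hexagon_one_ear:
  assumes e: "E v0 v1" "E v1 v2" "E v2 v3" "E v3 v4" "E v4 v5" "E v5 v0"
    and sh: "short v5 v0 v1" "short v1 v2 v3" "short v2 v3 v4" "short v3 v4 v5" "short v4 v5 v0" and c: "cap v1 z" and dist: "distinct [v0, v1, v2, v3, v4, v5, z]" and cl: "P \<subseteq> {v0, v1, v2, v3, v4, v5, z}"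
  shows "meets_bound P"
proof -
  let ?vs = "[v0, v1, v2, v3, v4, v5, z]"
  let ?W = "[(A1, A3), (A1, A4), (A1, A5), (A1, A6), (A3, A4), (A3, A6), (A4, A5), (A4, A6), (A5, A6)]"
  let ?gs = "[((A0, A1), [A0, A1]), ((A1, A2), [A1, A2]), ((A2, A3), [A2, A3]), ((A3, A4), [A3, A4]), ((A4, A5), [A4, A5]), ((A5, A0), [A5, A0]), ((A5, A1), [A5, A0, A1]), ((A1, A3), [A1, A2, A3]), ((A2, A4), [A2, A3, A4]), ((A3, A5), [A3, A4, A5]), ((A4, A0), [A4, A5, A0]), ((A1, A6), [A1, A6])]"
  note g = e[THEN E_cap, THEN guard_cap] sh[THEN guard_short] guard_cap[OF c]
  have inP: "set ?vs \<subseteq> P" using e cap_in[OF c] by (auto simp: E_def)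
  show ?thesis
  proof (rule checker_list[where vs = ?vs and opn = False and gs = ?gs and ex = "[]" and W = ?W and em = "[]"])
    show "chk False (take (length ?vs) ixs) ?gs [] ?W []" by (simp add: ixs_def, code_simp)
    show "distinct ?vs" using dist by simp
    show "set ?vs \<subseteq> P" using inP by simp
    show "False \<or> P \<subseteq> set ?vs" using cl by simp
    show "list_all (\<lambda>((i, j), S). guard (pick ?vs i) (pick ?vs j) (pick ?vs ` set S)) ?gs" using g by simp
  qed simp_all
qed

text \<open>Only \<open>v1v3\<close> and \<open>v2v5\<close> need geometry: \<open>z\<close> is on
  the side of \<open>v2v5\<close> containing \<open>v0\<close> or on the one containing
  \<open>v4\<close>, so \<open>v0z\<close> or \<open>v4z\<close> misses \<open>v2v5\<close>, and the
  empty ear at \<open>v2\<close> keeps both away from \<open>v1v3\<close>.\<close>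

lemma hexagon_centre:
  assumes e: "E v0 v1" "E v1 v2" "E v2 v3" "E v3 v4" "E v4 v5" "E v5 v0"
    and sh: "short v5 v0 v1" "short v0 v1 v2" "short v1 v2 v3" "short v2 v3 v4" "short v3 v4 v5" "short v4 v5 v0" and zP: "z \<in> P" and v: "L v2 v5 v0" "L v2 v4 v5" and dist: "distinct [v0, v1, v2, v3, v4, v5, z]" and cl: "P \<subseteq> {v0, v1, v2, v3, v4, v5, z}"
  shows "meets_bound P"
proof -
  let ?vs = "[v0, v1, v2, v3, v4, v5, z]"
  let ?W = "[(A0, A1), (A0, A2), (A0, A3), (A0, A4), (A0, A6), (A1, A4), (A3, A4), (A2, A6), (A4, A6)]"
  let ?gs = "[((A0, A1), [A0, A1]), ((A1, A2), [A1, A2]), ((A2, A3), [A2, A3]), ((A3, A4), [A3, A4]), ((A4, A5), [A4, A5]), ((A5, A0), [A5, A0]), ((A5, A1), [A5, A0, A1]), ((A0, A2), [A0, A1, A2]), ((A1, A3), [A1, A2, A3]), ((A2, A4), [A2, A3, A4]), ((A3, A5), [A3, A4, A5]), ((A4, A0), [A4, A5, A0])]"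
  let ?em = "[((A1, A3), (A2, A5))]"
  let ?R = "linked P (map_prod (pick ?vs) (pick ?vs) ` set ?W)"
  note g = e[THEN E_cap, THEN guard_cap] sh[THEN guard_short]
  have inP: "set ?vs \<subseteq> P" using e zP by (auto simp: E_def)
  have H: "?R v1 v3 v2 v5"
  proof (cases "L v2 v5 z")
    case True
    have "dj v2 v5 v0 z" by (rule sep[of v2 v5 v2 v5 v0 z]) (use v True in simp_all)
    moreover have "dj v1 v3 v0 z" using short_free(2)[OF sh(3), of v0 z] inP dist by auto
    ultimately show ?thesis by (intro linked_via[of A0 A6]) simp_all
  next
    case False
    then have "L v5 v2 z" using L_swap[of v2 v5 z] inP dist by auto
    moreover have "L v5 v2 v4" using v(2) L_rot by blast
    ultimately have "dj v2 v5 v4 z" by (intro sep[of v2 v2 v5 v5 v4 z]) simp_all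
    moreover have "dj v1 v3 v4 z" using short_free(2)[OF sh(3), of v4 z] inP dist by auto
    ultimately show ?thesis by (intro linked_via[of A4 A6]) simp_all
  qed
  show ?thesis
  proof (rule checker_list[where vs = ?vs and opn = False and gs = ?gs and ex = "[]" and W = ?W and em = "?em"])
    show "chk False (take (length ?vs) ixs) ?gs [] ?W ?em" by (simp add: ixs_def, code_simp)
    show "distinct ?vs" using dist by simp
    show "set ?vs \<subseteq> P" using inP by simp
    show "False \<or> P \<subseteq> set ?vs" using cl by simp
    show "list_all (\<lambda>((i, j), S). guard (pick ?vs i) (pick ?vs j) (pick ?vs ` set S)) ?gs" using g by simp
    show "list_all (\<lambda>(x, y). joined ?vs ?W x y) ?em" using H by (simp add: joined_def)
  qed simp_all
qed

text \<open>Only hull edges are left to see each other; two that share a vertex, such as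
  \<open>v0v1\<close> and \<open>v1v2\<close>, both miss a diagonal such as
  \<open>v3v5\<close>.\<close>

lemma hexagon_convex:
  assumes e: "E v0 v1" "E v1 v2" "E v2 v3" "E v3 v4" "E v4 v5" "E v5 v0"
    and dist: "distinct [v0, v1, v2, v3, v4, v5]" and cl: "P \<subseteq> {v0, v1, v2, v3, v4, v5}"
  shows "meets_bound P"
proof -
  let ?vs = "[v0, v1, v2, v3, v4, v5]"
  let ?W = "[(A0, A2), (A0, A3), (A0, A4), (A1, A3), (A1, A4), (A1, A5), (A2, A4), (A2, A5), (A3, A5)]"
  let ?gs = "[((A0, A1), [A0, A1]), ((A1, A2), [A1, A2]), ((A2, A3), [A2, A3]), ((A3, A4), [A3, A4]), ((A4, A5), [A4, A5]), ((A5, A0), [A5, A0])]"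
  note g = e[THEN E_cap, THEN guard_cap]
  have inP: "set ?vs \<subseteq> P" using e by (auto simp: E_def)
  show ?thesis
  proof (rule checker_list[where vs = ?vs and opn = False and gs = ?gs and ex = "[]" and W = ?W and em = "[]"])
    show "chk False (take (length ?vs) ixs) ?gs [] ?W []" by (simp add: ixs_def, code_simp)
    show "distinct ?vs" using dist by simp
    show "set ?vs \<subseteq> P" using inP by simp
    show "False \<or> P \<subseteq> set ?vs" using cl by simp
    show "list_all (\<lambda>((i, j), S). guard (pick ?vs i) (pick ?vs j) (pick ?vs ` set S)) ?gs" using g by simp
  qed simp_all
qed

text \<open>Modelled on the set for four caps: three disjoint hull edges, the four segments joining
  \<open>v1v2\<close> to \<open>v5v6\<close>, the spoke \<open>v0z\<close> in place of a fourth cap,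
  and \<open>v1v4\<close> in addition. The hypothesis \<open>q\<close> makes \<open>v3v6\<close>
  miss the spoke.\<close>

lemma heptagon_spoke:
  assumes e: "E v0 v1" "E v1 v2" "E v2 v3" "E v3 v4" "E v4 v5" "E v5 v6" "E v6 v0"
    and sh: "short v6 v0 v1" "short v0 v1 v2" "short v1 v2 v3" "short v2 v3 v4" "short v3 v4 v5" "short v4 v5 v6" "short v5 v6 v0"
    and q: "guard v3 v6 {v3, v4, v5, v6}" and zP: "z \<in> P" and dist: "distinct [v0, v1, v2, v3, v4, v5, v6, z]"
  shows "meets_bound P"
proof -
  let ?vs = "[v0, v1, v2, v3, v4, v5, v6, z]"
  let ?W = "[(A1, A2), (A3, A4), (A5, A6), (A0, A7), (A1, A5), (A1, A6), (A2, A5), (A2, A6), (A1, A4)]"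
  let ?gs = "[((A0, A1), [A0, A1]), ((A1, A2), [A1, A2]), ((A2, A3), [A2, A3]), ((A3, A4), [A3, A4]), ((A4, A5), [A4, A5]), ((A5, A6), [A5, A6]), ((A6, A0), [A6, A0]), ((A6, A1), [A6, A0, A1]), ((A0, A2), [A0, A1, A2]), ((A1, A3), [A1, A2, A3]), ((A2, A4), [A2, A3, A4]), ((A3, A5), [A3, A4, A5]), ((A4, A6), [A4, A5, A6]), ((A5, A0), [A5, A6, A0]), ((A3, A6), [A3, A4, A5, A6])]"
  note g = e[THEN E_cap, THEN guard_cap] sh[THEN guard_short] q
  have inP: "set ?vs \<subseteq> P" using e zP by (auto simp: E_def)
  show ?thesis
  proof (rule checker_list[where vs = ?vs and opn = True and gs = ?gs and ex = "[]" and W = ?W and em = "[]"])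
    show "chk True (take (length ?vs) ixs) ?gs [] ?W []" by (simp add: ixs_def, code_simp)
    show "distinct ?vs" using dist by simp
    show "set ?vs \<subseteq> P" using inP by simp
    show "list_all (\<lambda>((i, j), S). guard (pick ?vs i) (pick ?vs j) (pick ?vs ` set S)) ?gs" using g by simp
  qed simp_all
qed

text \<open>The segment \<open>yz\<close> serves crossing pairs such as \<open>v0v3\<close> with
  \<open>v6v1\<close> and \<open>v1v4\<close> with \<open>v3v5\<close>: it misses the ear chords
  because their ears are empty, and the long chords by \<open>d\<close>.\<close>

lemma heptagon_pair:
  assumes e: "E v0 v1" "E v1 v2" "E v2 v3" "E v3 v4" "E v4 v5" "E v5 v6" "E v6 v0"
    and sh: "short v6 v0 v1" "short v0 v1 v2" "short v1 v2 v3" "short v2 v3 v4" "short v3 v4 v5" "short v4 v5 v6" "short v5 v6 v0"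
    and d: "dj y z v0 v3" "dj y z v1 v4" and yz: "y \<in> P" "z \<in> P" and dist: "distinct [v0, v1, v2, v3, v4, v5, v6, y, z]"
  shows "meets_bound P"
proof -
  let ?vs = "[v0, v1, v2, v3, v4, v5, v6, y, z]"
  let ?W = "[(A1, A2), (A1, A5), (A2, A3), (A2, A5), (A2, A6), (A3, A4), (A3, A6), (A5, A6), (A7, A8)]"
  let ?gs = "[((A0, A1), [A0, A1]), ((A1, A2), [A1, A2]), ((A2, A3), [A2, A3]), ((A3, A4), [A3, A4]), ((A4, A5), [A4, A5]), ((A5, A6), [A5, A6]), ((A6, A0), [A6, A0]), ((A6, A1), [A6, A0, A1]), ((A0, A2), [A0, A1, A2]), ((A1, A3), [A1, A2, A3]), ((A2, A4), [A2, A3, A4]), ((A3, A5), [A3, A4, A5]), ((A4, A6), [A4, A5, A6]), ((A5, A0), [A5, A6, A0])]"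
  let ?ex = "[((A7, A8), (A0, A3)), ((A7, A8), (A1, A4))]"
  note g = e[THEN E_cap, THEN guard_cap] sh[THEN guard_short]
  have inP: "set ?vs \<subseteq> P" using e yz by (auto simp: E_def)
  show ?thesis
  proof (rule checker_list[where vs = ?vs and opn = True and gs = ?gs and ex = "?ex" and W = ?W and em = "[]"])
    show "chk True (take (length ?vs) ixs) ?gs ?ex ?W []" by (simp add: ixs_def, code_simp)
    show "distinct ?vs" using dist by simp
    show "set ?vs \<subseteq> P" using inP by simp
    show "list_all (\<lambda>((i, j), S). guard (pick ?vs i) (pick ?vs j) (pick ?vs ` set S)) ?gs" using g by simp
    show "list_all (\<lambda>((i, j), (k, l)). dj (pick ?vs i) (pick ?vs j) (pick ?vs k) (pick ?vs l)) ?ex" using d by simp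
  qed simp_all
qed

text \<open>If two neighbouring hull vertices are free of ends, their edge is a common neighbour.
  Otherwise the ends are a rotation of \<open>v0\<close>, \<open>v2\<close>, \<open>v4\<close>,
  \<open>v5\<close>. There \<open>v4v5\<close> is in \<open>W\<close> and \<open>v5v0\<close> misses
  \<open>v2v4\<close> because of its empty ear, so only \<open>v0v4\<close> and \<open>v2v5\<close>
  remain.\<close>

lemma heptagon_convex:
  assumes e: "E v0 v1" "E v1 v2" "E v2 v3" "E v3 v4" "E v4 v5" "E v5 v6" "E v6 v0"
    and sh: "short v6 v0 v1" "short v0 v1 v2" "short v1 v2 v3" "short v2 v3 v4" "short v3 v4 v5" "short v4 v5 v6" "short v5 v6 v0"
    and c: "cyc [v0, v1, v2, v3, v4, v5, v6]" and dist: "distinct [v0, v1, v2, v3, v4, v5, v6]" and cl: "P \<subseteq> {v0, v1, v2, v3, v4, v5, v6}"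
  shows "meets_bound P"
proof -
  let ?vs = "[v0, v1, v2, v3, v4, v5, v6]"
  let ?W = "[(A0, A1), (A1, A2), (A2, A3), (A3, A4), (A4, A5), (A5, A6), (A6, A0)]"
  let ?gs = "[((A0, A1), [A0, A1]), ((A1, A2), [A1, A2]), ((A2, A3), [A2, A3]), ((A3, A4), [A3, A4]), ((A4, A5), [A4, A5]), ((A5, A6), [A5, A6]), ((A6, A0), [A6, A0]), ((A6, A1), [A6, A0, A1]), ((A0, A2), [A0, A1, A2]), ((A1, A3), [A1, A2, A3]), ((A2, A4), [A2, A3, A4]), ((A3, A5), [A3, A4, A5]), ((A4, A6), [A4, A5, A6]), ((A5, A0), [A5, A6, A0])]"
  let ?em = "[((A0, A4), (A2, A5)), ((A1, A5), (A3, A6)), ((A2, A6), (A4, A0)), ((A3, A0), (A5, A1)), ((A4, A1), (A6, A2)), ((A5, A2), (A0, A3)), ((A6, A3), (A1, A4))]"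
  let ?R = "linked P (map_prod (pick ?vs) (pick ?vs) ` set ?W)"
  note g = e[THEN E_cap, THEN guard_cap] sh[THEN guard_short]
  have inP: "set ?vs \<subseteq> P" using e by (auto simp: E_def)
  note F = heptagon_far[of _ _ _ _ _ _ _ "map_prod (pick ?vs) (pick ?vs) ` set ?W"]
  have F0: "?R v0 v4 v2 v5"
    by (rule F[of v0 v1 v2 v3 v4 v5 v6]) (use cyc_rotate[OF c, of 0] cl in \<open>auto simp: eval_nat_numeral\<close>)
  have F1: "?R v1 v5 v3 v6"
    by (rule F[of v1 v2 v3 v4 v5 v6 v0]) (use cyc_rotate[OF c, of 1] cl in \<open>auto simp: eval_nat_numeral\<close>)
  have F2: "?R v2 v6 v4 v0"
    by (rule F[of v2 v3 v4 v5 v6 v0 v1]) (use cyc_rotate[OF c, of 2] cl in \<open>auto simp: eval_nat_numeral\<close>)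
  have F3: "?R v3 v0 v5 v1"
    by (rule F[of v3 v4 v5 v6 v0 v1 v2]) (use cyc_rotate[OF c, of 3] cl in \<open>auto simp: eval_nat_numeral\<close>)
  have F4: "?R v4 v1 v6 v2"
    by (rule F[of v4 v5 v6 v0 v1 v2 v3]) (use cyc_rotate[OF c, of 4] cl in \<open>auto simp: eval_nat_numeral\<close>)
  have F5: "?R v5 v2 v0 v3"
    by (rule F[of v5 v6 v0 v1 v2 v3 v4]) (use cyc_rotate[OF c, of 5] cl in \<open>auto simp: eval_nat_numeral\<close>)
  have F6: "?R v6 v3 v1 v4"
    by (rule F[of v6 v0 v1 v2 v3 v4 v5]) (use cyc_rotate[OF c, of 6] cl in \<open>auto simp: eval_nat_numeral\<close>)
  show ?thesis
  proof (rule checker_list[where vs = ?vs and opn = False and gs = ?gs and ex = "[]" and W = ?W and em = "?em"])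
    show "chk False (take (length ?vs) ixs) ?gs [] ?W ?em" by (simp add: ixs_def, code_simp)
    show "distinct ?vs" using dist by simp
    show "set ?vs \<subseteq> P" using inP by simp
    show "False \<or> P \<subseteq> set ?vs" using cl by simp
    show "list_all (\<lambda>((i, j), S). guard (pick ?vs i) (pick ?vs j) (pick ?vs ` set S)) ?gs" using g by simp
    show "list_all (\<lambda>(x, y). joined ?vs ?W x y) ?em" using F0 F1 F2 F3 F4 F5 F6 by (simp add: joined_def)
  qed simp_all
qed

text \<open>A pair that hits all four caps has one end in each and so pairs them up. The pairing of
  the first cap with the third needs no geometry, as one of its segments is in \<open>W\<close>;
  \<open>nc\<close> covers the other two. Hence a pairing that may cross has to be listed as first
  with third.\<close>

lemma four_caps_aux:
  assumes c: "cap a a'" "cap b b'" "cap c c'" "cap d d'" and dist: "distinct [a, a', b, b', c, c', d, d']"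
    and nc: "\<And>x y z w. \<lbrakk>x \<in> {a, a'}; y \<in> {b, b'}; z \<in> {c, c'}; w \<in> {d, d'}\<rbrakk> \<Longrightarrow> dj x y z w \<and> dj x w y z"
  shows "meets_bound P"
proof -
  let ?vs = "[a, a', b, b', c, c', d, d']"
  let ?W = "[(A0, A1), (A2, A3), (A4, A5), (A6, A7), (A0, A4), (A0, A5), (A1, A4), (A1, A5)]"
  let ?gs = "[((A0, A1), [A0, A1]), ((A2, A3), [A2, A3]), ((A4, A5), [A4, A5]), ((A6, A7), [A6, A7])]"
  let ?em = "[((A0, A2), (A4, A6)), ((A0, A2), (A4, A7)), ((A0, A2), (A5, A6)), ((A0, A2), (A5, A7)), ((A0, A3), (A4, A6)), ((A0, A3), (A4, A7)), ((A0, A3), (A5, A6)), ((A0, A3), (A5, A7)), ((A1, A2), (A4, A6)), ((A1, A2), (A4, A7)), ((A1, A2), (A5, A6)), ((A1, A2), (A5, A7)), ((A1, A3), (A4, A6)), ((A1, A3), (A4, A7)), ((A1, A3), (A5, A6)), ((A1, A3), (A5, A7)), ((A0, A6), (A2, A4)), ((A0, A7), (A2, A4)), ((A0, A6), (A2, A5)), ((A0, A7), (A2, A5)), ((A0, A6), (A3, A4)), ((A0, A7), (A3, A4)), ((A0, A6), (A3, A5)), ((A0, A7), (A3, A5)), ((A1, A6), (A2, A4)), ((A1, A7), (A2, A4)), ((A1, A6), (A2, A5)), ((A1, A7), (A2, A5)), ((A1, A6), (A3, A4)), ((A1, A7), (A3, A4)), ((A1, A6), (A3, A5)), ((A1, A7),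 (A3, A5))]"
  let ?R = "linked P (map_prod (pick ?vs) (pick ?vs) ` set ?W)"
  note g = c[THEN guard_cap]
  have inP: "set ?vs \<subseteq> P" using c by (auto simp: cap_def)
  show ?thesis
  proof (rule checker_list[where vs = ?vs and opn = True and gs = ?gs and ex = "[]" and W = ?W and em = "?em"])
    show "chk True (take (length ?vs) ixs) ?gs [] ?W ?em" by (simp add: ixs_def, code_simp)
    show "distinct ?vs" using dist by simp
    show "set ?vs \<subseteq> P" using inP by simp
    show "list_all (\<lambda>((i, j), S). guard (pick ?vs i) (pick ?vs j) (pick ?vs ` set S)) ?gs" using g by simp
    show "list_all (\<lambda>(x, y). joined ?vs ?W x y) ?em" using nc by (simp add: joined_def linked_dj)
  qed simp_all
qed

text \<open>By \<open>caps_sign\<close> the caps behave like four single points: at most one of the three ways to pair them up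
  gives crossing joining segments. The four caps, with the four joining segments between two caps paired in it, serve as \<open>W\<close>.\<close>
lemma four_caps:
  assumes c: "cap a a'" "cap b b'" "cap c c'" "cap d d'" and dist: "distinct [a, a', b, b', c, c', d, d']"
  shows "meets_bound P"
proof -
  have inP: "{a, a', b, b', c, c', d, d'} \<subseteq> P" using c by (auto simp: cap_def)
  have sg: "L x y z \<longleftrightarrow> L a b c" "L x y w \<longleftrightarrow> L a b d" "L x z w \<longleftrightarrow> L a c d" "L y z w \<longleftrightarrow> L b c d"
    if "x \<in> {a, a'}" "y \<in> {b, b'}" "z \<in> {c, c'}" "w \<in> {d, d'}" for x y z w
    by (rule caps_sign; use c dist that in auto)+
  have sw: "L y x z \<longleftrightarrow> \<not> L x y z" if "x \<in> P" "y \<in> P" "z \<in> P" "x \<noteq> y" "x \<noteq> z" "y \<noteq> z" for x y z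
    using L_swap[of x y z] that by blast
  have swap3: "L x z y \<longleftrightarrow> \<not> L x y z" if "x \<in> P" "y \<in> P" "z \<in> P" "x \<noteq> y" "x \<noteq> z" "y \<noteq> z" for x y z
    using sw[OF that] L_rot[of x z y] L_rot[of z y x] by blast
  have same: "dj p q r t" if "{p, q, r, t} \<subseteq> P" "distinct [p, q, r, t]" "(L p q r \<longleftrightarrow> L p q t) \<or> (L r t p \<longleftrightarrow> L r t q)" for p q r t
  proof -
    have m: "p \<in> P" "q \<in> P" "r \<in> P" "t \<in> P" "p \<noteq> q" "p \<noteq> r" "p \<noteq> t" "q \<noteq> r" "q \<noteq> t" "r \<noteq> t"
      using that(1,2) by auto
    from that(3) show ?thesis
    proof
      assume "L p q r \<longleftrightarrow> L p q t"
      with m show ?thesis by (intro same_side_dj) auto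
    next
      assume "L r t p \<longleftrightarrow> L r t q"
      with m have "dj r t p q" by (intro same_side_dj) auto
      then show ?thesis using dj_sym by blast
    qed
  qed
  have reps: "{x, y, z, w} \<subseteq> P" "distinct [x, y, z, w]"
    if "x \<in> {a, a'}" "y \<in> {b, b'}" "z \<in> {c, c'}" "w \<in> {d, d'}" for x y z w
    using that dist inP by auto
  have ab_cd: "dj x y z w"
    if "(L a b c \<longleftrightarrow> L a b d) \<or> (L a c d \<longleftrightarrow> L b c d)" "x \<in> {a, a'}" "y \<in> {b, b'}" "z \<in> {c, c'}" "w \<in> {d, d'}" for x y z w
  proof (rule same)
    show "(L x y z \<longleftrightarrow> L x y w) \<or> (L z w x \<longleftrightarrow> L z w y)"
      using that(1) sg[OF that(2-5)] L_rot[of x z w] L_rot[of y z w] by blast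
  qed (use reps[OF that(2-5)] in auto)
  have ac_bd: "dj x z y w"
    if "(L a b c \<longleftrightarrow> \<not> L a c d) \<or> (L a b d \<longleftrightarrow> \<not> L b c d)" "x \<in> {a, a'}" "y \<in> {b, b'}" "z \<in> {c, c'}" "w \<in> {d, d'}" for x y z w
  proof (rule same)
    have r: "x \<in> P" "y \<in> P" "z \<in> P" "w \<in> P" "x \<noteq> y" "x \<noteq> z" "x \<noteq> w" "y \<noteq> z" "y \<noteq> w" "z \<noteq> w"
      using reps[OF that(2-5)] by simp_all
    have "L x z y \<longleftrightarrow> \<not> L x y z" using r by (intro swap3)
    moreover have "L y w z \<longleftrightarrow> \<not> L y z w" using r by (intro swap3)
    moreover have "L y w x \<longleftrightarrow> L x y w" using L_rot by blast
    ultimately show "(L x z y \<longleftrightarrow> L x z w) \<or> (L y w x \<longleftrightarrow> L y w z)"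
      using that(1) sg[OF that(2-5)] by blast
  qed (use reps[OF that(2-5)] in auto)
  have ad_bc: "dj x w y z"
    if "(L a b d \<longleftrightarrow> L a c d) \<or> (L a b c \<longleftrightarrow> L b c d)" "x \<in> {a, a'}" "y \<in> {b, b'}" "z \<in> {c, c'}" "w \<in> {d, d'}" for x y z w
  proof (rule same)
    have r: "x \<in> P" "y \<in> P" "z \<in> P" "w \<in> P" "x \<noteq> y" "x \<noteq> z" "x \<noteq> w" "y \<noteq> z" "y \<noteq> w" "z \<noteq> w"
      using reps[OF that(2-5)] by simp_all
    have "L x w y \<longleftrightarrow> \<not> L x y w" using r by (intro swap3)
    moreover have "L x w z \<longleftrightarrow> \<not> L x z w" using r by (intro swap3)
    moreover have "L y z x \<longleftrightarrow> L x y z" using L_rot by blast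
    ultimately show "(L x w y \<longleftrightarrow> L x w z) \<or> (L y z x \<longleftrightarrow> L y z w)"
      using that(1) sg[OF that(2-5)] by blast
  qed (use reps[OF that(2-5)] in auto)
  have P4: "a \<in> P" "b \<in> P" "c \<in> P" "d \<in> P" "a \<noteq> b" "a \<noteq> c" "a \<noteq> d" "b \<noteq> c" "b \<noteq> d" "c \<noteq> d" using inP dist by auto
  \<comment> \<open>If two pairings both failed their criteria, \<open>abc\<close> and
    \<open>acd\<close> would have one sign and \<open>abd\<close> and \<open>bcd\<close> the other,
    which \<open>four_points\<close> excludes for either sign.\<close>
  have "\<not> (L a b c \<and> L a c d \<and> \<not> L a b d \<and> \<not> L b c d)"
    using four_points[of a b c d] sw[of a b d] sw[of b c d] P4 by blast
  moreover have "\<not> (\<not> L a b c \<and> \<not> L a c d \<and> L a b d \<and> L b c d)"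
  proof
    assume h: "\<not> L a b c \<and> \<not> L a c d \<and> L a b d \<and> L b c d"
    have "L c b a" using h sw[of a b c] L_rot[of b a c] L_rot[of a c b] P4 by blast
    moreover have "L c a d" using h sw[of a c d] P4 by blast
    moreover have "L b c d" "L a b d" using h by blast+
    ultimately show False using four_points[of c b a d] by blast
  qed
  ultimately consider
      "(L a b c \<longleftrightarrow> L a b d) \<or> (L a c d \<longleftrightarrow> L b c d)" "(L a b d \<longleftrightarrow> L a c d) \<or> (L a b c \<longleftrightarrow> L b c d)"
    | "(L a b c \<longleftrightarrow> \<not> L a c d) \<or> (L a b d \<longleftrightarrow> \<not> L b c d)" "(L a b d \<longleftrightarrow> L a c d) \<or> (L a b c \<longleftrightarrow> L b c d)"
    | "(L a b c \<longleftrightarrow> L a b d) \<or> (L a c d \<longleftrightarrow> L b c d)" "(L a b c \<longleftrightarrow> \<not> L a c d) \<or> (L a b d \<longleftrightarrow> \<not> L b c d)"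
    by argo
  then show ?thesis
  proof cases
    case 1
    show ?thesis
      by (rule four_caps_aux[OF c dist]) (intro conjI ab_cd[OF 1(1)] ad_bc[OF 1(2)])
  next
    case 2
    show ?thesis
    proof (rule four_caps_aux[OF c(1,3,2,4)])
      show "distinct [a, a', c, c', b, b', d, d']" using dist by auto
      show "dj x z y w \<and> dj x w z y" if "x \<in> {a, a'}" "z \<in> {c, c'}" "y \<in> {b, b'}" "w \<in> {d, d'}" for x z y w
        using ac_bd[OF 2(1) that(1,3,2,4)] ad_bc[OF 2(2) that(1,3,2,4)] dj_flip2[of x w z y] by simp
    qed
  next
    case 3
    show ?thesis
    proof (rule four_caps_aux[OF c(1,2,4,3)])
      show "distinct [a, a', b, b', d, d', c, c']" using dist by auto
      show "dj x y w z \<and> dj x z y w" if "x \<in> {a, a'}" "y \<in> {b, b'}" "w \<in> {d, d'}" "z \<in> {c, c'}" for x y w z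
        using ab_cd[OF 3(1) that(1,2,4,3)] ac_bd[OF 3(2) that(1,2,4,3)] dj_flip2[of x y w z] by simp
    qed
  qed
qed

section \<open>Case distinction on the number of hull vertices\<close>

lemma ear_cap: "ear u v w t \<Longrightarrow> cap v t"
  using pend_cap unfolding ear_def by blast

lemma cyc_inP: "cyc vs \<Longrightarrow> set vs \<subseteq> P"
proof
  fix x assume c: "cyc vs" "x \<in> set vs"
  then obtain i where "i < length vs" "x = vs ! i" by (metis in_set_conv_nth)
  then show "x \<in> P" using cyc_E[OF c(1), of i] by (simp add: E_def)
qed

lemma ear_not_hull:
  assumes "cyc (u # v # w # xs)" "ear u v w t" shows "t \<notin> set (u # v # w # xs)"
proof
  assume t: "t \<in> set (u # v # w # xs)"
  have "t \<notin> {u, v, w}" "L w u t" using assms(2) by (auto simp: ear_def pend_def)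
  then obtain i where i: "i < length xs" "t = xs ! i" using t by (auto simp: in_set_conv_nth)
  have "L ((u # v # w # xs) ! 0) ((u # v # w # xs) ! 2) ((u # v # w # xs) ! (3 + i))"
    by (rule cyc_L[OF assms(1)]) (use i in auto)
  then have "L u w t" using i by (simp add: eval_nat_numeral)
  then show False using \<open>L w u t\<close> L_asym by blast
qed

text \<open>Otherwise \<open>t\<close> would be inside the triangle \<open>xyz\<close>, all of whose
  corners lie beyond the line cutting off the cap \<open>vt\<close>.\<close>

lemma ear_not_ear:
  assumes "cap v t" "ear x y z t" "E x y" "E y z" "v \<notin> {x, y, z}" shows False
proof (rule cap_not_tri[OF assms(1), of x y z])
  have t: "t \<notin> {x, y, z}" "L z x t" "t \<in> P" using assms(2) by (auto simp: ear_def pend_def)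
  then show "x \<in> P - {v, t}" "y \<in> P - {v, t}" "z \<in> P - {v, t}" "L x y t" "L y z t" "L z x t"
    using assms(3-5) by (auto simp: E_def)
qed

text \<open>Each ear is the whole triangle, so any inner point makes all three nonempty; the cases
  record which of their first points coincide.\<close>

lemma hull_triangle:
  assumes c: "cyc [v0, v1, v2]" and n: "\<not> P \<subseteq> {v0, v1, v2}"
  shows "meets_bound P"
proof -
  have e: "E v0 v1" "E v1 v2" "E v2 v0" using cyc_E[OF c, of 0] cyc_E[OF c, of 1] cyc_E[OF c, of 2] by simp_all
  have d: "distinct [v0, v1, v2]" using c by (simp add: cyc_def)
  obtain x where x: "x \<in> P" "x \<notin> {v0, v1, v2}" using n by blast
  have ns: "\<not> short u v w" if "E w u" "x \<notin> {u, v, w}" for u v w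
    using that x L_asym unfolding short_def E_def by blast
  obtain a where a: "ear v0 v1 v2 a" using ear_cases[OF e(1,2)] ns[OF e(3), of v1] x d by auto
  obtain b where b: "ear v1 v2 v0 b" using ear_cases[OF e(2,3)] ns[OF e(1), of v2] x d by auto
  obtain t where t: "ear v2 v0 v1 t" using ear_cases[OF e(3,1)] ns[OF e(2), of v0] x d by auto
  have p: "pend v0 v1 a" "pend v1 v2 b" "pend v2 v0 t" "a \<notin> {v0, v1, v2}" "b \<notin> {v0, v1, v2}" "t \<notin> {v0, v1, v2}"
    using a b t by (auto simp: ear_def pend_def)
  consider "a = b" "b = t" | "a = b" "b \<noteq> t" | "a = t" "a \<noteq> b" | "b = t" "a \<noteq> b" | "distinct [a, b, t]" by auto
  then show ?thesis
  proof cases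
    case 1 then show ?thesis using triangle_one[OF e, of a] p d by auto
  next
    case 2 then show ?thesis using triangle_two[OF e, of a t] p d by auto
  next
    case 3 then show ?thesis using triangle_two[OF e(3,1,2), of a b] p d by auto
  next
    case 4 then show ?thesis using triangle_two[OF e(2,3,1), of b a] p d by auto
  next
    case 5 then show ?thesis using triangle_three[OF e p(1-3)] p d by auto
  qed
qed

section \<open>Quadrilateral hulls, with the reflected configuration\<close>

lemma mirror: "planar P (- s)"
  by unfold_locales (use fin gp sgn in auto)

lemma mirror_L: "planar.L (- s) a b c \<longleftrightarrow> L b a c"
  using planar.L_def[OF mirror] L_neg by simp

lemma mirror_E: "E a b \<Longrightarrow> planar.E P (- s) b a"
  unfolding planar.E_def[OF mirror] mirror_L by (auto simp: E_def)

text \<open>If \<open>z\<close> is on the side of \<open>v1v3\<close> containing \<open>v2\<close>,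
  reflect and let \<open>y\<close> be the first point seen from \<open>v2\<close>. By
  \<open>tri_star\<close>, \<open>y\<close> is \<open>z\<close> or precedes \<open>z\<close> around
  \<open>v1\<close>, and \<open>z\<close> precedes \<open>v3\<close>; so \<open>y\<close> is on that
  side too, as the reflected \<open>quadrilateral\<close> requires.\<close>

lemma quadrilateral_ear:
  assumes c: "cyc [v0, v1, v2, v3]" and z: "ear v0 v1 v2 z"
  shows "meets_bound P"
proof (cases "L v1 v3 z")
  case True
  have "z \<notin> {v0, v1, v2, v3}" using ear_not_hull[OF c z] by simp
  then show ?thesis
    using quadrilateral[of v0 v1 v2 v3 z] cyc_E[OF c, of 0] cyc_E[OF c, of 1] cyc_E[OF c, of 2] cyc_E[OF c, of 3] z True c
    by (auto simp: cyc_def)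
next
  case False
  interpret m: planar P "- s" by (rule mirror)
  have e: "E v0 v1" "E v1 v2" "E v2 v3" "E v3 v0"
    using cyc_E[OF c, of 0] cyc_E[OF c, of 1] cyc_E[OF c, of 2] cyc_E[OF c, of 3] by simp_all
  have d: "distinct [v0, v1, v2, v3]" using c by (simp add: cyc_def)
  have P: "v0 \<in> P" "v1 \<in> P" "v2 \<in> P" "v3 \<in> P" using cyc_inP[OF c] by auto
  have zn: "z \<notin> {v0, v1, v2, v3}" "z \<in> P" "L v2 v0 z" "\<And>x. x \<in> P - {v0, v1, z} \<Longrightarrow> L v0 z x"
    using ear_not_hull[OF c z] z by (auto simp: ear_def pend_def)
  have z3: "L v3 v1 z" using False L_swap[of v1 v3 z] P zn d by auto
  have me: "m.E v1 v0" "m.E v2 v1" "m.E v3 v2" "m.E v0 v3" using e mirror_E by blast+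
  have "\<not> m.short v2 v1 v0"
  proof
    assume "m.short v2 v1 v0"
    then have "L v0 v2 z" unfolding m.short_def mirror_L using zn by auto
    then show False using zn(3) L_asym by blast
  qed
  then obtain y where y: "m.ear v2 v1 v0 y" using m.ear_cases[OF me(2,1)] d by auto
  have yn: "y \<notin> {v0, v1, v2}" "y \<in> P" "L v2 v0 y" "\<And>x. x \<in> P - {v2, v1, y} \<Longrightarrow> L y v2 x"
    using y unfolding m.ear_def m.pend_def mirror_L using L_rot by auto
  have "L v0 v2 v3" using cyc_L[OF c, of 0 2 3] by (simp add: eval_nat_numeral)
  then have "y \<noteq> v3" using yn(3) L_asym by blast
  have "L v3 v1 y"
  proof (cases "y = z")
    case True then show ?thesis using z3 by simp
  next
    case yz: False
    have "\<not> L v1 z y"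
    proof
      assume "L v1 z y"
      moreover have "L v0 z y" using zn(4)[of y] yn yz by auto
      moreover have "L v2 z y" using yn(4)[of z] zn yz d L_rot by blast
      moreover have "L v0 v1 z" "L v1 v2 z" using e zn by (auto simp: E_def)
      ultimately show False using tri_star[of v0 v1 z v2 y] zn(3) by blast
    qed
    then have "L z v1 y" using L_swap[of v1 z y] P zn yn yz by auto
    then have "L v1 y z" using L_rot by blast
    moreover have "L v1 z v3" using z3 L_rot by blast
    ultimately have "L v1 y v3" using E_trans[OF e(2), of y z v3] P zn yn d by auto
    then show ?thesis using L_rot by blast
  qed
  then have "m.L v1 v3 y" by (simp add: mirror_L)
  then show ?thesis
    using m.quadrilateral[of v2 v1 v0 v3 y] me y d yn \<open>y \<noteq> v3\<close> by auto
qed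

text \<open>The diagonal \<open>v0v2\<close> leaves any inner point in the ear of \<open>v1\<close>
  or in that of \<open>v3\<close>.\<close>

lemma hull_quadrilateral:
  assumes c: "cyc [v0, v1, v2, v3]" and n: "\<not> P \<subseteq> {v0, v1, v2, v3}"
  shows "meets_bound P"
proof -
  have c2: "cyc [v2, v3, v0, v1]" using cyc_rotate[OF c, of 2] by (simp add: eval_nat_numeral)
  have e: "E v0 v1" "E v1 v2" "E v2 v3" "E v3 v0"
    using cyc_E[OF c, of 0] cyc_E[OF c, of 1] cyc_E[OF c, of 2] cyc_E[OF c, of 3] by simp_all
  have d: "distinct [v0, v1, v2, v3]" using c by (simp add: cyc_def)
  obtain x where x: "x \<in> P" "x \<notin> {v0, v1, v2, v3}" using n by blast
  have "\<not> (short v0 v1 v2 \<and> short v2 v3 v0)"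
    using x L_asym[of v0 v2 x] unfolding short_def by blast
  then show ?thesis
    using ear_cases[OF e(1,2)] ear_cases[OF e(3,4)] quadrilateral_ear[OF c] quadrilateral_ear[OF c2] d by auto
qed

text \<open>With every ear nonempty, take the first points of three consecutive ears. If two
  neighbouring ones coincide, \<open>cap_triangle\<close> applies; the outer two never coincide;
  three distinct ones give, with \<open>v3v4\<close>, four disjoint caps.\<close>

lemma hull_pentagon:
  assumes c: "cyc [v0, v1, v2, v3, v4]"
  shows "meets_bound P"
proof (rule ccontr)
  assume n: "\<not> meets_bound P"
  have c1: "cyc [v1, v2, v3, v4, v0]" using cyc_rotate[OF c, of 1] by (simp add: eval_nat_numeral)
  have c4: "cyc [v4, v0, v1, v2, v3]" using cyc_rotate[OF c, of 4] by (simp add: eval_nat_numeral)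
  have e: "E v0 v1" "E v1 v2" "E v2 v3" "E v3 v4" "E v4 v0"
    using cyc_E[OF c, of 0] cyc_E[OF c, of 1] cyc_E[OF c, of 2] cyc_E[OF c, of 3] cyc_E[OF c, of 4] by simp_all
  have d: "distinct [v0, v1, v2, v3, v4]" using c by (simp add: cyc_def)
  have n0: "\<not> short v4 v0 v1" using pentagon[of v4 v0 v1 v2 v3] e d n by auto
  have n1: "\<not> short v0 v1 v2" using pentagon[of v0 v1 v2 v3 v4] e d n by auto
  have n2: "\<not> short v1 v2 v3" using pentagon[of v1 v2 v3 v4 v0] e d n by auto
  have n3: "\<not> short v2 v3 v4" using pentagon[of v2 v3 v4 v0 v1] e d n by auto
  have n4: "\<not> short v3 v4 v0" using pentagon[of v3 v4 v0 v1 v2] e d n by auto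
  obtain t0 where t0: "ear v4 v0 v1 t0" using ear_cases[OF e(5,1)] n0 d by auto
  obtain t1 where t1: "ear v0 v1 v2 t1" using ear_cases[OF e(1,2)] n1 d by auto
  obtain t2 where t2: "ear v1 v2 v3 t2" using ear_cases[OF e(2,3)] n2 d by auto
  have h: "t0 \<notin> set [v0, v1, v2, v3, v4]" "t1 \<notin> set [v0, v1, v2, v3, v4]" "t2 \<notin> set [v0, v1, v2, v3, v4]"
    using ear_not_hull[OF c4 t0] ear_not_hull[OF c t1] ear_not_hull[OF c1 t2] by auto
  note k = ear_cap[OF t0] ear_cap[OF t1] ear_cap[OF t2] e[THEN E_cap]
  have "t0 \<noteq> t1" using cap_triangle[of v3 v4 v0 v1 t0] k n d h by auto
  moreover have "t1 \<noteq> t2" using cap_triangle[of v4 v0 v1 v2 t1] k n d h by auto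
  moreover have "t0 \<noteq> t2" using ear_not_ear[OF k(1), of v1 v2 v3] t2 e d by auto
  ultimately show False using four_caps[OF k(1-3), of v3 v4] k n d h by auto
qed

section \<open>Hexagonal hulls\<close>

lemma hexagon_opposite_ears:
  assumes c: "cyc [v0, v1, v2, v3, v4, v5]" and t: "ear v5 v0 v1 t" "ear v2 v3 v4 u"
  shows "meets_bound P"
proof -
  have c2: "cyc [v2, v3, v4, v5, v0, v1]" using cyc_rotate[OF c, of 2] by (simp add: eval_nat_numeral)
  have c5: "cyc [v5, v0, v1, v2, v3, v4]" using cyc_rotate[OF c, of 5] by (simp add: eval_nat_numeral)
  have e: "E v0 v1" "E v1 v2" "E v2 v3" "E v3 v4" "E v4 v5" "E v5 v0"
    using cyc_E[OF c, of 0] cyc_E[OF c, of 1] cyc_E[OF c, of 2] cyc_E[OF c, of 3] cyc_E[OF c, of 4] cyc_E[OF c, of 5] by simp_all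
  have d: "distinct [v0, v1, v2, v3, v4, v5]" using c by (simp add: cyc_def)
  have h: "t \<notin> set [v0, v1, v2, v3, v4, v5]" "u \<notin> set [v0, v1, v2, v3, v4, v5]"
    using ear_not_hull[OF c5 t(1)] ear_not_hull[OF c2 t(2)] by auto
  note k = t[THEN ear_cap] e[THEN E_cap]
  have "t \<noteq> u" using ear_not_ear[OF k(1), of v2 v3 v4] t(2) e d by auto
  then show ?thesis using four_caps[of v0 t v1 v2 v3 u v4 v5] k d h by auto
qed

lemma hexagon_adjacent_ears:
  assumes c: "cyc [v0, v1, v2, v3, v4, v5]" and t: "ear v5 v0 v1 t" "ear v0 v1 v2 u"
  shows "meets_bound P"
proof -
  have c5: "cyc [v5, v0, v1, v2, v3, v4]" using cyc_rotate[OF c, of 5] by (simp add: eval_nat_numeral)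
  have e: "E v0 v1" "E v1 v2" "E v2 v3" "E v3 v4" "E v4 v5" "E v5 v0"
    using cyc_E[OF c, of 0] cyc_E[OF c, of 1] cyc_E[OF c, of 2] cyc_E[OF c, of 3] cyc_E[OF c, of 4] cyc_E[OF c, of 5] by simp_all
  have d: "distinct [v0, v1, v2, v3, v4, v5]" using c by (simp add: cyc_def)
  have h: "t \<notin> set [v0, v1, v2, v3, v4, v5]" "u \<notin> set [v0, v1, v2, v3, v4, v5]"
    using ear_not_hull[OF c5 t(1)] ear_not_hull[OF c t(2)] by auto
  note k = t[THEN ear_cap] e[THEN E_cap]
  show ?thesis
  proof (cases "t = u")
    case True then show ?thesis using cap_triangle[of v4 v5 v0 v1 t] k d h by auto
  next
    case False then show ?thesis using four_caps[of v0 t v1 u v2 v3 v4 v5] k d h by auto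
  qed
qed

lemma hexagon_alternate_ears:
  assumes c: "cyc [v0, v1, v2, v3, v4, v5]" and t: "ear v0 v1 v2 t" "ear v2 v3 v4 u" and s: "short v5 v0 v1" "short v1 v2 v3"
  shows "meets_bound P"
proof -
  have e: "E v0 v1" "E v1 v2" "E v2 v3" "E v3 v4" "E v4 v5" "E v5 v0"
    using cyc_E[OF c, of 0] cyc_E[OF c, of 1] cyc_E[OF c, of 2] cyc_E[OF c, of 3] cyc_E[OF c, of 4] cyc_E[OF c, of 5] by simp_all
  have d: "distinct [v0, v1, v2, v3, v4, v5]" using c by (simp add: cyc_def)
  have "L v0 v2 v5" "L v2 v4 v5" "L v0 v2 v4"
    using cyc_L[OF c, of 0 2 5] cyc_L[OF c, of 2 4 5] cyc_L[OF c, of 0 2 4] by (simp_all add: eval_nat_numeral)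
  then have "L v2 v5 v0" "L v2 v4 v5" "L v2 v4 v0" using L_rot by blast+
  then show ?thesis using hexagon_two_ears[OF e s t] d by blast
qed

lemma hexagon_few_ears:
  assumes c: "cyc [v0, v1, v2, v3, v4, v5]" and s: "short v5 v0 v1" "short v1 v2 v3" "short v2 v3 v4" "short v3 v4 v5" "short v4 v5 v0"
  shows "meets_bound P"
proof -
  have e: "E v0 v1" "E v1 v2" "E v2 v3" "E v3 v4" "E v4 v5" "E v5 v0"
    using cyc_E[OF c, of 0] cyc_E[OF c, of 1] cyc_E[OF c, of 2] cyc_E[OF c, of 3] cyc_E[OF c, of 4] cyc_E[OF c, of 5] by simp_all
  have d: "distinct [v0, v1, v2, v3, v4, v5]" using c by (simp add: cyc_def)
  let ?h = "{v0, v1, v2, v3, v4, v5}"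
  show ?thesis
  proof (cases "\<exists>y z. y \<in> P - ?h \<and> z \<in> P - ?h \<and> y \<noteq> z")
    case True
    then obtain y z where "y \<in> P - ?h" "z \<in> P - ?h" "y \<noteq> z" by blast
    then show ?thesis using hexagon_open[OF e s(1,2,3,5), of y z] d by auto
  next
    case few: False
    show ?thesis
    proof (cases "short v0 v1 v2")
      case True
      show ?thesis
      proof (cases "P \<subseteq> ?h")
        case True then show ?thesis using hexagon_convex[OF e d] by blast
      next
        case False
        then obtain z where z: "z \<in> P - ?h" by blast
        then have "P \<subseteq> {v0, v1, v2, v3, v4, v5, z}" using few by blast
        moreover have "L v0 v2 v5" "L v2 v4 v5"
          using cyc_L[OF c, of 0 2 5] cyc_L[OF c, of 2 4 5] by (simp_all add: eval_nat_numeral)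
        then have "L v2 v5 v0" "L v2 v4 v5" using L_rot by blast+
        ultimately show ?thesis using hexagon_centre[OF e s(1) True s(2-5), of z] z d by auto
      qed
    next
      case False
      then obtain z where z: "ear v0 v1 v2 z" using ear_cases[OF e(1,2)] d by auto
      have zn: "z \<in> P - ?h" using ear_not_hull[OF c z] z by (auto simp: ear_def pend_def)
      then have "P \<subseteq> {v0, v1, v2, v3, v4, v5, z}" using few by blast
      then show ?thesis using hexagon_one_ear[OF e s ear_cap[OF z]] zn d by auto
    qed
  qed
qed

text \<open>Two nonempty ears on the 6-cycle are opposite, adjacent or at distance two. Excluding
  adjacent ones supplies the empty ears that the distance-two case requires, so at most one nonempty
  ear is left.\<close>

lemma hull_hexagon:
  assumes c: "cyc [v0, v1, v2, v3, v4, v5]"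
  shows "meets_bound P"
proof (rule ccontr)
  assume n: "\<not> meets_bound P"
  have c1: "cyc [v1, v2, v3, v4, v5, v0]" using cyc_rotate[OF c, of 1] by (simp add: eval_nat_numeral)
  have c2: "cyc [v2, v3, v4, v5, v0, v1]" using cyc_rotate[OF c, of 2] by (simp add: eval_nat_numeral)
  have c3: "cyc [v3, v4, v5, v0, v1, v2]" using cyc_rotate[OF c, of 3] by (simp add: eval_nat_numeral)
  have c4: "cyc [v4, v5, v0, v1, v2, v3]" using cyc_rotate[OF c, of 4] by (simp add: eval_nat_numeral)
  have c5: "cyc [v5, v0, v1, v2, v3, v4]" using cyc_rotate[OF c, of 5] by (simp add: eval_nat_numeral)
  have e: "E v0 v1" "E v1 v2" "E v2 v3" "E v3 v4" "E v4 v5" "E v5 v0"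
    using cyc_E[OF c, of 0] cyc_E[OF c, of 1] cyc_E[OF c, of 2] cyc_E[OF c, of 3] cyc_E[OF c, of 4] cyc_E[OF c, of 5] by simp_all
  have d: "distinct [v0, v1, v2, v3, v4, v5]" using c by (simp add: cyc_def)
  let ?r = "\<lambda>u v w. \<exists>t. ear u v w t"
  have a0: "short v5 v0 v1 \<or> ?r v5 v0 v1" using ear_cases[OF e(6,1)] d by auto
  have a1: "short v0 v1 v2 \<or> ?r v0 v1 v2" using ear_cases[OF e(1,2)] d by auto
  have a2: "short v1 v2 v3 \<or> ?r v1 v2 v3" using ear_cases[OF e(2,3)] d by auto
  have a3: "short v2 v3 v4 \<or> ?r v2 v3 v4" using ear_cases[OF e(3,4)] d by auto
  have a4: "short v3 v4 v5 \<or> ?r v3 v4 v5" using ear_cases[OF e(4,5)] d by auto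
  have a5: "short v4 v5 v0 \<or> ?r v4 v5 v0" using ear_cases[OF e(5,6)] d by auto
  have op: "\<not> (?r v5 v0 v1 \<and> ?r v2 v3 v4)"
    "\<not> (?r v0 v1 v2 \<and> ?r v3 v4 v5)"
    "\<not> (?r v1 v2 v3 \<and> ?r v4 v5 v0)"
    using n hexagon_opposite_ears[OF c] hexagon_opposite_ears[OF c1] hexagon_opposite_ears[OF c2] by blast+
  have ad: "\<not> (?r v5 v0 v1 \<and> ?r v0 v1 v2)"
    "\<not> (?r v0 v1 v2 \<and> ?r v1 v2 v3)"
    "\<not> (?r v1 v2 v3 \<and> ?r v2 v3 v4)"
    "\<not> (?r v2 v3 v4 \<and> ?r v3 v4 v5)"
    "\<not> (?r v3 v4 v5 \<and> ?r v4 v5 v0)"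
    "\<not> (?r v4 v5 v0 \<and> ?r v5 v0 v1)"
    using n hexagon_adjacent_ears[OF c] hexagon_adjacent_ears[OF c1] hexagon_adjacent_ears[OF c2] hexagon_adjacent_ears[OF c3] hexagon_adjacent_ears[OF c4] hexagon_adjacent_ears[OF c5] by blast+
  have al: "\<not> (?r v0 v1 v2 \<and> ?r v2 v3 v4 \<and> short v5 v0 v1 \<and> short v1 v2 v3)"
    "\<not> (?r v1 v2 v3 \<and> ?r v3 v4 v5 \<and> short v0 v1 v2 \<and> short v2 v3 v4)"
    "\<not> (?r v2 v3 v4 \<and> ?r v4 v5 v0 \<and> short v1 v2 v3 \<and> short v3 v4 v5)"
    "\<not> (?r v3 v4 v5 \<and> ?r v5 v0 v1 \<and> short v2 v3 v4 \<and> short v4 v5 v0)"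
    "\<not> (?r v4 v5 v0 \<and> ?r v0 v1 v2 \<and> short v3 v4 v5 \<and> short v5 v0 v1)"
    "\<not> (?r v5 v0 v1 \<and> ?r v1 v2 v3 \<and> short v4 v5 v0 \<and> short v0 v1 v2)"
    using n hexagon_alternate_ears[OF c] hexagon_alternate_ears[OF c1] hexagon_alternate_ears[OF c2] hexagon_alternate_ears[OF c3] hexagon_alternate_ears[OF c4] hexagon_alternate_ears[OF c5] by blast+
  have fw: "\<not> (short v5 v0 v1 \<and> short v1 v2 v3 \<and> short v2 v3 v4 \<and> short v3 v4 v5 \<and> short v4 v5 v0)"
    "\<not> (short v0 v1 v2 \<and> short v2 v3 v4 \<and> short v3 v4 v5 \<and> short v4 v5 v0 \<and> short v5 v0 v1)"
    "\<not> (short v1 v2 v3 \<and> short v3 v4 v5 \<and> short v4 v5 v0 \<and> short v5 v0 v1 \<and> short v0 v1 v2)"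
    "\<not> (short v2 v3 v4 \<and> short v4 v5 v0 \<and> short v5 v0 v1 \<and> short v0 v1 v2 \<and> short v1 v2 v3)"
    "\<not> (short v3 v4 v5 \<and> short v5 v0 v1 \<and> short v0 v1 v2 \<and> short v1 v2 v3 \<and> short v2 v3 v4)"
    "\<not> (short v4 v5 v0 \<and> short v0 v1 v2 \<and> short v1 v2 v3 \<and> short v2 v3 v4 \<and> short v3 v4 v5)"
    using n hexagon_few_ears[OF c] hexagon_few_ears[OF c1] hexagon_few_ears[OF c2] hexagon_few_ears[OF c3] hexagon_few_ears[OF c4] hexagon_few_ears[OF c5] by blast+
  show False using a0 a1 a2 a3 a4 a5 op ad al fw by argo
qed

section \<open>Heptagonal hulls\<close>

lemma heptagon_ear:
  assumes c: "cyc [v0, v1, v2, v3, v4, v5, v6]" and t: "ear v6 v0 v1 t"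
  shows "meets_bound P"
proof -
  have c6: "cyc [v6, v0, v1, v2, v3, v4, v5]" using cyc_rotate[OF c, of 6] by (simp add: eval_nat_numeral)
  have e: "E v0 v1" "E v1 v2" "E v2 v3" "E v3 v4" "E v4 v5" "E v5 v6" "E v6 v0"
    using cyc_E[OF c, of 0] cyc_E[OF c, of 1] cyc_E[OF c, of 2] cyc_E[OF c, of 3] cyc_E[OF c, of 4] cyc_E[OF c, of 5] cyc_E[OF c, of 6] by simp_all
  have d: "distinct [v0, v1, v2, v3, v4, v5, v6]" using c by (simp add: cyc_def)
  have h: "t \<notin> set [v0, v1, v2, v3, v4, v5, v6]" using ear_not_hull[OF c6 t] by auto
  show ?thesis using four_caps[OF ear_cap[OF t], of v1 v2 v3 v4 v5 v6] e[THEN E_cap] d h by auto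
qed

lemma heptagon_empty_quad:
  assumes c: "cyc [v0, v1, v2, v3, v4, v5, v6]" and s: "short v6 v0 v1" "short v0 v1 v2" "short v1 v2 v3" "short v2 v3 v4" "short v3 v4 v5" "short v4 v5 v6" "short v5 v6 v0"
    and z: "z \<in> P" "z \<notin> set [v0, v1, v2, v3, v4, v5, v6]" and q: "\<And>x. x \<in> P \<Longrightarrow> x \<notin> set [v0, v1, v2, v3, v4, v5, v6] \<Longrightarrow> \<not> L v6 v3 x"
  shows "meets_bound P"
proof -
  have e: "E v0 v1" "E v1 v2" "E v2 v3" "E v3 v4" "E v4 v5" "E v5 v6" "E v6 v0"
    using cyc_E[OF c, of 0] cyc_E[OF c, of 1] cyc_E[OF c, of 2] cyc_E[OF c, of 3] cyc_E[OF c, of 4] cyc_E[OF c, of 5] cyc_E[OF c, of 6] by simp_all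
  have d: "distinct [v0, v1, v2, v3, v4, v5, v6]" using c by (simp add: cyc_def)
  have P: "v3 \<in> P" "v6 \<in> P" using cyc_inP[OF c] by auto
  have v: "L v0 v3 v6" "L v1 v3 v6" "L v2 v3 v6"
    using cyc_L[OF c, of 0 3 6] cyc_L[OF c, of 1 3 6] cyc_L[OF c, of 2 3 6] by (simp_all add: eval_nat_numeral)
  have side: "L v3 v6 x" if x: "x \<in> P" "x \<notin> {v3, v4, v5, v6}" for x
  proof (cases "x \<in> {v0, v1, v2}")
    case True then show ?thesis using v L_rot by blast
  next
    case False
    then have "\<not> L v6 v3 x" using q x by simp
    then show ?thesis using L_swap[of v6 v3 x] P x d by auto
  qed
  have "guard v3 v6 {v3, v4, v5, v6}" unfolding guard_def
  proof (intro ballI)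
    fix p r assume "p \<in> P - {v3, v4, v5, v6}" "r \<in> P - {v3, v4, v5, v6}"
    then have "L v3 v6 p" "L v3 v6 r" using side by auto
    then have "dj v3 v6 p r" by (intro sep[of v3 v6 v3 v6 p r]) auto
    then show "dj p r v3 v6" by (simp add: dj_sym)
  qed
  then show ?thesis using heptagon_spoke[OF e s, of z] z d by auto
qed

lemma same_side_dj2:
  assumes "a \<in> P" "b \<in> P" "y \<in> P" "z \<in> P" "distinct [a, b, y, z]" "L b a y \<longleftrightarrow> L b a z"
  shows "dj y z a b"
  using same_side_dj[of b a y z] assms dj_sym[of y z b a] dj_flip2[of y z a b] by auto

lemma heptagon_close_pair:
  assumes c: "cyc [v0, v1, v2, v3, v4, v5, v6]" and s: "short v6 v0 v1" "short v0 v1 v2" "short v1 v2 v3" "short v2 v3 v4" "short v3 v4 v5" "short v4 v5 v6" "short v5 v6 v0"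
    and y: "y \<in> P" "y \<notin> set [v0, v1, v2, v3, v4, v5, v6]" and z: "z \<in> P" "z \<notin> set [v0, v1, v2, v3, v4, v5, v6]" and yz: "y \<noteq> z"
    and m: "L v3 v0 y \<longleftrightarrow> L v3 v0 z" "L v4 v1 y \<longleftrightarrow> L v4 v1 z"
  shows "meets_bound P"
proof -
  have e: "E v0 v1" "E v1 v2" "E v2 v3" "E v3 v4" "E v4 v5" "E v5 v6" "E v6 v0"
    using cyc_E[OF c, of 0] cyc_E[OF c, of 1] cyc_E[OF c, of 2] cyc_E[OF c, of 3] cyc_E[OF c, of 4] cyc_E[OF c, of 5] cyc_E[OF c, of 6] by simp_all
  have d: "distinct [v0, v1, v2, v3, v4, v5, v6]" using c by (simp add: cyc_def)
  have P: "v0 \<in> P" "v1 \<in> P" "v3 \<in> P" "v4 \<in> P" using cyc_inP[OF c] by auto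
  have "dj y z v0 v3" by (rule same_side_dj2) (use P y z yz d m in auto)
  moreover have "dj y z v1 v4" by (rule same_side_dj2) (use P y z yz d m in auto)
  ultimately show ?thesis using heptagon_pair[OF e s, of y z] y z yz d by auto
qed

text \<open>The quadrilaterals \<open>v0v1v2v3\<close> and \<open>v3v4v5v6\<close> meet only in
  \<open>v3\<close>: around \<open>v3\<close>, the vertex \<open>v6\<close> precedes
  \<open>v0\<close>, and \<open>v0\<close> precedes every point beyond the chord
  \<open>v0v3\<close>.\<close>

lemma heptagon_quads_disjoint:
  assumes c: "cyc [v0, v1, v2, v3, v4, v5, v6]" and x: "x \<in> P" "x \<notin> set [v0, v1, v2, v3, v4, v5, v6]"
  shows "\<not> (L v3 v0 x \<and> L v6 v3 x)"
proof
  assume h: "L v3 v0 x \<and> L v6 v3 x"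
  have e: "E v0 v1" "E v1 v2" "E v2 v3" "E v3 v4" "E v4 v5" "E v5 v6" "E v6 v0"
    using cyc_E[OF c, of 0] cyc_E[OF c, of 1] cyc_E[OF c, of 2] cyc_E[OF c, of 3] cyc_E[OF c, of 4] cyc_E[OF c, of 5] cyc_E[OF c, of 6] by simp_all
  have d: "distinct [v0, v1, v2, v3, v4, v5, v6]" using c by (simp add: cyc_def)
  have P: "v0 \<in> P" "v3 \<in> P" "v6 \<in> P" using cyc_inP[OF c] by auto
  have "L v0 v3 v6" using cyc_L[OF c, of 0 3 6] by (simp add: eval_nat_numeral)
  then have "L v3 v6 v0" using L_rot by blast
  then have "L v3 v6 x" using h E_trans[OF e(4), of v6 v0 x] P x d by auto
  then show False using h L_asym by blast
qed

lemma hull_heptagon: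
  assumes c: "cyc [v0, v1, v2, v3, v4, v5, v6]"
  shows "meets_bound P"
proof (rule ccontr)
  assume n: "\<not> meets_bound P"
  have c1: "cyc [v1, v2, v3, v4, v5, v6, v0]" using cyc_rotate[OF c, of 1] by (simp add: eval_nat_numeral)
  have c2: "cyc [v2, v3, v4, v5, v6, v0, v1]" using cyc_rotate[OF c, of 2] by (simp add: eval_nat_numeral)
  have c3: "cyc [v3, v4, v5, v6, v0, v1, v2]" using cyc_rotate[OF c, of 3] by (simp add: eval_nat_numeral)
  have c4: "cyc [v4, v5, v6, v0, v1, v2, v3]" using cyc_rotate[OF c, of 4] by (simp add: eval_nat_numeral)
  have c5: "cyc [v5, v6, v0, v1, v2, v3, v4]" using cyc_rotate[OF c, of 5] by (simp add: eval_nat_numeral)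
  have c6: "cyc [v6, v0, v1, v2, v3, v4, v5]" using cyc_rotate[OF c, of 6] by (simp add: eval_nat_numeral)
  have e: "E v0 v1" "E v1 v2" "E v2 v3" "E v3 v4" "E v4 v5" "E v5 v6" "E v6 v0"
    using cyc_E[OF c, of 0] cyc_E[OF c, of 1] cyc_E[OF c, of 2] cyc_E[OF c, of 3] cyc_E[OF c, of 4] cyc_E[OF c, of 5] cyc_E[OF c, of 6] by simp_all
  have d: "distinct [v0, v1, v2, v3, v4, v5, v6]" using c by (simp add: cyc_def)
  have s0: "short v6 v0 v1" using ear_cases[OF e(7,1)] heptagon_ear[OF c] n d by auto
  have s1: "short v0 v1 v2" using ear_cases[OF e(1,2)] heptagon_ear[OF c1] n d by auto
  have s2: "short v1 v2 v3" using ear_cases[OF e(2,3)] heptagon_ear[OF c2] n d by auto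
  have s3: "short v2 v3 v4" using ear_cases[OF e(3,4)] heptagon_ear[OF c3] n d by auto
  have s4: "short v3 v4 v5" using ear_cases[OF e(4,5)] heptagon_ear[OF c4] n d by auto
  have s5: "short v4 v5 v6" using ear_cases[OF e(5,6)] heptagon_ear[OF c5] n d by auto
  have s6: "short v5 v6 v0" using ear_cases[OF e(6,7)] heptagon_ear[OF c6] n d by auto
  note s = s0 s1 s2 s3 s4 s5 s6
  let ?Q = "P - set [v0, v1, v2, v3, v4, v5, v6]"
  have "\<not> P \<subseteq> set [v0, v1, v2, v3, v4, v5, v6]" using heptagon_convex[OF e s c d] n by auto
  then obtain w where w: "w \<in> ?Q" by blast
  \<comment> \<open>From here on only the incidences between inner points and the seven chords
    \<open>v_k v_(k+3)\<close> matter. Some point lies beyond each chord, as otherwise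
    \<open>heptagon_empty_quad\<close> applies to a rotation.\<close>
  have q0: "\<exists>x\<in>?Q. L v3 v0 x"
    using heptagon_empty_quad[OF c4 s4 s5 s6 s0 s1 s2 s3, of w] w n by auto
  have q1: "\<exists>x\<in>?Q. L v4 v1 x"
    using heptagon_empty_quad[OF c5 s5 s6 s0 s1 s2 s3 s4, of w] w n by auto
  have q2: "\<exists>x\<in>?Q. L v5 v2 x"
    using heptagon_empty_quad[OF c6 s6 s0 s1 s2 s3 s4 s5, of w] w n by auto
  have q3: "\<exists>x\<in>?Q. L v6 v3 x"
    using heptagon_empty_quad[OF c s0 s1 s2 s3 s4 s5 s6, of w] w n by auto
  have q4: "\<exists>x\<in>?Q. L v0 v4 x"
    using heptagon_empty_quad[OF c1 s1 s2 s3 s4 s5 s6 s0, of w] w n by auto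
  have q5: "\<exists>x\<in>?Q. L v1 v5 x"
    using heptagon_empty_quad[OF c2 s2 s3 s4 s5 s6 s0 s1, of w] w n by auto
  have q6: "\<exists>x\<in>?Q. L v2 v6 x"
    using heptagon_empty_quad[OF c3 s3 s4 s5 s6 s0 s1 s2, of w] w n by auto
  have x0: "\<not> (L v3 v0 x \<and> L v6 v3 x)" if "x \<in> ?Q" for x
    using heptagon_quads_disjoint[OF c, of x] that by auto
  have x1: "\<not> (L v4 v1 x \<and> L v0 v4 x)" if "x \<in> ?Q" for x
    using heptagon_quads_disjoint[OF c1, of x] that by auto
  have x2: "\<not> (L v5 v2 x \<and> L v1 v5 x)" if "x \<in> ?Q" for x
    using heptagon_quads_disjoint[OF c2, of x] that by auto
  have x3: "\<not> (L v6 v3 x \<and> L v2 v6 x)" if "x \<in> ?Q" for x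
    using heptagon_quads_disjoint[OF c3, of x] that by auto
  have x4: "\<not> (L v0 v4 x \<and> L v3 v0 x)" if "x \<in> ?Q" for x
    using heptagon_quads_disjoint[OF c4, of x] that by auto
  have x5: "\<not> (L v1 v5 x \<and> L v4 v1 x)" if "x \<in> ?Q" for x
    using heptagon_quads_disjoint[OF c5, of x] that by auto
  have x6: "\<not> (L v2 v6 x \<and> L v5 v2 x)" if "x \<in> ?Q" for x
    using heptagon_quads_disjoint[OF c6, of x] that by auto
  have y0: "\<not> ((L v3 v0 x \<longleftrightarrow> L v3 v0 y) \<and> (L v4 v1 x \<longleftrightarrow> L v4 v1 y))" if "x \<in> ?Q" "y \<in> ?Q" "x \<noteq> y" for x y
    using heptagon_close_pair[OF c s0 s1 s2 s3 s4 s5 s6, of x y] that n by auto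
  have y1: "\<not> ((L v4 v1 x \<longleftrightarrow> L v4 v1 y) \<and> (L v5 v2 x \<longleftrightarrow> L v5 v2 y))" if "x \<in> ?Q" "y \<in> ?Q" "x \<noteq> y" for x y
    using heptagon_close_pair[OF c1 s1 s2 s3 s4 s5 s6 s0, of x y] that n by auto
  have y2: "\<not> ((L v5 v2 x \<longleftrightarrow> L v5 v2 y) \<and> (L v6 v3 x \<longleftrightarrow> L v6 v3 y))" if "x \<in> ?Q" "y \<in> ?Q" "x \<noteq> y" for x y
    using heptagon_close_pair[OF c2 s2 s3 s4 s5 s6 s0 s1, of x y] that n by auto
  have y3: "\<not> ((L v6 v3 x \<longleftrightarrow> L v6 v3 y) \<and> (L v0 v4 x \<longleftrightarrow> L v0 v4 y))" if "x \<in> ?Q" "y \<in> ?Q" "x \<noteq> y" for x y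
    using heptagon_close_pair[OF c3 s3 s4 s5 s6 s0 s1 s2, of x y] that n by auto
  have y4: "\<not> ((L v0 v4 x \<longleftrightarrow> L v0 v4 y) \<and> (L v1 v5 x \<longleftrightarrow> L v1 v5 y))" if "x \<in> ?Q" "y \<in> ?Q" "x \<noteq> y" for x y
    using heptagon_close_pair[OF c4 s4 s5 s6 s0 s1 s2 s3, of x y] that n by auto
  have y5: "\<not> ((L v1 v5 x \<longleftrightarrow> L v1 v5 y) \<and> (L v2 v6 x \<longleftrightarrow> L v2 v6 y))" if "x \<in> ?Q" "y \<in> ?Q" "x \<noteq> y" for x y
    using heptagon_close_pair[OF c5 s5 s6 s0 s1 s2 s3 s4, of x y] that n by auto
  have y6: "\<not> ((L v2 v6 x \<longleftrightarrow> L v2 v6 y) \<and> (L v3 v0 x \<longleftrightarrow> L v3 v0 y))" if "x \<in> ?Q" "y \<in> ?Q" "x \<noteq> y" for x y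
    using heptagon_close_pair[OF c6 s6 s0 s1 s2 s3 s4 s5, of x y] that n by auto
  obtain x where x: "x \<in> ?Q" "L v3 v0 x" using q0 by blast
  obtain y where y: "y \<in> ?Q" "L v6 v3 y" using q3 by blast
  have "x \<noteq> y" using x0[OF x(1)] x(2) y(2) by blast
  text \<open>No point lies beyond two of the chords \<open>v\<^sub>k v\<^sub>k\<^sub>+\<^sub>3\<close> with indices differing by 3, and these differences
    form a 7-cycle, so two points lie beyond at most six of the seven chords.\<close>
  have "(\<not> L v3 v0 x \<and> \<not> L v3 v0 y) \<or> (\<not> L v4 v1 x \<and> \<not> L v4 v1 y) \<or> (\<not> L v5 v2 x \<and> \<not> L v5 v2 y) \<or> (\<not> L v6 v3 x \<and> \<not> L v6 v3 y) \<or> (\<not> L v0 v4 x \<and> \<not> L v0 v4 y) \<or> (\<not> L v1 v5 x \<and> \<not> L v1 v5 y) \<or> (\<not> L v2 v6 x \<and> \<not> L v2 v6 y)"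
    using x0[OF x(1)] x1[OF x(1)] x2[OF x(1)] x3[OF x(1)] x4[OF x(1)] x5[OF x(1)] x6[OF x(1)] x0[OF y(1)] x1[OF y(1)] x2[OF y(1)] x3[OF y(1)] x4[OF y(1)] x5[OF y(1)] x6[OF y(1)] by argo
  then obtain z where z: "z \<in> ?Q" "x \<noteq> z" "y \<noteq> z"
    using q0 q1 q2 q3 q4 q5 q6 by metis
  \<comment> \<open>Two consecutive chords distinguish \<open>x\<close>, \<open>y\<close>,
    \<open>z\<close> pairwise, so each chord singles out one of them, being alone on its side, and
    consecutive chords single out different points. If two points were beyond chord
    \<open>k\<close>, only the third could be beyond chords \<open>k+3\<close> and
    \<open>k+4\<close>, which are consecutive. So exactly one point is beyond each chord, and it
    differs for indices at distance 1 or 3. As no three indices modulo 7 have pairwise distance 2,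
    each point serves at most two chords, which accounts for only six.\<close>
  show False
    using x0[OF x(1)] x1[OF x(1)] x2[OF x(1)] x3[OF x(1)] x4[OF x(1)] x5[OF x(1)] x6[OF x(1)] x0[OF y(1)] x1[OF y(1)] x2[OF y(1)] x3[OF y(1)] x4[OF y(1)] x5[OF y(1)] x6[OF y(1)] x0[OF z(1)] x1[OF z(1)] x2[OF z(1)] x3[OF z(1)] x4[OF z(1)] x5[OF z(1)] x6[OF z(1)]
      y0[OF x(1) y(1) \<open>x \<noteq> y\<close>] y1[OF x(1) y(1) \<open>x \<noteq> y\<close>] y2[OF x(1) y(1) \<open>x \<noteq> y\<close>] y3[OF x(1) y(1) \<open>x \<noteq> y\<close>] y4[OF x(1) y(1) \<open>x \<noteq> y\<close>] y5[OF x(1) y(1) \<open>x \<noteq> y\<close>] y6[OF x(1) y(1) \<open>x \<noteq> y\<close>] y0[OF x(1) z(1) z(2)] y1[OF x(1) z(1) z(2)] y2[OF x(1) z(1) z(2)] y3[OF x(1) z(1) z(2)] y4[OF x(1) z(1) z(2)] y5[OF x(1) z(1) z(2)] y6[OF x(1) z(1) z(2)] y0[OF y(1) z(1) z(3)] y1[OF y(1) z(1) z(3)] y2[OF y(1) z(1) z(3)] y3[OF y(1) z(1) z(3)] y4[OF y(1) z(1) z(3)] y5[OF y(1) z(1) z(3)] y6[OF y(1) z(1) z(3)] by argo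
qed

section \<open>Hulls with at least eight vertices, and the combination of all cases\<close>

lemma hull_large:
  assumes c: "cyc vs" and l: "8 \<le> length vs" shows "meets_bound P"
proof -
  have d: "vs ! i \<noteq> vs ! j" if "i < 8" "j < 8" "i \<noteq> j" for i j
    using c l that by (simp add: cyc_def nth_eq_iff_index_eq)
  have k: "cap (vs ! i) (vs ! Suc i)" if "i < 7" for i
    using cyc_E[OF c, of i] E_cap l that by simp
  have "distinct [vs ! 0, vs ! 1, vs ! 2, vs ! 3, vs ! 4, vs ! 5, vs ! 6, vs ! 7]"
    using d by simp
  then show ?thesis
    using four_caps[of "vs ! 0" "vs ! 1" "vs ! 2" "vs ! 3" "vs ! 4" "vs ! 5" "vs ! 6" "vs ! 7"] k[of 0] k[of 2] k[of 4] k[of 6]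
    by (simp add: eval_nat_numeral)
qed

lemma planar_meets_bound: assumes n: "card P \<ge> 5" shows "meets_bound P"
proof -
  obtain vs where c: "cyc vs" using cyc_exists n by fastforce
  then have "3 \<le> length vs" by (simp add: cyc_def)
  then consider "length vs = 3" | "length vs = 4" | "length vs = 5" | "length vs = 6" | "length vs = 7" | "8 \<le> length vs"
    by linarith
  then show ?thesis
  proof cases
    case 1
    then obtain a b d where vs: "vs = [a, b, d]" by (auto simp: numeral_eq_Suc length_Suc_conv)
    have "\<not> P \<subseteq> {a, b, d}"
    proof
      assume "P \<subseteq> {a, b, d}"
      then have "card P \<le> card {a, b, d}" by (intro card_mono) auto
      also have "\<dots> \<le> 3" by (simp add: card_insert_if)
      finally show False using n by simp
    qed
    then show ?thesis using hull_triangle c vs by blast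
  next
    case 2
    then obtain a b d e where vs: "vs = [a, b, d, e]" by (auto simp: numeral_eq_Suc length_Suc_conv)
    have "\<not> P \<subseteq> {a, b, d, e}"
    proof
      assume "P \<subseteq> {a, b, d, e}"
      then have "card P \<le> card {a, b, d, e}" by (intro card_mono) auto
      also have "\<dots> \<le> 4" by (simp add: card_insert_if)
      finally show False using n by simp
    qed
    then show ?thesis using hull_quadrilateral c vs by blast
  next
    case 3
    then obtain a b d e f where "vs = [a, b, d, e, f]" by (auto simp: numeral_eq_Suc length_Suc_conv)
    then show ?thesis using hull_pentagon c by blast
  next
    case 4
    then obtain a b d e f g where "vs = [a, b, d, e, f, g]" by (auto simp: numeral_eq_Suc length_Suc_conv)
    then show ?thesis using hull_hexagon c by blast
  next
    case 5
    then obtain a b d e f g h where "vs = [a, b, d, e, f, g, h]" by (auto simp: numeral_eq_Suc length_Suc_conv)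
    then show ?thesis using hull_heptagon c by blast
  next
    case 6 then show ?thesis using hull_large c by blast
  qed
qed

end

theorem theorem2:
  fixes P :: "(real^2) set" and n :: nat
  assumes "finite P" and "card P = n" and "n \<ge> 5" and "general_position P"
  shows "int (mu (seg_vertices P) disj_adj) \<ge> int (n choose 2) - 9"
proof -
  interpret planar P 1 by unfold_locales (use assms in auto)
  show ?thesis using planar_meets_bound assms unfolding meets_bound_def by simp
qed

end
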